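(* Let $M_0,M_0'\subset N_0$ be two lattices with $\epsilon M_0^{\vee}\stackrel{1}{\subset}M_0\stackrel{n-1}{\subset}M_0^{\vee}$ and $\epsilon M_0'^{\vee}\stackrel{1}{\subset}M_0'\stackrel{n-1}{\subset}M_0'^{\vee}$. Then $M_0$ and $M_0'$ have the same Vollaard-Wedhorn invariant $(\Lambda,d)$ if and only if $\mathrm{inv}(M_0,\Lambda')=\mathrm{inv}(M_0',\Lambda')$ for all $\tau$-invariant lattices $\Lambda'\subseteq N_0$ with $\epsilon^i(\Lambda')^{\vee}\stackrel{1}{\subset}\Lambda'\stackrel{n-1}{\subset}\epsilon^{i-1}(\Lambda')^{\vee}$ for some $i\in\mathbb Z$.
   Context: Let $k$ be a finite field with $q=p^r$ elements, and let either $F=W(k)[1/p]$, $\epsilon=p$, or $F=k((t))$, $\epsilon=t$. Let $L$ be the completion of the maximal unramified extension of $F$, with valuation ring $\mathcal O_L$ and Frobenius $\sigma$ over $F$. Let $E\subset L$ be the unramified quadratic extension of $F$ and fix $\delta\in\mathcal O_E^{\times}$ with $\sigma(\delta)=-\delta$. Let $N$ be the $L$-vector space with basis $g_1,h_1,\dots,g_n,h_n$, with the $\sigma$-linear bijection $\Phi$ given by $\Phi(g_i)=\epsilon h_i$, $\Phi(h_i)=g_i$ for $1\le i\le n-1$ and $\Phi(g_n)=h_n$, $\Phi(h_n)=\epsilon g_n$, and with the alternating $L$-bilinear form $\langle\cdot,\cdot\rangle$ with $\langle g_i,h_i\rangle=\delta$ and all other pairings of basis vectors $g_i,h_j$, $g_i,g_j$,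 $h_i,h_j$ ($i\neq j$) equal to $0$. (This is the supersingular unitary isocrystal of signature $(1,n-1)$.) Let $N_0$ be the span of $g_1,\dots,g_n$. Define on $N_0$ the form $\{x,y\}=\delta\langle x,\Phi y\rangle$ ($L$-linear in $x$, $\sigma$-linear in $y$), and let $\tau=\epsilon^{-1}\Phi^2:N_0\to N_0$, a $\sigma^2$-linear bijection. All lattices are $\mathcal O_L$-lattices in $N_0$. For a lattice $M_0$, its dual is $M_0^{\vee}=\{x\in N_0\mid\{x,M_0\}\subseteq\mathcal O_L\}$. The notation $A\stackrel{s}{\subset}B$ means $A\subseteq B$ with $B/A$ of $\mathcal O_L$-length $s$. For lattices $M_1,M_2$ in $N_0$, $\mathrm{inv}(M_1,M_2)\in\{(a_1\ge\dots\ge a_n)\in\mathbb Z^n\}$ is their relative position (given by elementary divisors). For a lattice $M_0$ with $\epsilon M_0^{\vee}\stackrel{1}{\subset}M_0\stackrel{n-1}{\subset}M_0^{\vee}$, its Vollaard-Wedhorn invariant is the pair $(\Lambda,d)$ where $d\ge0$ is minimal such that $\Lambda=M_0+\tau(M_0)+\dots+\tau^d(M_0)$ is $\tau$-invariant; $\Lambda$ is the smallest $\tau$-invariant lattice containing $M_0$. *)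

theory Defs
  imports
    "HOL-Library.Extended_Nat"
    "HOL-Computational_Algebra.Formal_Laurent_Series"
    "HOL-Algebra.Algebraic_Closure_Type"
begin

section \<open>Discretely valued fields\<close>

text \<open>The whole type 'l is the big field L, and subfields of L are sets. A normalised discrete
  valuation is a function v to the integers; its value at 0 is irrelevant.\<close>

definition discrete_valuation :: "('l::field \<Rightarrow> int) \<Rightarrow> bool" where
  "discrete_valuation v \<longleftrightarrow>
     (\<forall>x y. x \<noteq> 0 \<longrightarrow> y \<noteq> 0 \<longrightarrow> v (x * y) = v x + v y) \<and>
     (\<forall>x y. x \<noteq> 0 \<longrightarrow> y \<noteq> 0 \<longrightarrow> x + y \<noteq> 0 \<longrightarrow> min (v x) (v y) \<le> v (x + y)) \<and>
     v ` (UNIV - {0}) = UNIV"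

definition val_ge :: "('l::field \<Rightarrow> int) \<Rightarrow> int \<Rightarrow> 'l set" where
  "val_ge v m = {x. x = 0 \<or> m \<le> v x}"

abbreviation int_ring :: "('l::field \<Rightarrow> int) \<Rightarrow> 'l set" where
  "int_ring v \<equiv> val_ge v 0"

definition is_subfield :: "'l::field set \<Rightarrow> bool" where
  "is_subfield K \<longleftrightarrow> 0 \<in> K \<and> 1 \<in> K \<and>
     (\<forall>x\<in>K. \<forall>y\<in>K. x + y \<in> K \<and> x * y \<in> K) \<and> (\<forall>x\<in>K. - x \<in> K \<and> inverse x \<in> K)"

definition val_complete :: "('l::field \<Rightarrow> int) \<Rightarrow> 'l set \<Rightarrow> bool" where
  "val_complete v K \<longleftrightarrow>
     (\<forall>s :: nat \<Rightarrow> 'l. range s \<subseteq> K \<longrightarrow>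
        (\<forall>m. \<exists>k. \<forall>i\<ge>k. \<forall>j\<ge>k. s i - s j \<in> val_ge v m) \<longrightarrow>
        (\<exists>x\<in>K. \<forall>m. \<exists>k. \<forall>i\<ge>k. s i - x \<in> val_ge v m))"

definition val_dense :: "('l::field \<Rightarrow> int) \<Rightarrow> 'l set \<Rightarrow> bool" where
  "val_dense v K \<longleftrightarrow> (\<forall>x m. \<exists>y\<in>K. x - y \<in> val_ge v m)"

text \<open>A map res on L that restricts to the reduction from the valuation ring onto the residue
  field of L, the latter being identified with the type 'r (values outside the valuation ring
  are irrelevant).\<close>

definition residue_map :: "('l::field \<Rightarrow> int) \<Rightarrow> ('l \<Rightarrow> 'r::field) \<Rightarrow> bool" where
  "residue_map v res \<longleftrightarrow>
     res 1 = 1 \<and>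
     (\<forall>x\<in>int_ring v. \<forall>y\<in>int_ring v.
        res (x + y) = res x + res y \<and> res (x * y) = res x * res y) \<and>
     (\<forall>x\<in>int_ring v. res x = 0 \<longleftrightarrow> x \<in> val_ge v 1) \<and>
     res ` int_ring v = UNIV"

section \<open>The fields F and L\<close>

text \<open>F is W(k)[1/p], with W(k) the strict p-ring with residue ring k (as in Serre, Local Fields,
  chapter II): F is complete of characteristic 0, p is a uniformizer, and the residue field of F
  is k. Here k is the finite field type 'k inside its algebraic closure.\<close>

definition witt_fraction_field ::
  "nat \<Rightarrow> ('l::field \<Rightarrow> int) \<Rightarrow> ('l \<Rightarrow> 'k::{finite,field} alg_closure) \<Rightarrow> 'l set \<Rightarrow> 'l \<Rightarrow> bool" where
  "witt_fraction_field p v res F \<epsilon> \<longleftrightarrow>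
     CHAR('l) = 0 \<and> \<epsilon> = of_nat p \<and> v (of_nat p) = 1 \<and>
     val_complete v F \<and> res ` (F \<inter> int_ring v) = range to_ac"

text \<open>F is k((t)) with its t-adic valuation, its residue map, and uniformizer t.\<close>

definition laurent_series_field ::
  "('l::field \<Rightarrow> int) \<Rightarrow> ('l \<Rightarrow> 'k::{finite,field} alg_closure) \<Rightarrow> 'l set \<Rightarrow> 'l \<Rightarrow> bool" where
  "laurent_series_field v res F \<epsilon> \<longleftrightarrow>
     (\<exists>\<iota> :: 'k fls \<Rightarrow> 'l.
        \<iota> 1 = 1 \<and> (\<forall>a b. \<iota> (a + b) = \<iota> a + \<iota> b \<and> \<iota> (a * b) = \<iota> a * \<iota> b) \<and>
        range \<iota> = F \<and> \<iota> fls_X = \<epsilon> \<and>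
        (\<forall>a. a \<noteq> 0 \<longrightarrow> v (\<iota> a) = fls_subdegree a) \<and>
        (\<forall>a. 0 \<le> fls_subdegree a \<longrightarrow> res (\<iota> a) = to_ac (fls_nth a 0)))"

text \<open>Unramified means that the value group does not grow; separability of the residue field
  extension is automatic because the residue field of F is finite.\<close>

definition unramified_ext :: "('l::field \<Rightarrow> int) \<Rightarrow> 'l set \<Rightarrow> 'l set \<Rightarrow> bool" where
  "unramified_ext v F K \<longleftrightarrow>
     is_subfield K \<and> F \<subseteq> K \<and>
     (\<forall>x\<in>K. \<exists>P :: 'l poly. P \<noteq> 0 \<and> (\<forall>i. poly.coeff P i \<in> F) \<and> poly P x = 0) \<and>
     v ` (K - {0}) = v ` (F - {0})"

text \<open>An unramified extension of F is maximal (in an algebraic closure of F, not just in L)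
  iff its residue field is a separable, here equivalently algebraic, closure of k.\<close>

definition max_unramified_ext ::
  "('l::field \<Rightarrow> int) \<Rightarrow> ('l \<Rightarrow> 'k::{finite,field} alg_closure) \<Rightarrow> 'l set \<Rightarrow> 'l set \<Rightarrow> bool" where
  "max_unramified_ext v res F K \<longleftrightarrow> unramified_ext v F K \<and> res ` (K \<inter> int_ring v) = UNIV"

definition unramified_quadratic_ext :: "('l::field \<Rightarrow> int) \<Rightarrow> 'l set \<Rightarrow> 'l set \<Rightarrow> bool" where
  "unramified_quadratic_ext v F E \<longleftrightarrow>
     unramified_ext v F E \<and> (\<exists>\<theta>. \<theta> \<notin> F \<and> E = {a + b * \<theta> | a b. a \<in> F \<and> b \<in> F})"

locale unramified_completion =
  fixes p r :: nat
    and v :: "'l::field \<Rightarrow> int"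
    and res :: "'l \<Rightarrow> 'k::{finite,field} alg_closure"
    and F :: "'l set"
    and \<epsilon> :: 'l
    and \<sigma> :: "'l \<Rightarrow> 'l"
  assumes prime_p: "prime p"
    and card_k: "card (UNIV :: 'k set) = p ^ r"
    and valuation: "discrete_valuation v"
    and residue: "residue_map v res"
    and subfield_F: "is_subfield F"
    and F_cases: "witt_fraction_field p v res F \<epsilon> \<or> laurent_series_field v res F \<epsilon>"
    and L_complete: "val_complete v UNIV"
    and Fur_dense: "\<exists>Fur. max_unramified_ext v res F Fur \<and> val_dense v Fur"
    and frob_bij: "bij \<sigma>"
    and frob_add: "\<sigma> (x + y) = \<sigma> x + \<sigma> y"
    and frob_mult: "\<sigma> (x * y) = \<sigma> x * \<sigma> y"
    and frob_fixes_F: "x \<in> F \<Longrightarrow> \<sigma> x = x"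
    and frob_val: "x \<noteq> 0 \<Longrightarrow> v (\<sigma> x) = v x"
    and frob_res: "x \<in> int_ring v \<Longrightarrow> res (\<sigma> x) = res x ^ (p ^ r)"

section \<open>The supersingular unitary isocrystal of signature (1, n - 1)\<close>

text \<open>The whole type 'v is the vector space N.\<close>

locale unitary_isocrystal = vector_space scale
  for scale :: "'l::field \<Rightarrow> 'v::ab_group_add \<Rightarrow> 'v" +
  fixes \<sigma> :: "'l \<Rightarrow> 'l" and \<epsilon> \<delta> :: 'l and n :: nat
    and g h :: "nat \<Rightarrow> 'v"
    and \<Phi> :: "'v \<Rightarrow> 'v"
    and B :: "'v \<Rightarrow> 'v \<Rightarrow> 'l"
  assumes n_pos: "n \<ge> 1"
    and basis_inj: "inj_on g {1..n}" "inj_on h {1..n}" "g ` {1..n} \<inter> h ` {1..n} = {}"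
    and basis_indep: "independent (g ` {1..n} \<union> h ` {1..n})"
    and basis_span: "span (g ` {1..n} \<union> h ` {1..n}) = UNIV"
    and Phi_bij: "bij \<Phi>"
    and Phi_add: "\<Phi> (x + y) = \<Phi> x + \<Phi> y"
    and Phi_scale: "\<Phi> (scale c x) = scale (\<sigma> c) (\<Phi> x)"
    and Phi_g: "i \<in> {1..<n} \<Longrightarrow> \<Phi> (g i) = scale \<epsilon> (h i)"
    and Phi_h: "i \<in> {1..<n} \<Longrightarrow> \<Phi> (h i) = g i"
    and Phi_gn: "\<Phi> (g n) = h n"
    and Phi_hn: "\<Phi> (h n) = scale \<epsilon> (g n)"
    and B_add_left: "B (x + y) z = B x z + B y z"
    and B_add_right: "B z (x + y) = B z x + B z y"
    and B_scale_left: "B (scale c x) y = c * B x y"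
    and B_scale_right: "B x (scale c y) = c * B x y"
    and B_alternating: "B x x = 0"
    and B_gh: "i \<in> {1..n} \<Longrightarrow> j \<in> {1..n} \<Longrightarrow> B (g i) (h j) = (if i = j then \<delta> else 0)"
    and B_gg: "i \<in> {1..n} \<Longrightarrow> j \<in> {1..n} \<Longrightarrow> B (g i) (g j) = 0"
    and B_hh: "i \<in> {1..n} \<Longrightarrow> j \<in> {1..n} \<Longrightarrow> B (h i) (h j) = 0"

definition N0 :: "('l::field \<Rightarrow> 'v::ab_group_add \<Rightarrow> 'v) \<Rightarrow> nat \<Rightarrow> (nat \<Rightarrow> 'v) \<Rightarrow> 'v set" where
  "N0 scale n g = module.span scale (g ` {1..n})"

definition herm :: "'l::field \<Rightarrow> ('v \<Rightarrow> 'v) \<Rightarrow> ('v \<Rightarrow> 'v \<Rightarrow> 'l) \<Rightarrow> 'v \<Rightarrow> 'v \<Rightarrow> 'l" where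
  "herm \<delta> \<Phi> B x y = \<delta> * B x (\<Phi> y)"

definition tau :: "('l::field \<Rightarrow> 'v \<Rightarrow> 'v) \<Rightarrow> 'l \<Rightarrow> ('v \<Rightarrow> 'v) \<Rightarrow> 'v \<Rightarrow> 'v" where
  "tau scale \<epsilon> \<Phi> x = scale (inverse \<epsilon>) (\<Phi> (\<Phi> x))"

section \<open>Lattices\<close>

definition int_span ::
  "('l::field \<Rightarrow> int) \<Rightarrow> ('l \<Rightarrow> 'v::ab_group_add \<Rightarrow> 'v) \<Rightarrow> nat \<Rightarrow> (nat \<Rightarrow> 'v) \<Rightarrow> 'v set" where
  "int_span v scale m e = {\<Sum>i<m. scale (c i) (e i) | c. \<forall>i<m. c i \<in> int_ring v}"

text \<open>A lattice in the L-subspace V is a finitely generated submodule over the valuation ring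
  of L that spans V over L.\<close>

definition lattice_in ::
  "('l::field \<Rightarrow> int) \<Rightarrow> ('l \<Rightarrow> 'v::ab_group_add \<Rightarrow> 'v) \<Rightarrow> 'v set \<Rightarrow> 'v set \<Rightarrow> bool" where
  "lattice_in v scale V M \<longleftrightarrow>
     (\<exists>m e. M = int_span v scale m e) \<and> module.span scale M = V"

definition dual_lattice ::
  "('l::field \<Rightarrow> int) \<Rightarrow> 'v set \<Rightarrow> ('v \<Rightarrow> 'v \<Rightarrow> 'l) \<Rightarrow> 'v set \<Rightarrow> 'v set" where
  "dual_lattice v V H M = {x \<in> V. \<forall>y\<in>M. H x y \<in> int_ring v}"

definition scale_lattice ::
  "('l::field \<Rightarrow> 'v \<Rightarrow> 'v) \<Rightarrow> 'l \<Rightarrow> int \<Rightarrow> 'v set \<Rightarrow> 'v set" where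
  "scale_lattice scale \<epsilon> i M = scale (\<epsilon> powi i) ` M"

definition int_submodule ::
  "('l::field \<Rightarrow> int) \<Rightarrow> ('l \<Rightarrow> 'v::ab_group_add \<Rightarrow> 'v) \<Rightarrow> 'v set \<Rightarrow> bool" where
  "int_submodule v scale M \<longleftrightarrow> 0 \<in> M \<and> (\<forall>x\<in>M. \<forall>y\<in>M. x + y \<in> M) \<and>
     (\<forall>c\<in>int_ring v. \<forall>x\<in>M. scale c x \<in> M)"

text \<open>The length of M/A: submodules of M/A correspond to submodules of M containing A.\<close>

definition quot_length ::
  "('l::field \<Rightarrow> int) \<Rightarrow> ('l \<Rightarrow> 'v::ab_group_add \<Rightarrow> 'v) \<Rightarrow> 'v set \<Rightarrow> 'v set \<Rightarrow> enat" where
  "quot_length v scale A M =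
     Sup {enat m | m. \<exists>C :: nat \<Rightarrow> 'v set. C 0 = A \<and> C m = M \<and>
            (\<forall>i\<le>m. int_submodule v scale (C i)) \<and> (\<forall>i<m. C i \<subset> C (Suc i))}"

definition sub_of_length ::
  "('l::field \<Rightarrow> int) \<Rightarrow> ('l \<Rightarrow> 'v::ab_group_add \<Rightarrow> 'v) \<Rightarrow> nat \<Rightarrow> 'v set \<Rightarrow> 'v set \<Rightarrow> bool" where
  "sub_of_length v scale s A M \<longleftrightarrow> A \<subseteq> M \<and> quot_length v scale A M = enat s"

text \<open>The condition that the i-th multiple of the dual of M is contained in M with length 1, and M
  in the (i-1)-st multiple with length n - 1; i = 1 is the condition on the lattices
  having a Vollaard-Wedhorn invariant.\<close>

definition dual_condition ::
  "('l::field \<Rightarrow> int) \<Rightarrow> ('l \<Rightarrow> 'v::ab_group_add \<Rightarrow> 'v) \<Rightarrow> 'l \<Rightarrow> nat \<Rightarrow> 'v set \<Rightarrow> ('v \<Rightarrow> 'v \<Rightarrow> 'l)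
     \<Rightarrow> int \<Rightarrow> 'v set \<Rightarrow> bool" where
  "dual_condition v scale \<epsilon> n V H i M \<longleftrightarrow>
     sub_of_length v scale 1 (scale_lattice scale \<epsilon> i (dual_lattice v V H M)) M \<and>
     sub_of_length v scale (n - 1) M (scale_lattice scale \<epsilon> (i - 1) (dual_lattice v V H M))"

text \<open>Relative position by elementary divisors, in the convention that M1 has a basis e such that
  the vectors (uniformizer ^ a i) * e i form a basis of M2; a is listed in decreasing order. The opposite
  convention replaces a by its reversed negative.\<close>

definition has_rel_pos ::
  "('l::field \<Rightarrow> int) \<Rightarrow> ('l \<Rightarrow> 'v::ab_group_add \<Rightarrow> 'v) \<Rightarrow> 'l \<Rightarrow> nat \<Rightarrow> 'v set \<Rightarrow> 'v set \<Rightarrow> int list \<Rightarrow> bool"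
  where
  "has_rel_pos v scale \<epsilon> n M1 M2 a \<longleftrightarrow>
     length a = n \<and> sorted_wrt (\<ge>) a \<and>
     (\<exists>e. inj_on e {..<n} \<and> \<not> module.dependent scale (e ` {..<n}) \<and>
        M1 = int_span v scale n e \<and>
        M2 = int_span v scale n (\<lambda>i. scale (\<epsilon> powi (a ! i)) (e i)))"

definition rel_pos ::
  "('l::field \<Rightarrow> int) \<Rightarrow> ('l \<Rightarrow> 'v::ab_group_add \<Rightarrow> 'v) \<Rightarrow> 'l \<Rightarrow> nat \<Rightarrow> 'v set \<Rightarrow> 'v set \<Rightarrow> int list" where
  "rel_pos v scale \<epsilon> n M1 M2 = (THE a. has_rel_pos v scale \<epsilon> n M1 M2 a)"

section \<open>The Vollaard-Wedhorn invariant\<close>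

definition invariant_under :: "('v \<Rightarrow> 'v) \<Rightarrow> 'v set \<Rightarrow> bool" where
  "invariant_under T M \<longleftrightarrow> T ` M = M"

definition iterate_sum :: "('v::ab_group_add \<Rightarrow> 'v) \<Rightarrow> 'v set \<Rightarrow> nat \<Rightarrow> 'v set" where
  "iterate_sum T M d = {\<Sum>i\<le>d. (T ^^ i) (x i) | x. \<forall>i\<le>d. x i \<in> M}"

definition VW_invariant :: "('v::ab_group_add \<Rightarrow> 'v) \<Rightarrow> 'v set \<Rightarrow> 'v set \<times> nat" where
  "VW_invariant T M =
     (let d = (LEAST d. invariant_under T (iterate_sum T M d)) in (iterate_sum T M d, d))"

end

theory Submission
  imports Defs "HOL-Library.Set_Algebras"
begin

text \<open>
  All quotients of lattices have finite additive length, so that every lattice A has an integral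
  volume with vol (A + B) + vol (A \<inter> B) = vol A + vol B. By the theory of elementary divisors, the
  relative positions of M and L, for M of a given volume, and the volumes of all M + \<epsilon>^j L
  determine each other (rel_pos_eq_iff). So two lattices M and M' have to be compared through the
  volumes of their sums with \<tau>-invariant lattices.

  Write A* for the first multiple of the dual of A (pdual). The form is hermitian up to the
  Frobenius, hence A** = \<tau> A. The lattices M of the theorem satisfy M* \<subseteq> M with colength one, and
  by duality also M* \<subseteq> \<tau> M with colength one. Therefore the chain M, M + \<tau> M, M + \<tau> M + \<tau>^2 M, ...
  grows by one in each step until it reaches \<Lambda> after d steps. Dually, the intersections of M with
  its images under inverse powers of \<tau> shrink by one in each step until they reach S = \<Lambda>*, unless
  M is \<tau>-invariant. The intersection P after d steps (M itself if d = 0) contains S with colength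
  one, and it generates everything: M = P + ... + \<tau>^d P (M_generated) and \<Lambda> = P + ... + \<tau>^(2 d) P.
  So \<Lambda> / S is generated by one line under \<tau>, and the same is true of its quotients. In a quotient
  of length l the sum of the first j images of the line has length min j l. Applied to the
  quotient by a \<tau>-invariant lattice Y this gives vol (M + Y) = min (vol (S + Y) + 1 + d) (vol (\<Lambda> +
  Y)) (vol_plus_invariant), and the right-hand side depends on \<Lambda> and d only. This is one direction
  of the theorem.

  Conversely, call a lattice I special if I* \<subseteq> I with colength one; all special lattices have the
  same volume. For \<tau>-invariant special I contained in \<Lambda> the formula gives vol (M + I) = vol M + d.
  If vol (M' + I) has the same value, and M' has the invariant (\<Lambda>', d') with d \<le> d', the formula
  for M' leaves only the possibility d = d' and I \<subseteq> \<Lambda>' (special_distance). So \<Lambda> = \<Lambda>' as soon as \<Lambda>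
  is a sum of such lattices I. These correspond to maximal isotropic subspaces of \<Lambda> / S, a
  nondegenerate hermitian space of dimension 2 d + 1 over the residue field, with a Frobenius
  under which the subspaces have to be stable. Vectors fixed by the Frobenius generate it
  (nearly_fixed_generators): the fixed basis of the whole space gives a filtration with fixed
  generators, which are lifted with the help of Artin-Schreier equations. From fixed vectors one
  builds two stable maximal isotropic subspaces with trivial intersection (ex_opposite_isotropic),
  as for hermitian forms over finite fields. Their orthogonal complements correspond to two
  lattices I with sum \<Lambda> (Lambda_sum_of_special).
\<close>

(* Membership in sums of sets is reasoned about explicitly. *)
declare set_plus_intro [rule del] set_plus_mono [rule del] set_plus_mono2 [rule del]

section \<open>Valued fields and coordinates\<close>

locale valued_space = vector_space scale
  for scale :: "'l::field \<Rightarrow> 'v::ab_group_add \<Rightarrow> 'v" (infixr \<open>*s\<close> 75) +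
  fixes v :: "'l \<Rightarrow> int" and \<epsilon> :: 'l
  assumes valuation: "discrete_valuation v"
    and eps_nz [simp]: "\<epsilon> \<noteq> 0" and v_eps: "v \<epsilon> = 1"
begin

abbreviation submod :: "'v set \<Rightarrow> bool" where "submod \<equiv> int_submodule v scale"

abbreviation len :: "'v set \<Rightarrow> 'v set \<Rightarrow> enat" where "len \<equiv> quot_length v scale"

lemma v_mult: "x \<noteq> 0 \<Longrightarrow> y \<noteq> 0 \<Longrightarrow> v (x * y) = v x + v y"
  using valuation unfolding discrete_valuation_def by blast

lemma v_one [simp]: "v 1 = 0"
  using v_mult[of 1 1] by simp

lemma v_minus_one: "v (- 1) = 0"
  using v_mult[of "-1" "-1"] by simp

lemma v_uminus [simp]: "v (- x) = v x"
proof (cases "x = 0")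
  case False
  then show ?thesis using v_mult[of "-1" x] v_minus_one by simp
qed simp

lemma v_inverse: "x \<noteq> 0 \<Longrightarrow> v (inverse x) = - v x"
  using v_mult[of x "inverse x"] by simp

lemma v_pow: "v (\<epsilon> ^ k) = int k"
  by (induction k) (auto simp: v_mult eps_nz v_eps)

lemma v_powi [simp]: "v (\<epsilon> powi k) = k"
proof (cases "k \<ge> 0")
  case True
  then show ?thesis using v_pow[of "nat k"] by (simp add: power_int_def)
next
  case False
  then show ?thesis using v_pow[of "nat (-k)"]
    by (simp add: power_int_def v_inverse eps_nz power_inverse)
qed

lemma powi_nz [simp]: "\<epsilon> powi k \<noteq> 0"
  using eps_nz by simp

lemma powi_add: "\<epsilon> powi (i + j) = \<epsilon> powi i * \<epsilon> powi j"
  using eps_nz by (simp add: power_int_add)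

lemma powi_minus_cancel [simp]: "\<epsilon> powi i * \<epsilon> powi (- i) = 1" "\<epsilon> powi (- i) * \<epsilon> powi i = 1"
  using powi_add[of i "- i"] powi_add[of "- i" i] by simp_all

lemma val_ge_0 [simp]: "0 \<in> val_ge v a"
  by (simp add: val_ge_def)

lemma val_ge_add: "x \<in> val_ge v a \<Longrightarrow> y \<in> val_ge v a \<Longrightarrow> x + y \<in> val_ge v a"
proof (cases "x = 0 \<or> y = 0 \<or> x + y = 0")
  case False
  moreover have "min (v x) (v y) \<le> v (x + y)"
    using valuation False unfolding discrete_valuation_def by blast
  moreover assume "x \<in> val_ge v a" "y \<in> val_ge v a"
  ultimately show ?thesis by (auto simp: val_ge_def)
qed (auto simp: val_ge_def)

lemma val_ge_uminus: "x \<in> val_ge v a \<Longrightarrow> - x \<in> val_ge v a"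
  by (simp add: val_ge_def)

lemma val_ge_diff: "x \<in> val_ge v a \<Longrightarrow> y \<in> val_ge v a \<Longrightarrow> x - y \<in> val_ge v a"
  using val_ge_add[of x a "- y"] val_ge_uminus by simp

lemma val_ge_mult: "x \<in> val_ge v a \<Longrightarrow> y \<in> val_ge v b \<Longrightarrow> x * y \<in> val_ge v (a + b)"
  by (cases "x = 0 \<or> y = 0") (auto simp: val_ge_def v_mult)

lemma val_ge_mult0: "x \<in> int_ring v \<Longrightarrow> y \<in> val_ge v b \<Longrightarrow> x * y \<in> val_ge v b"
  using val_ge_mult[of x 0 y b] by simp

lemma val_ge_mono: "a \<le> b \<Longrightarrow> x \<in> val_ge v b \<Longrightarrow> x \<in> val_ge v a"
  by (auto simp: val_ge_def)

lemma val_ge_sum: "(\<And>i. i \<in> I \<Longrightarrow> f i \<in> val_ge v a) \<Longrightarrow> sum f I \<in> val_ge v a"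
  by (induction I rule: infinite_finite_induct) (auto intro: val_ge_add)

lemma val_ge_powi: "\<epsilon> powi k \<in> val_ge v a \<longleftrightarrow> a \<le> k"
  by (simp add: val_ge_def)

lemma val_ge_powi_mult: "\<epsilon> powi k * x \<in> val_ge v a \<longleftrightarrow> x \<in> val_ge v (a - k)"
  by (cases "x = 0") (auto simp: val_ge_def v_mult)

lemma val_ge_inverse: "x \<noteq> 0 \<Longrightarrow> inverse x \<in> val_ge v (- v x)"
  by (simp add: val_ge_def v_inverse)

lemma int_ring_one [simp]: "1 \<in> int_ring v"
  by (simp add: val_ge_def)

lemma val_ge_divide: "x \<noteq> 0 \<Longrightarrow> y \<in> val_ge v (v x) \<Longrightarrow> y / x \<in> int_ring v"
  using val_ge_mult[OF _ val_ge_inverse, of y "v x" x] by (simp add: divide_inverse)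

text \<open>Bases are indexed, because the exponents of relative positions are lists.\<close>

definition frame :: "nat \<Rightarrow> (nat \<Rightarrow> 'v) \<Rightarrow> bool" where
  "frame m e \<longleftrightarrow> inj_on e {..<m} \<and> independent (e ` {..<m})"

definition coord :: "nat \<Rightarrow> (nat \<Rightarrow> 'v) \<Rightarrow> nat \<Rightarrow> 'v \<Rightarrow> 'l" where
  "coord m e i x = representation (e ` {..<m}) x (e i)"

abbreviation fspan :: "nat \<Rightarrow> (nat \<Rightarrow> 'v) \<Rightarrow> 'v set" where
  "fspan m e \<equiv> span (e ` {..<m})"

text \<open>Sums of the lines through the vectors of a frame, scaled by possibly different powers of the
  uniformizer. Two lattices in relative position a are such boxes for a common frame.\<close>

definition box :: "nat \<Rightarrow> (nat \<Rightarrow> 'v) \<Rightarrow> (nat \<Rightarrow> int) \<Rightarrow> 'v set" where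
  "box m e a = {x \<in> fspan m e. \<forall>i<m. coord m e i x \<in> val_ge v (a i)}"

lemma coord_add: "frame m e \<Longrightarrow> x \<in> fspan m e \<Longrightarrow> y \<in> fspan m e \<Longrightarrow>
    coord m e i (x + y) = coord m e i x + coord m e i y"
  by (simp add: coord_def frame_def representation_add)

lemma coord_scale: "frame m e \<Longrightarrow> x \<in> fspan m e \<Longrightarrow> coord m e i (c *s x) = c * coord m e i x"
  by (simp add: coord_def frame_def representation_scale)

lemma coord_diff: "frame m e \<Longrightarrow> x \<in> fspan m e \<Longrightarrow> y \<in> fspan m e \<Longrightarrow>
    coord m e i (x - y) = coord m e i x - coord m e i y"
  by (simp add: coord_def frame_def representation_diff)

lemma coord_zero [simp]: "coord m e i 0 = 0"
  by (simp add: coord_def representation_zero)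

lemma coord_basis: "frame m e \<Longrightarrow> i < m \<Longrightarrow> j < m \<Longrightarrow> coord m e i (e j) = (if i = j then 1 else 0)"
  by (auto simp: coord_def frame_def representation_basis inj_on_def)

lemma sum_in_fspan: "(\<Sum>i<m. c i *s e i) \<in> fspan m e"
  by (intro span_sum span_scale span_base) auto

lemma coord_expand: assumes "frame m e" "x \<in> fspan m e" shows "(\<Sum>i<m. coord m e i x *s e i) = x"
proof -
  have "(\<Sum>b\<in>e ` {..<m}. representation (e ` {..<m}) x b *s b) = x"
    using assms by (intro sum_representation_eq) (auto simp: frame_def)
  then show ?thesis
    using assms by (subst (asm) sum.reindex) (auto simp: frame_def coord_def)
qed

lemma coord_sum: "frame m e \<Longrightarrow> (\<And>i. i \<in> I \<Longrightarrow> f i \<in> fspan m e) \<Longrightarrow>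
    coord m e j (sum f I) = (\<Sum>i\<in>I. coord m e j (f i))"
  by (induction I rule: infinite_finite_induct) (auto simp: coord_add span_sum)

lemma coord_lincomb: assumes "frame m e" "j < m" shows "coord m e j (\<Sum>i<m. c i *s e i) = c j"
proof -
  have "coord m e j (\<Sum>i<m. c i *s e i) = (\<Sum>i<m. c i * (if j = i then 1 else 0))"
    using assms by (subst coord_sum) (auto simp: coord_scale coord_basis span_base span_scale)
  also have "\<dots> = c j" using assms(2) by (simp add: if_distrib cong: if_cong)
  finally show ?thesis .
qed

lemma sum_in_box: "frame m e \<Longrightarrow> (\<And>i. i < m \<Longrightarrow> c i \<in> val_ge v (a i)) \<Longrightarrow> (\<Sum>i<m. c i *s e i) \<in> box m e a"
  by (auto simp: box_def sum_in_fspan coord_lincomb)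

lemma box_fspan: "x \<in> box m e a \<Longrightarrow> x \<in> fspan m e"
  by (simp add: box_def)

lemma int_span_eq_box:
  assumes e: "frame m e"
  shows "int_span v scale m (\<lambda>i. \<epsilon> powi (a i) *s e i) = box m e a"
proof (intro equalityI subsetI)
  fix x assume "x \<in> int_span v scale m (\<lambda>i. \<epsilon> powi (a i) *s e i)"
  then obtain c where c: "\<forall>i<m. c i \<in> int_ring v" "x = (\<Sum>i<m. (c i * \<epsilon> powi (a i)) *s e i)"
    by (auto simp: int_span_def)
  have "c i * \<epsilon> powi (a i) \<in> val_ge v (a i)" if "i < m" for i
    using that c val_ge_mult0[of "c i" "\<epsilon> powi (a i)"] by (simp add: val_ge_powi)
  then show "x \<in> box m e a" unfolding c(2) using e by (intro sum_in_box) auto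
next
  fix x assume x: "x \<in> box m e a"
  let ?c = "\<lambda>i. \<epsilon> powi (- a i) * coord m e i x"
  have "\<forall>i<m. ?c i \<in> int_ring v" using x by (auto simp: box_def val_ge_powi_mult)
  moreover have "x = (\<Sum>i<m. ?c i *s \<epsilon> powi (a i) *s e i)"
    using coord_expand[OF e box_fspan[OF x]] by (simp add: mult.assoc[symmetric] mult.commute[of "\<epsilon> powi _"] del: power_int_minus) (simp add: mult.assoc)
  ultimately show "x \<in> int_span v scale m (\<lambda>i. \<epsilon> powi (a i) *s e i)"
    unfolding int_span_def by (intro CollectI exI[of _ ?c] conjI)
qed

lemma int_span_eq_box0: "frame m e \<Longrightarrow> int_span v scale m e = box m e (\<lambda>_. 0)"
  using int_span_eq_box[of m e "\<lambda>_. 0"] by simp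

lemma box_mono: "(\<And>i. i < m \<Longrightarrow> b i \<le> a i) \<Longrightarrow> box m e a \<subseteq> box m e b"
  by (auto simp: box_def intro: val_ge_mono)

lemma box_subset_iff: assumes e: "frame m e" 
  shows "box m e a \<subseteq> box m e b \<longleftrightarrow> (\<forall>i<m. b i \<le> a i)"
proof
  assume sub: "box m e a \<subseteq> box m e b"
  show "\<forall>i<m. b i \<le> a i"
  proof (intro allI impI)
    fix i assume i: "i < m"
    have "\<epsilon> powi (a i) *s e i \<in> box m e a"
      using i e by (auto simp: box_def coord_scale coord_basis span_base span_scale val_ge_powi)
    then have "\<epsilon> powi (a i) *s e i \<in> box m e b" using sub by blast
    then show "b i \<le> a i"
      using i e by (auto simp: box_def coord_scale coord_basis span_base val_ge_powi)
  qed
qed (simp add: box_mono)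

section \<open>Submodules over the valuation ring and their lengths\<close>

lemma submodI: "0 \<in> M \<Longrightarrow> (\<And>x y. x \<in> M \<Longrightarrow> y \<in> M \<Longrightarrow> x + y \<in> M) \<Longrightarrow>
    (\<And>c x. c \<in> int_ring v \<Longrightarrow> x \<in> M \<Longrightarrow> c *s x \<in> M) \<Longrightarrow> submod M"
  by (simp add: int_submodule_def)

lemma submod_0: "submod M \<Longrightarrow> 0 \<in> M"
  and submod_add: "submod M \<Longrightarrow> x \<in> M \<Longrightarrow> y \<in> M \<Longrightarrow> x + y \<in> M"
  and submod_scale: "submod M \<Longrightarrow> c \<in> int_ring v \<Longrightarrow> x \<in> M \<Longrightarrow> c *s x \<in> M"
  by (simp_all add: int_submodule_def)

lemma submod_uminus: "submod M \<Longrightarrow> x \<in> M \<Longrightarrow> - x \<in> M"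
  using submod_scale[of M "- 1" x] by (simp add: val_ge_uminus)

lemma submod_diff: "submod M \<Longrightarrow> x \<in> M \<Longrightarrow> y \<in> M \<Longrightarrow> x - y \<in> M"
  using submod_add[of M x "- y"] submod_uminus by simp

lemma submod_sum: "submod M \<Longrightarrow> (\<And>i. i \<in> I \<Longrightarrow> f i \<in> M) \<Longrightarrow> sum f I \<in> M"
  by (induction I rule: infinite_finite_induct) (auto intro: submod_add submod_0)

lemma submod_Int: "submod A \<Longrightarrow> submod B \<Longrightarrow> submod (A \<inter> B)"
  by (simp add: int_submodule_def)

lemma submod_plus: assumes "submod A" "submod B" shows "submod (A + B)"
proof (rule submodI)
  show "0 \<in> A + B" using assms set_plus_intro[of 0 A 0 B] by (simp add: submod_0)
next
  fix x y assume "x \<in> A + B" "y \<in> A + B"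
  then obtain a b a' b' where *: "x = a + b" "y = a' + b'" "a \<in> A" "b \<in> B" "a' \<in> A" "b' \<in> B"
    by (auto elim!: set_plus_elim)
  then have "x + y = (a + a') + (b + b')" by (simp add: algebra_simps)
  then show "x + y \<in> A + B" using * assms by (metis set_plus_intro submod_add)
next
  fix c x assume c: "c \<in> int_ring v" and "x \<in> A + B"
  then obtain a b where "x = a + b" "a \<in> A" "b \<in> B" by (auto elim!: set_plus_elim)
  then show "c *s x \<in> A + B"
    using assms c by (simp add: scale_right_distrib set_plus_intro submod_scale)
qed

lemma subset_plus_left: "submod B \<Longrightarrow> A \<subseteq> A + B"
  using set_plus_intro[of _ A 0 B] submod_0 by fastforce

lemma subset_plus_right: "submod A \<Longrightarrow> B \<subseteq> A + B"
  using set_plus_intro[of 0 A _ B] submod_0 by fastforce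

lemma plus_subset: "submod C \<Longrightarrow> A \<subseteq> C \<Longrightarrow> B \<subseteq> C \<Longrightarrow> A + B \<subseteq> C"
  by (auto elim!: set_plus_elim intro: submod_add)

lemma plus_absorb: "submod A \<Longrightarrow> submod B \<Longrightarrow> A \<subseteq> B \<Longrightarrow> A + B = B"
  by (simp add: plus_subset subset_antisym subset_plus_right)

lemma plus_absorb2: "submod A \<Longrightarrow> submod B \<Longrightarrow> B \<subseteq> A \<Longrightarrow> A + B = A"
  by (simp add: plus_subset subset_antisym subset_plus_left)

lemma modular_law: "submod A \<Longrightarrow> submod B \<Longrightarrow> submod C \<Longrightarrow> A \<subseteq> C \<Longrightarrow> (A + B) \<inter> C = A + (B \<inter> C)"
proof (intro equalityI subsetI)
  fix x assume *: "submod A" "submod B" "submod C" "A \<subseteq> C" "x \<in> (A + B) \<inter> C"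
  then obtain a b where ab: "x = a + b" "a \<in> A" "b \<in> B" "x \<in> C" by (auto elim!: set_plus_elim)
  then have "b = x - a" "a \<in> C" using * by (auto simp: algebra_simps)
  then have "b \<in> C" using ab * submod_diff by blast
  then show "x \<in> A + (B \<inter> C)" using ab by (simp add: set_plus_intro)
next
  fix x assume *: "submod A" "submod B" "submod C" "A \<subseteq> C" "x \<in> A + (B \<inter> C)"
  then obtain a b where ab: "x = a + b" "a \<in> A" "b \<in> B" "b \<in> C" by (auto elim!: set_plus_elim)
  then have "a \<in> C" using * by blast
  then show "x \<in> (A + B) \<inter> C" using ab submod_add[OF *(3)] by (simp add: set_plus_intro)
qed

lemma submod_box: "frame m e \<Longrightarrow> submod (box m e a)"
  by (intro submodI) (auto simp: box_def coord_add coord_scale span_add span_zero span_scale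
      intro: val_ge_add val_ge_mult0)

definition strict_chain :: "'v set \<Rightarrow> 'v set \<Rightarrow> nat \<Rightarrow> (nat \<Rightarrow> 'v set) \<Rightarrow> bool" where
  "strict_chain A M m C \<longleftrightarrow> C 0 = A \<and> C m = M \<and> (\<forall>i\<le>m. submod (C i)) \<and> (\<forall>i<m. C i \<subset> C (Suc i))"

lemma strict_chain_start: "strict_chain A M m C \<Longrightarrow> C 0 = A"
  and strict_chain_end: "strict_chain A M m C \<Longrightarrow> C m = M"
  and strict_chain_submod: "strict_chain A M m C \<Longrightarrow> i \<le> m \<Longrightarrow> submod (C i)"
  and strict_chain_step: "strict_chain A M m C \<Longrightarrow> i < m \<Longrightarrow> C i \<subset> C (Suc i)"
  by (simp_all add: strict_chain_def)

lemma strict_chain_mono: "strict_chain A M m C \<Longrightarrow> i \<le> j \<Longrightarrow> j \<le> m \<Longrightarrow> C i \<subseteq> C j"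
proof (induction j)
  case (Suc j)
  show ?case
  proof (cases "i = Suc j")
    case False
    then have "C i \<subseteq> C j" using Suc by simp
    then show ?thesis using strict_chain_step[OF Suc.prems(1), of j] Suc.prems(3) by auto
  qed simp
qed simp

lemma strict_chain_bounds: "strict_chain A M m C \<Longrightarrow> i \<le> m \<Longrightarrow> A \<subseteq> C i \<and> C i \<subseteq> M"
  using strict_chain_mono[of A M m C 0 i] strict_chain_mono[of A M m C i m]
  by (simp add: strict_chain_start strict_chain_end)

lemma len_eq_Sup: "len A M = Sup {enat m | m. \<exists>C. strict_chain A M m C}"
  by (simp add: quot_length_def strict_chain_def)

lemma strict_chain_le_len: "strict_chain A M m C \<Longrightarrow> enat m \<le> len A M"
  unfolding len_eq_Sup by (rule Sup_upper) blast

lemma len_leI: "(\<And>m C. strict_chain A M m C \<Longrightarrow> enat m \<le> z) \<Longrightarrow> len A M \<le> z"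
  unfolding len_eq_Sup by (rule Sup_least) blast

lemma len_attained:
  assumes "submod A" "submod M" "A \<subseteq> M" "len A M = enat m"
  shows "\<exists>C. strict_chain A M m C"
proof -
  define S where "S = {enat m | m. \<exists>C. strict_chain A M m C}"
  have "S \<noteq> {}"
  proof (cases "A = M")
    case True
    then have "strict_chain A M 0 (\<lambda>_. A)" using assms by (simp add: strict_chain_def)
    then show ?thesis unfolding S_def by blast
  next
    case False
    then have "strict_chain A M 1 (\<lambda>i. if i = 0 then A else M)" using assms by (auto simp: strict_chain_def)
    then show ?thesis unfolding S_def by blast
  qed
  moreover have "Sup S = enat m" using assms(4) unfolding len_eq_Sup S_def .
  ultimately have "finite S" "Max S = enat m" by (simp_all add: Sup_enat_def split: if_splits)
  then have "enat m \<in> S" using \<open>S \<noteq> {}\<close> Max_in[of S] by simp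
  then show ?thesis unfolding S_def by blast
qed

text \<open>Dropping the repetitions from a weakly increasing chain leaves a strict one.\<close>

lemma weak_chain_strict:
  assumes "\<And>i. i \<le> m \<Longrightarrow> submod (D i)" "\<And>i. i < m \<Longrightarrow> D i \<subseteq> D (Suc i)"
  shows "\<exists>C. strict_chain (D 0) (D m) (card {i. i < m \<and> D i \<noteq> D (Suc i)}) C"
  using assms
proof (induction m)
  case 0
  then have "strict_chain (D 0) (D 0) 0 (\<lambda>_. D 0)" by (auto simp: strict_chain_def)
  then show ?case by auto
next
  case (Suc m)
  let ?c = "card {i. i < m \<and> D i \<noteq> D (Suc i)}"
  obtain C where C: "strict_chain (D 0) (D m) ?c C" using Suc by (metis le_SucI less_SucI)
  show ?case
  proof (cases "D m = D (Suc m)")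
    case True
    then have "{i. i < Suc m \<and> D i \<noteq> D (Suc i)} = {i. i < m \<and> D i \<noteq> D (Suc i)}"
      using less_Suc_eq by auto
    then show ?thesis using C True by auto
  next
    case False
    then have "{i. i < Suc m \<and> D i \<noteq> D (Suc i)} = insert m {i. i < m \<and> D i \<noteq> D (Suc i)}"
      using less_Suc_eq by auto
    then have card: "card {i. i < Suc m \<and> D i \<noteq> D (Suc i)} = Suc ?c" by simp
    have "D m \<subset> D (Suc m)" using False Suc.prems(2)[of m] by blast
    then have "strict_chain (D 0) (D (Suc m)) (Suc ?c) (C(Suc ?c := D (Suc m)))"
      using C Suc.prems(1)[of "Suc m"] by (auto simp: strict_chain_def less_Suc_eq le_Suc_eq)
    then show ?thesis unfolding card by blast
  qed
qed

lemma weak_chain_len: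
  assumes "\<And>i. i \<le> m \<Longrightarrow> submod (D i)" "\<And>i. i < m \<Longrightarrow> D i \<subseteq> D (Suc i)"
  shows "enat (card {i. i < m \<and> D i \<noteq> D (Suc i)}) \<le> len (D 0) (D m)"
  using weak_chain_strict[of m D] assms strict_chain_le_len by blast

text \<open>Intersecting a chain with B and adding B to it, at each step at least one of the two results
  grows, by the modular law.\<close>

lemma len_subadditive:
  assumes "submod A" "submod B" "submod M" "A \<subseteq> B" "B \<subseteq> M"
  shows "len A M \<le> len A B + len B M"
proof (rule len_leI)
  fix m C assume C: "strict_chain A M m C"
  let ?D = "\<lambda>i. C i \<inter> B" and ?E = "\<lambda>i. C i + B"
  let ?I = "{i. i < m \<and> ?D i \<noteq> ?D (Suc i)}" and ?J = "{i. i < m \<and> ?E i \<noteq> ?E (Suc i)}"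
  have sm: "submod (C i)" if "i \<le> m" for i using C that by (auto simp: strict_chain_def)
  have inc: "C i \<subset> C (Suc i)" if "i < m" for i using C that by (auto simp: strict_chain_def)
  have "enat (card ?I) \<le> len (?D 0) (?D m)"
  proof (rule weak_chain_len)
    show "submod (?D i)" if "i \<le> m" for i using sm[OF that] assms(2) by (rule submod_Int)
    show "?D i \<subseteq> ?D (Suc i)" if "i < m" for i using inc[OF that] by blast
  qed
  then have 1: "enat (card ?I) \<le> len A B"
    using C assms by (simp add: strict_chain_def Int_absorb2 Int_absorb1)
  have "enat (card ?J) \<le> len (?E 0) (?E m)"
  proof (rule weak_chain_len)
    show "submod (?E i)" if "i \<le> m" for i using sm[OF that] assms(2) by (rule submod_plus)
    show "?E i \<subseteq> ?E (Suc i)" if "i < m" for i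
      using inc[OF that] by (intro set_plus_mono2) auto
  qed
  then have 2: "enat (card ?J) \<le> len B M"
    using C assms by (simp add: strict_chain_def plus_absorb plus_absorb2)
  have "{..<m} \<subseteq> ?I \<union> ?J"
  proof
    fix i assume "i \<in> {..<m}"
    then have i: "i < m" by simp
    {
      assume eq: "?D i = ?D (Suc i)" "?E i = ?E (Suc i)"
      have s: "submod (C i)" "submod (C (Suc i))" using sm i by auto
      have "C (Suc i) = (C i + B) \<inter> C (Suc i)"
        using eq(2) subset_plus_left[of B "C (Suc i)"] assms(2) by blast
      also have "\<dots> = C i + (B \<inter> C (Suc i))" using s assms(2) inc[OF i] by (intro modular_law) auto
      also have "\<dots> = C i + ?D i" using eq(1) by (simp add: Int_commute)
      also have "\<dots> = C i" using s assms by (intro plus_absorb2 submod_Int) auto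
      finally have False using inc[OF i] by auto
    }
    then show "i \<in> ?I \<union> ?J" using i by blast
  qed
  then have "card {..<m} \<le> card (?I \<union> ?J)" by (intro card_mono) auto
  then have "m \<le> card ?I + card ?J" using card_Un_le[of ?I ?J] by simp
  then have "enat m \<le> enat (card ?I) + enat (card ?J)" by simp
  also have "\<dots> \<le> len A B + len B M" using 1 2 by (rule add_mono)
  finally show "enat m \<le> len A B + len B M" .
qed

lemma len_superadditive:
  assumes "submod A" "submod B" "submod M" "A \<subseteq> B" "B \<subseteq> M" "len A B = enat a" "len B M = enat b"
  shows "enat (a + b) \<le> len A M"
proof -
  obtain C D where C: "strict_chain A B a C" and D: "strict_chain B M b D"
    using len_attained assms by meson
  let ?E = "\<lambda>i. if i < a then C i else D (i - a)"
  have glue: "C a = D 0" using strict_chain_end[OF C] strict_chain_start[OF D] by simp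
  have "strict_chain A M (a + b) ?E"
    unfolding strict_chain_def
  proof (intro conjI allI impI)
    show "?E 0 = A" using strict_chain_start[OF C] glue by (cases "a = 0") simp_all
    show "?E (a + b) = M" using strict_chain_end[OF D] by simp
  next
    fix i assume "i \<le> a + b"
    then show "submod (?E i)" using strict_chain_submod[OF C, of i] strict_chain_submod[OF D, of "i - a"] by simp
  next
    fix i assume i: "i < a + b"
    consider "Suc i < a" | "Suc i = a" | "a \<le> i" by linarith
    then show "?E i \<subset> ?E (Suc i)"
    proof cases
      case 1
      then show ?thesis using strict_chain_step[OF C, of i] by simp
    next
      case 2
      then show ?thesis using strict_chain_step[OF C, of i] glue by (metis diff_self_eq_0 lessI less_irrefl)
    next
      case 3
      then show ?thesis using strict_chain_step[OF D, of "i - a"] i by (simp add: Suc_diff_le)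
    qed
  qed
  then show ?thesis by (rule strict_chain_le_len)
qed

lemma len_additive:
  assumes "submod A" "submod B" "submod M" "A \<subseteq> B" "B \<subseteq> M" "len A B = enat a" "len B M = enat b"
  shows "len A M = enat (a + b)"
  using len_subadditive[OF assms(1-5)] len_superadditive[OF assms] unfolding assms(6,7) plus_enat_simps
  by (rule antisym)

text \<open>A strictly monotone map takes strict chains to strict chains of the same length.\<close>

lemma len_map:
  assumes "\<And>C. submod C \<Longrightarrow> A \<subseteq> C \<Longrightarrow> C \<subseteq> M \<Longrightarrow> submod (f C)"
    and "\<And>C D. submod C \<Longrightarrow> submod D \<Longrightarrow> A \<subseteq> C \<Longrightarrow> C \<subset> D \<Longrightarrow> D \<subseteq> M \<Longrightarrow> f C \<subset> f D"
    and "A' = f A" "M' = f M"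
  shows "len A M \<le> len A' M'"
proof (rule len_leI)
  fix m C assume C: "strict_chain A M m C"
  have b: "A \<subseteq> C i" "C i \<subseteq> M" "submod (C i)" if "i \<le> m" for i
    using strict_chain_bounds[OF C that] strict_chain_submod[OF C that] by auto
  have "f (C i) \<subset> f (C (Suc i))" if "i < m" for i
    using that b[of i] b[of "Suc i"] strict_chain_step[OF C that] by (intro assms(2)) auto
  then have "strict_chain A' M' m (\<lambda>i. f (C i))"
    unfolding strict_chain_def using strict_chain_start[OF C] strict_chain_end[OF C] assms(1,3,4) b by auto
  then show "enat m \<le> len A' M'" by (rule strict_chain_le_len)
qed

lemma len_map_anti:
  assumes "\<And>C. submod C \<Longrightarrow> A \<subseteq> C \<Longrightarrow> C \<subseteq> M \<Longrightarrow> submod (f C)"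
    and "\<And>C D. submod C \<Longrightarrow> submod D \<Longrightarrow> A \<subseteq> C \<Longrightarrow> C \<subset> D \<Longrightarrow> D \<subseteq> M \<Longrightarrow> f D \<subset> f C"
    and "A' = f A" "M' = f M"
  shows "len A M \<le> len M' A'"
proof (rule len_leI)
  fix m C assume C: "strict_chain A M m C"
  have b: "A \<subseteq> C i" "C i \<subseteq> M" "submod (C i)" if "i \<le> m" for i
    using strict_chain_bounds[OF C that] strict_chain_submod[OF C that] by auto
  have "f (C (m - i)) \<subset> f (C (m - Suc i))" if "i < m" for i
  proof (rule assms(2))
    show "C (m - Suc i) \<subset> C (m - i)"
      using strict_chain_step[OF C, of "m - Suc i"] that by (simp add: Suc_diff_Suc)
  qed (use b in auto)
  then have "strict_chain M' A' m (\<lambda>i. f (C (m - i)))"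
    unfolding strict_chain_def using strict_chain_start[OF C] strict_chain_end[OF C] assms(1,3,4) b by auto
  then show "enat m \<le> len M' A'" by (rule strict_chain_le_len)
qed

text \<open>By the modular law, adding B and intersecting with A are inverse to each other.\<close>

lemma len_second_iso:
  assumes A: "submod A" and B: "submod B"
  shows "len (A \<inter> B) A = len B (A + B)"
proof (rule antisym)
  have BA: "submod (B \<inter> A)" using A B by (rule submod_Int[rotated])
  show "len (A \<inter> B) A \<le> len B (A + B)"
  proof (rule len_map[where f = "\<lambda>C. C + B"])
    fix C D assume *: "submod C" "submod D" "A \<inter> B \<subseteq> C" "C \<subset> D" "D \<subseteq> A"
    have rec: "(E + B) \<inter> A = E" if E: "submod E" "A \<inter> B \<subseteq> E" "E \<subseteq> A" for E
    proof -
      have "(E + B) \<inter> A = E + (B \<inter> A)" by (rule modular_law[OF E(1) B A E(3)])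
      also have "\<dots> = E" using E(2) by (intro plus_absorb2[OF E(1) BA]) (simp add: Int_commute)
      finally show ?thesis .
    qed
    have sub: "A \<inter> B \<subseteq> D" "C \<subseteq> A" using * by blast+
    have "C + B \<subseteq> D + B" using * by (intro set_plus_mono2) auto
    moreover have "C + B \<noteq> D + B"
    proof
      assume "C + B = D + B"
      then have "(C + B) \<inter> A = (D + B) \<inter> A" by (rule arg_cong)
      then have "C = D" unfolding rec[OF *(1,3) sub(2)] rec[OF *(2) sub(1) *(5)] .
      then show False using *(4) by simp
    qed
    ultimately show "C + B \<subset> D + B" by (rule psubsetI)
  next
    fix C assume "submod C" then show "submod (C + B)" using B by (rule submod_plus)
  next
    show "B = A \<inter> B + B" by (rule plus_absorb[symmetric, OF submod_Int[OF A B] B Int_lower2])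
  qed (rule refl)
  show "len B (A + B) \<le> len (A \<inter> B) A"
  proof (rule len_map[where f = "\<lambda>C. C \<inter> A"])
    fix C D assume *: "submod C" "submod D" "B \<subseteq> C" "C \<subset> D" "D \<subseteq> A + B"
    have rec: "B + (E \<inter> A) = E" if E: "submod E" "B \<subseteq> E" "E \<subseteq> A + B" for E
    proof -
      have "B + (A \<inter> E) = (B + A) \<inter> E" by (rule modular_law[OF B A E(1,2), symmetric])
      also have "\<dots> = E" using E(3) unfolding add.commute[of B A] by (rule Int_absorb1)
      finally show ?thesis by (simp only: Int_commute)
    qed
    have sub: "B \<subseteq> D" "C \<subseteq> A + B" using * by blast+
    have "C \<inter> A \<noteq> D \<inter> A"
    proof
      assume "C \<inter> A = D \<inter> A"
      then have "B + (C \<inter> A) = B + (D \<inter> A)" by (rule arg_cong)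
      then have "C = D" unfolding rec[OF *(1,3) sub(2)] rec[OF *(2) sub(1) *(5)] .
      then show False using *(4) by simp
    qed
    then show "C \<inter> A \<subset> D \<inter> A" using *(4) by blast
  next
    fix C assume "submod C" then show "submod (C \<inter> A)" using A by (rule submod_Int)
  next
    show "A = (A + B) \<inter> A" by (rule Int_absorb1[symmetric, OF subset_plus_left[OF B]])
  qed (rule Int_commute)
qed

lemma len_refl [simp]: "len A A = 0"
proof -
  have "enat m \<le> 0" if C: "strict_chain A A m C" for m C
  proof (rule ccontr)
    assume "\<not> enat m \<le> 0"
    then have "0 < m" by (simp add: zero_enat_def)
    then show False
      using strict_chain_step[OF C, of 0] strict_chain_bounds[OF C, of 1] strict_chain_start[OF C] by auto
  qed
  then have "len A A \<le> 0" by (rule len_leI)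
  then show ?thesis by simp
qed

lemma len_pos:
  assumes "submod A" "submod B" "A \<subset> B"
  shows "1 \<le> len A B"
proof -
  have "strict_chain A B 1 (\<lambda>i. if i = 0 then A else B)"
    using assms by (simp add: strict_chain_def)
  then have "enat 1 \<le> len A B" by (rule strict_chain_le_len)
  then show ?thesis by (simp only: one_enat_def)
qed

definition line :: "'v \<Rightarrow> 'v set" where
  "line x = {c *s x | c. c \<in> int_ring v}"

lemma lineI: "c \<in> int_ring v \<Longrightarrow> c *s x \<in> line x"
  unfolding line_def by blast

lemma lineE: assumes "y \<in> line x" obtains c where "c \<in> int_ring v" "y = c *s x"
  using assms unfolding line_def by blast

lemma submod_line: "submod (line x)"
proof (rule submodI)
  show "0 \<in> line x" using lineI[of 0 x] by simp
next
  fix y z assume "y \<in> line x" "z \<in> line x"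
  then obtain c d where *: "c \<in> int_ring v" "d \<in> int_ring v" "y = c *s x" "z = d *s x"
    by (blast elim: lineE)
  then have "y + z = (c + d) *s x" by (simp add: scale_left_distrib)
  then show "y + z \<in> line x" using lineI[OF val_ge_add[OF *(1,2)]] by simp
next
  fix c y assume c: "c \<in> int_ring v" and "y \<in> line x"
  then obtain d where "d \<in> int_ring v" "y = d *s x" by (blast elim: lineE)
  then show "c *s y \<in> line x" using lineI[OF val_ge_mult0[OF c]] by simp
qed

lemma line_self: "x \<in> line x"
  using lineI[of 1 x] by simp

lemma line_subset: "submod A \<Longrightarrow> x \<in> A \<Longrightarrow> line x \<subseteq> A"
  by (auto simp: line_def submod_scale)

text \<open>Adjoining a vector x whose multiple by the uniformizer is already present gives a simple
  quotient: a unit multiple of x modulo A recovers x.\<close>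

lemma len_adjoin_le:
  assumes A: "submod A" and x: "\<epsilon> *s x \<in> A"
  shows "len A (A + line x) \<le> 1"
proof (rule len_leI)
  fix m C assume C: "strict_chain A (A + line x) m C"
  show "enat m \<le> 1"
  proof (rule ccontr)
    assume "\<not> enat m \<le> 1"
    then have m: "m \<ge> 2" unfolding one_enat_def by simp
    define D where "D = C 1"
    have Suc1: "Suc 0 = 1" "Suc 1 = 2" by simp_all
    have D: "submod D" unfolding D_def using m by (intro strict_chain_submod[OF C]) simp
    have AD: "A \<subset> D"
      using strict_chain_step[OF C, of 0] m unfolding strict_chain_start[OF C] Suc1 D_def by simp
    have "D \<subset> C 2" using strict_chain_step[OF C, of 1] m unfolding Suc1 D_def by simp
    then have DM: "D \<subset> A + line x" using strict_chain_bounds[OF C m] by blast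
    obtain y where y: "y \<in> D" "y \<notin> A" using AD by blast
    then have "y \<in> A + line x" using DM by blast
    then obtain a w where aw: "y = a + w" "a \<in> A" "w \<in> line x" by (rule set_plus_elim)
    then obtain c where ac: "y = a + c *s x" "a \<in> A" "c \<in> int_ring v" by (blast elim: lineE)
    have "c \<notin> val_ge v 1"
    proof
      assume "c \<in> val_ge v 1"
      then have "c * inverse \<epsilon> \<in> int_ring v"
        using val_ge_mult[OF _ val_ge_inverse[OF eps_nz], of c 1] v_eps by simp
      then have "(c * inverse \<epsilon>) *s \<epsilon> *s x \<in> A" using A x submod_scale by blast
      then have "c *s x \<in> A" by (simp add: mult.assoc)
      then show False using submod_add[OF A ac(2)] ac(1) y(2) by simp
    qed
    then have c: "c \<noteq> 0" "v c = 0" using ac(3) by (auto simp: val_ge_def)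
    have "a \<in> D" using ac(2) AD by blast
    then have "c *s x \<in> D" using submod_diff[OF D y(1), of a] ac(1) by simp
    then have "inverse c *s c *s x \<in> D"
      using submod_scale[OF D, of "inverse c" "c *s x"] val_ge_inverse[OF c(1)] c(2) by simp
    then have "x \<in> D" using c(1) by simp
    then have "A + line x \<subseteq> D" using AD line_subset[OF D] by (intro plus_subset[OF D]) auto
    then show False using DM by blast
  qed
qed

lemma len_adjoin:
  assumes A: "submod A" and x: "\<epsilon> *s x \<in> A" "x \<notin> A"
  shows "len A (A + line x) = 1"
proof (rule antisym[OF len_adjoin_le])
  have "A \<subseteq> A + line x" by (rule subset_plus_left[OF submod_line])
  moreover have "x \<in> A + line x" using set_plus_intro[OF submod_0[OF A] line_self[of x]] by simp
  ultimately have "A \<subset> A + line x" using x(2) by blast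
  then show "1 \<le> len A (A + line x)" using A submod_line by (intro len_pos submod_plus)
qed (use assms in auto)

section \<open>Boxes and adapted bases\<close>

lemma scale_cancel_powi: "\<epsilon> powi i *s \<epsilon> powi (- i) *s x = x" "\<epsilon> powi (- i) *s \<epsilon> powi i *s x = x"
  unfolding scale_scale powi_minus_cancel by simp_all

abbreviation twist :: "int \<Rightarrow> 'v set \<Rightarrow> 'v set" where "twist \<equiv> scale_lattice scale \<epsilon>"

lemma twist_iff: "x \<in> twist j A \<longleftrightarrow> \<epsilon> powi (- j) *s x \<in> A"
proof
  assume "x \<in> twist j A"
  then obtain y where "y \<in> A" "x = \<epsilon> powi j *s y" unfolding scale_lattice_def by blast
  then show "\<epsilon> powi (- j) *s x \<in> A" by (simp only: scale_cancel_powi)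
next
  assume "\<epsilon> powi (- j) *s x \<in> A"
  then have "\<epsilon> powi j *s \<epsilon> powi (- j) *s x \<in> twist j A" unfolding scale_lattice_def by (rule imageI)
  then show "x \<in> twist j A" by (simp only: scale_cancel_powi)
qed

lemma twist_0 [simp]: "twist 0 A = A"
  by (rule Set.set_eqI) (simp add: twist_iff)

lemma twist_twist [simp]: "twist i (twist j A) = twist (i + j) A"
proof (rule Set.set_eqI)
  fix x
  have "\<epsilon> powi (- j) *s \<epsilon> powi (- i) *s x = \<epsilon> powi (- i + - j) *s x"
    by (simp only: scale_scale powi_add mult.commute)
  then show "x \<in> twist i (twist j A) \<longleftrightarrow> x \<in> twist (i + j) A" by (simp only: twist_iff minus_add_distrib)
qed

lemma twist_mono: "A \<subseteq> B \<Longrightarrow> twist j A \<subseteq> twist j B"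
  by (auto simp: twist_iff)

lemma submod_twist: assumes "submod A" shows "submod (twist j A)"
proof (rule submodI)
  show "0 \<in> twist j A" using assms by (simp add: twist_iff submod_0)
next
  fix x y assume "x \<in> twist j A" "y \<in> twist j A"
  then show "x + y \<in> twist j A" unfolding twist_iff scale_right_distrib by (rule submod_add[OF assms])
next
  fix c x assume c: "c \<in> int_ring v" and "x \<in> twist j A"
  then show "c *s x \<in> twist j A"
    unfolding twist_iff scale_left_commute[of _ c] by (rule submod_scale[OF assms])
qed

lemma twist_box: "frame m e \<Longrightarrow> twist j (box m e a) = box m e (\<lambda>i. a i + j)"
proof (rule Set.set_eqI)
  fix x assume e: "frame m e"
  have "\<epsilon> powi (- j) *s x \<in> fspan m e \<longleftrightarrow> x \<in> fspan m e"
    using span_scale[of "\<epsilon> powi (- j) *s x" "e ` {..<m}" "\<epsilon> powi j"] span_scale[of x "e ` {..<m}"]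
    unfolding scale_cancel_powi by blast
  then show "x \<in> twist j (box m e a) \<longleftrightarrow> x \<in> box m e (\<lambda>i. a i + j)"
    using e by (auto simp: twist_iff box_def coord_scale val_ge_powi_mult simp del: power_int_minus)
qed

lemma powi_basis_in_box: "frame m e \<Longrightarrow> i < m \<Longrightarrow> \<epsilon> powi k *s e i \<in> box m e a \<longleftrightarrow>
    (\<forall>j<m. j = i \<longrightarrow> a j \<le> k)"
  by (auto simp: box_def coord_scale coord_basis span_base span_scale val_ge_powi)

text \<open>Lowering one exponent by one is adjoining one vector, so lengths between boxes can be counted
  one unit at a time.\<close>

lemma box_lower:
  assumes e: "frame m e" and i: "i < m"
  shows "len (box m e a) (box m e (a(i := a i - 1))) = 1"
proof -
  let ?x = "\<epsilon> powi (a i - 1) *s e i" and ?a = "a(i := a i - 1)"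
  have sm: "submod (box m e a)" "submod (box m e ?a)" using submod_box[OF e] by auto
  have x: "?x \<in> box m e ?a" "?x \<notin> box m e a" using powi_basis_in_box[OF e i] i by auto
  have "box m e a + line ?x = box m e ?a"
  proof (rule antisym)
    show "box m e a + line ?x \<subseteq> box m e ?a"
      using x sm line_subset by (intro plus_subset box_mono) auto
    show "box m e ?a \<subseteq> box m e a + line ?x"
    proof
      fix y assume y: "y \<in> box m e ?a"
      let ?c = "coord m e i y"
      have c: "?c \<in> val_ge v (a i - 1)" using y i by (auto simp: box_def)
      have ei: "e i \<in> fspan m e" using i by (intro span_base) auto
      have yc: "y - ?c *s e i \<in> box m e a"
        using y e i ei unfolding box_def
        by (auto simp: coord_diff coord_scale coord_basis span_scale intro!: span_diff)
      have "?c *s e i = (\<epsilon> powi (- (a i - 1)) * ?c) *s ?x"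
        by (simp add: mult.assoc[symmetric] mult.commute[of "?c"] del: minus_diff_eq power_int_minus)
      also have "\<dots> \<in> line ?x" using c by (intro lineI) (simp add: val_ge_powi_mult del: power_int_minus minus_diff_eq)
      finally have "(y - ?c *s e i) + ?c *s e i \<in> box m e a + line ?x" using yc by (intro set_plus_intro)
      then show "y \<in> box m e a + line ?x" by simp
    qed
  qed
  moreover have "\<epsilon> *s ?x = \<epsilon> powi (a i) *s e i"
    using powi_add[of 1 "a i - 1"] by simp
  moreover have "\<epsilon> powi (a i) *s e i \<in> box m e a" using powi_basis_in_box[OF e i] by blast
  ultimately show ?thesis using len_adjoin[OF sm(1) _ x(2)] by argo
qed

lemma box_len:
  assumes e: "frame m e" and "\<And>i. i < m \<Longrightarrow> c i \<le> a i"
  shows "len (box m e a) (box m e c) = enat (\<Sum>i<m. nat (a i - c i))"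
  using assms(2)
proof (induction "\<Sum>i<m. nat (a i - c i)" arbitrary: a)
  case 0
  then have "\<forall>i<m. nat (a i - c i) = 0" using sum_eq_0_iff[of "{..<m}" "\<lambda>i. nat (a i - c i)"] by auto
  then have "\<forall>i<m. a i = c i" using "0.prems" by (metis diff_le_0_iff_le nat_0_iff order_antisym)
  then have "box m e a = box m e c" by (simp add: box_def)
  then show ?case using 0 by (simp add: zero_enat_def)
next
  case (Suc s)
  have "\<not> (\<forall>i<m. a i \<le> c i)"
  proof
    assume "\<forall>i<m. a i \<le> c i"
    then have "(\<Sum>i<m. nat (a i - c i)) = 0" by (intro sum.neutral) auto
    then show False using Suc.hyps(2) by simp
  qed
  then obtain i where i: "i < m" "c i < a i" by fastforce
  let ?a = "a(i := a i - 1)"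
  have split: "(\<Sum>j<m. nat (f j - c j)) = nat (f i - c i) + (\<Sum>j\<in>{..<m} - {i}. nat (f j - c j))" for f
    using i by (intro sum.remove) auto
  have "(\<Sum>j<m. nat (?a j - c j)) = nat (a i - 1 - c i) + (\<Sum>j\<in>{..<m} - {i}. nat (a j - c j))"
    unfolding split[of ?a] by (intro arg_cong2[of _ _ _ _ "(+)"] sum.cong) auto
  moreover have "nat (a i - c i) = Suc (nat (a i - 1 - c i))" using i by simp
  ultimately have s: "s = (\<Sum>j<m. nat (?a j - c j))" using Suc.hyps(2) split[of a] by simp
  have le: "c j \<le> ?a j" if "j < m" for j using Suc.prems i that by auto
  have "len (box m e ?a) (box m e c) = enat s" unfolding s by (rule Suc.hyps(1)[OF s le])
  moreover have "len (box m e a) (box m e ?a) = enat 1" using box_lower[OF e i(1)] by (simp add: one_enat_def)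
  moreover have "box m e a \<subseteq> box m e ?a" "box m e ?a \<subseteq> box m e c" using le by (auto intro!: box_mono)
  ultimately have "len (box m e a) (box m e c) = enat (1 + s)"
    using submod_box[OF e] by (intro len_additive)
  then show ?case using Suc.hyps(2) by simp
qed

lemma box_plus:
  assumes e: "frame m e"
  shows "box m e a + box m e c = box m e (\<lambda>i. min (a i) (c i))"
proof (rule antisym)
  show "box m e a + box m e c \<subseteq> box m e (\<lambda>i. min (a i) (c i))"
    using submod_box[OF e] by (intro plus_subset box_mono) auto
  show "box m e (\<lambda>i. min (a i) (c i)) \<subseteq> box m e a + box m e c"
  proof
    fix x assume x: "x \<in> box m e (\<lambda>i. min (a i) (c i))"
    let ?y = "\<Sum>i<m. (if a i \<le> c i then coord m e i x else 0) *s e i"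
    let ?z = "\<Sum>i<m. (if a i \<le> c i then 0 else coord m e i x) *s e i"
    have c: "coord m e i x \<in> val_ge v (min (a i) (c i))" if "i < m" for i using x that by (simp add: box_def)
    have "?y \<in> box m e a"
    proof (rule sum_in_box[OF e])
      fix i assume "i < m"
      then show "(if a i \<le> c i then coord m e i x else 0) \<in> val_ge v (a i)" using c[of i] by (auto simp: min_def)
    qed
    moreover have "?z \<in> box m e c"
    proof (rule sum_in_box[OF e])
      fix i assume "i < m"
      then show "(if a i \<le> c i then 0 else coord m e i x) \<in> val_ge v (c i)" using c[of i] by (auto simp: min_def)
    qed
    ultimately have "?y + ?z \<in> box m e a + box m e c" by (rule set_plus_intro)
    moreover have "?y + ?z = (\<Sum>i<m. coord m e i x *s e i)"
      unfolding sum.distrib[symmetric] by (intro sum.cong) auto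
    then have "?y + ?z = x" using coord_expand[OF e box_fspan[OF x]] by simp
    ultimately show "x \<in> box m e a + box m e c" by simp
  qed
qed

lemma box_coord_lessE:
  assumes "x \<in> box m e (\<lambda>_. A)" "x \<notin> box m e (\<lambda>_. A + 1)"
  obtains i where "i < m" "coord m e i x \<noteq> 0" "v (coord m e i x) = A"
proof -
  obtain i where i: "i < m" "coord m e i x \<notin> val_ge v (A + 1)" using assms by (auto simp: box_def)
  moreover have "coord m e i x \<in> val_ge v A" using assms(1) i by (auto simp: box_def)
  ultimately show ?thesis using that[of i] by (auto simp: val_ge_def)
qed

lemma frame_snoc:
  assumes e: "frame m e" and w: "w \<notin> fspan m e"
  shows "frame (Suc m) (e(m := w))"
    and "fspan (Suc m) (e(m := w)) = span (insert w (e ` {..<m}))"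
proof -
  have im: "(e(m := w)) ` {..<Suc m} = insert w (e ` {..<m})" by (auto simp: lessThan_Suc)
  have "w \<notin> e ` {..<m}" using w span_base[of w "e ` {..<m}"] by blast
  moreover have "inj_on (e(m := w)) {..<m} = inj_on e {..<m}" by (intro inj_on_cong) auto
  ultimately have "inj_on (e(m := w)) {..<Suc m}"
    using e by (auto simp: frame_def lessThan_Suc)
  moreover have "independent (insert w (e ` {..<m}))"
    using e w by (intro independent_insertI) (auto simp: frame_def)
  ultimately show "frame (Suc m) (e(m := w))" unfolding frame_def im by blast
  show "fspan (Suc m) (e(m := w)) = span (insert w (e ` {..<m}))" unfolding im ..
qed

text \<open>In a frame extended by w, the coordinates are read off by first splitting off the multiple of w.\<close>

lemma box_snoc:
  assumes e: "frame m e" and w: "w \<notin> fspan m e"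
    and y: "y \<in> fspan m e"
  shows "y + c *s w \<in> box (Suc m) (e(m := w)) a \<longleftrightarrow> y \<in> box m e a \<and> c \<in> val_ge v (a m)"
proof -
  let ?e = "e(m := w)" and ?c = "\<lambda>i. if i = m then c else coord m e i y"
  have "(\<Sum>i<Suc m. ?c i *s ?e i) = (\<Sum>i<m. coord m e i y *s e i) + c *s w"
    by (simp add: sum.lessThan_Suc)
  also have "\<dots> = y + c *s w" using coord_expand[OF e y] by simp
  finally have sum: "y + c *s w = (\<Sum>i<Suc m. ?c i *s ?e i)" ..
  have "coord (Suc m) ?e i (y + c *s w) = ?c i" if "i < Suc m" for i
    unfolding sum using coord_lincomb[OF frame_snoc(1)[OF e w] that] .
  moreover have "y + c *s w \<in> fspan (Suc m) ?e" unfolding sum by (rule sum_in_fspan)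
  ultimately show ?thesis using y by (auto simp: box_def less_Suc_eq)
qed

text \<open>Elementary divisors. Choose the largest A with M contained in the A-th multiple of the standard
  module, and a vector of M that attains it; suitably normalised it is the A-th multiple of a
  basis vector of the standard module, and a coordinate function splits it off from both modules
  at once. It comes last, because the exponents found later are at least A.\<close>

theorem adapted_frame:
  assumes "frame m b" "submod M" "box m b (\<lambda>_. k) \<subseteq> M" "M \<subseteq> box m b (\<lambda>_. - k)"
  shows "\<exists>e a. frame m e \<and> fspan m e = fspan m b \<and> box m e (\<lambda>_. 0) = box m b (\<lambda>_. 0) \<and>
    M = box m e a \<and> (\<forall>i j. i \<le> j \<longrightarrow> j < m \<longrightarrow> a j \<le> a i)"
  using assms
proof (induction m arbitrary: b M)
  case 0
  have "box 0 b a = {0}" for a by (auto simp: box_def)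
  then have "M = box 0 b (\<lambda>_. 0)" using 0 by auto
  then show ?case using 0 by blast
next
  case (Suc m)
  note b = \<open>frame (Suc m) b\<close> and M = \<open>submod M\<close>
  let ?Q = "\<lambda>A. M \<subseteq> box (Suc m) b (\<lambda>_. A)"
  have bound: "A \<le> k" if "?Q A" for A
  proof -
    have "box (Suc m) b (\<lambda>_. k) \<subseteq> box (Suc m) b (\<lambda>_. A)" using that Suc.prems(3) by blast
    then show ?thesis unfolding box_subset_iff[OF b] by blast
  qed
  have "\<exists>A. ?Q A \<and> \<not> ?Q (A + 1)"
  proof (rule ccontr)
    assume no: "\<nexists>A. ?Q A \<and> \<not> ?Q (A + 1)"
    have "?Q (- k + int j)" for j
    proof (induction j)
      case 0
      then show ?case using Suc.prems(4) by simp
    next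
      case (Suc j)
      then have "?Q (- k + int j + 1)" using no by blast
      then show ?case by (simp add: algebra_simps)
    qed
    from bound[OF this[of "nat (2 * \<bar>k\<bar> + 1)"]] show False by auto
  qed
  then obtain A x where A: "?Q A" and x: "x \<in> M" "x \<notin> box (Suc m) b (\<lambda>_. A + 1)" by blast
  have xA: "x \<in> box (Suc m) b (\<lambda>_. A)" using x(1) A by blast
  obtain i0 where i0: "i0 < Suc m" "coord (Suc m) b i0 x \<noteq> 0" "v (coord (Suc m) b i0 x) = A"
    using box_coord_lessE[OF xA x(2)] .
  define \<phi> where "\<phi> = coord (Suc m) b i0"
  define w where "w = inverse (\<phi> x) *s x"
  have xspan: "x \<in> fspan (Suc m) b" using xA by (rule box_fspan)
  have wspan: "w \<in> fspan (Suc m) b" unfolding w_def by (rule span_scale[OF xspan])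
  have \<phi>w: "\<phi> w = 1" using i0 b xspan by (simp add: w_def \<phi>_def coord_scale)
  have xw: "x = \<phi> x *s w" using i0 by (simp add: w_def \<phi>_def)
  \<comment> \<open>The A-th multiple of w is a unit multiple of x.\<close>
  have AwM: "c *s w \<in> M" if "c \<in> val_ge v A" for c
  proof -
    have "c / \<phi> x \<in> int_ring v" using val_ge_divide[of "\<phi> x" c] i0 that by (simp add: \<phi>_def)
    then have "(c / \<phi> x) *s x \<in> M" using submod_scale[OF M] x(1) by blast
    then show ?thesis by (simp add: w_def divide_inverse)
  qed
  \<comment> \<open>The other basis vectors, the last one moved to the free position i0.\<close>
  define s where "s = (\<lambda>i. if i = i0 then m else i)"
  define b' where "b' = (\<lambda>i. b (s i))"
  have s_inj: "inj_on s {..<m}" and s_im: "s ` {..<m} = {..<Suc m} - {i0}"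
  proof -
    show "inj_on s {..<m}" by (auto simp: s_def inj_on_def)
    show "s ` {..<m} = {..<Suc m} - {i0}"
    proof (rule antisym)
      show "s ` {..<m} \<subseteq> {..<Suc m} - {i0}" using i0(1) by (auto simp: s_def)
      show "{..<Suc m} - {i0} \<subseteq> s ` {..<m}"
      proof
        fix j assume j: "j \<in> {..<Suc m} - {i0}"
        show "j \<in> s ` {..<m}"
        proof (cases "j = m")
          case True
          then have "i0 < m" "s i0 = j" using j i0(1) by (auto simp: s_def)
          then show ?thesis by blast
        next
          case False
          then have "j < m" "s j = j" using j by (auto simp: s_def)
          then show ?thesis by (metis imageI lessThan_iff)
        qed
      qed
    qed
  qed
  have s_less: "s i < Suc m" "s i \<noteq> i0" if "i < m" for i using s_im that by blast+
  have im: "b' ` {..<m} = b ` ({..<Suc m} - {i0})" unfolding b'_def s_im[symmetric] by (simp add: image_image)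
  have b': "frame m b'"
  proof -
    have "inj_on (b \<circ> s) {..<m}"
      using s_inj b unfolding s_im frame_def by (intro comp_inj_on) (auto simp: s_im intro: inj_on_subset)
    moreover have "b' ` {..<m} \<subseteq> b ` {..<Suc m}" unfolding im by blast
    ultimately show ?thesis using b independent_mono unfolding frame_def b'_def comp_def by blast
  qed
  have sub: "fspan m b' \<subseteq> fspan (Suc m) b" unfolding im by (intro span_mono) blast
  have lin: "(\<Sum>i<Suc m. coord (Suc m) b i y *s b i) =
      (\<Sum>i<m. coord (Suc m) b (s i) y *s b' i) + \<phi> y *s b i0" for y
  proof -
    have "(\<Sum>i<Suc m. coord (Suc m) b i y *s b i) = \<phi> y *s b i0 + (\<Sum>i\<in>s ` {..<m}. coord (Suc m) b i y *s b i)"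
      unfolding s_im \<phi>_def using i0(1) by (subst sum.remove[of _ i0]) auto
    then show ?thesis by (subst (asm) sum.reindex[OF s_inj]) (simp add: b'_def add.commute)
  qed
  have ker: "y \<in> fspan m b'" if "y \<in> fspan (Suc m) b" "\<phi> y = 0" for y
    using lin[of y] coord_expand[OF b that(1)] that(2) sum_in_fspan[where m = m and e = b'] by simp metis
  have coord': "coord m b' i y = coord (Suc m) b (s i) y" if "y \<in> fspan (Suc m) b" "\<phi> y = 0" "i < m" for y i
  proof -
    have "y = (\<Sum>i<m. coord (Suc m) b (s i) y *s b' i)" using lin[of y] coord_expand[OF b that(1)] that(2) by simp
    then show ?thesis using coord_lincomb[OF b' that(3), of "\<lambda>i. coord (Suc m) b (s i) y"] by simp
  qed
  have \<phi>0: "\<phi> y = 0" if "y \<in> fspan m b'" for y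
  proof -
    have "\<phi> y = \<phi> (\<Sum>i<m. coord m b' i y *s b' i)" using coord_expand[OF b' that] by simp
    also have "\<dots> = (\<Sum>i<m. \<phi> (coord m b' i y *s b' i))"
      unfolding \<phi>_def using s_less by (intro coord_sum[OF b]) (auto simp: b'_def intro!: span_scale intro: span_base)
    also have "\<dots> = 0" using s_less i0(1) by (intro sum.neutral)
        (auto simp: \<phi>_def b'_def coord_scale[OF b] coord_basis[OF b] span_base)
    finally show ?thesis .
  qed
  have box': "y \<in> box m b' (\<lambda>_. c) \<longleftrightarrow> y \<in> box (Suc m) b (\<lambda>_. c) \<and> \<phi> y = 0" for y c
  proof
    assume y: "y \<in> box m b' (\<lambda>_. c)"
    then have ys: "y \<in> fspan m b'" "\<phi> y = 0" "y \<in> fspan (Suc m) b" using box_fspan \<phi>0 sub by blast+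
    have "coord (Suc m) b j y \<in> val_ge v c" if "j < Suc m" for j
    proof (cases "j = i0")
      case True then show ?thesis using ys(2) by (simp add: \<phi>_def)
    next
      case False
      then obtain i where i: "i < m" "j = s i" using s_im \<open>j < Suc m\<close> by (metis DiffI imageE lessThan_iff singletonD)
      then have "coord m b' i y \<in> val_ge v c" using y by (simp add: box_def)
      then show ?thesis unfolding coord'[OF ys(3,2) i(1)] i(2) .
    qed
    then show "y \<in> box (Suc m) b (\<lambda>_. c) \<and> \<phi> y = 0" using ys by (simp add: box_def)
  next
    assume y: "y \<in> box (Suc m) b (\<lambda>_. c) \<and> \<phi> y = 0"
    then have "y \<in> fspan m b'" using ker box_fspan by blast
    moreover have "coord m b' i y \<in> val_ge v c" if "i < m" for i
      using y s_less(1)[OF that] coord'[of y i] that by (simp add: box_def)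
    ultimately show "y \<in> box m b' (\<lambda>_. c)" by (simp add: box_def)
  qed
  define M' where "M' = M \<inter> fspan m b'"
  have span': "submod (fspan m b')" by (intro submodI span_zero span_add span_scale)
  have "submod M'" unfolding M'_def by (rule submod_Int[OF M span'])
  moreover have "box m b' (\<lambda>_. k) \<subseteq> M'" using box' box_fspan Suc.prems(3) unfolding M'_def by blast
  moreover have "M' \<subseteq> box m b' (\<lambda>_. - k)" using box' \<phi>0 Suc.prems(4) unfolding M'_def by blast
  ultimately obtain e' a' where IH: "frame m e'" "fspan m e' = fspan m b'"
      "box m e' (\<lambda>_. 0) = box m b' (\<lambda>_. 0)" "M' = box m e' a'"
      "\<forall>i j. i \<le> j \<longrightarrow> j < m \<longrightarrow> a' j \<le> a' i"
    using Suc.IH[OF b', of M'] by blast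
  have wn: "w \<notin> fspan m e'" using \<phi>0 \<phi>w IH(2) by fastforce
  define e where "e = e'(m := w)"
  define a where "a = a'(m := A)"
  have e: "frame (Suc m) e" unfolding e_def by (rule frame_snoc(1)[OF IH(1) wn])
  have split: "y - \<phi> y *s w \<in> fspan m e'" if "y \<in> fspan (Suc m) b" for y
  proof -
    have "\<phi> (y - \<phi> y *s w) = \<phi> y - \<phi> y * \<phi> w"
      unfolding \<phi>_def using that wspan by (simp add: coord_diff[OF b] coord_scale[OF b] span_scale)
    then show ?thesis unfolding IH(2) using that wspan \<phi>w by (intro ker span_diff span_scale) auto
  qed
  have fs: "fspan (Suc m) e = fspan (Suc m) b"
  proof (rule antisym)
    have "e' ` {..<m} \<subseteq> fspan (Suc m) b" using sub IH(2) span_superset[of "e' ` {..<m}"] by blast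
    then show "fspan (Suc m) e \<subseteq> fspan (Suc m) b"
      unfolding e_def frame_snoc(2)[OF IH(1) wn] using wspan by (intro span_minimal) auto
    show "fspan (Suc m) b \<subseteq> fspan (Suc m) e"
    proof
      fix y assume "y \<in> fspan (Suc m) b"
      from split[OF this] have "y - \<phi> y *s w \<in> span (insert w (e' ` {..<m}))"
        using span_mono[of "e' ` {..<m}" "insert w (e' ` {..<m})"] by blast
      moreover have "\<phi> y *s w \<in> span (insert w (e' ` {..<m}))" by (intro span_scale span_base) simp
      ultimately have "(y - \<phi> y *s w) + \<phi> y *s w \<in> span (insert w (e' ` {..<m}))" by (rule span_add)
      then show "y \<in> fspan (Suc m) e" unfolding e_def frame_snoc(2)[OF IH(1) wn] by simp
    qed
  qed
  have mem: "y \<in> box (Suc m) e c \<longleftrightarrow> y - \<phi> y *s w \<in> box m e' c \<and> \<phi> y \<in> val_ge v (c m)"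
    if "y \<in> fspan (Suc m) b" for y c
    using box_snoc[OF IH(1) wn split[OF that], of "\<phi> y" c] unfolding e_def by simp
  have "w \<in> box (Suc m) b (\<lambda>_. 0)"
    using xA wspan i0 b xspan val_ge_divide[of "\<phi> x"] unfolding box_def w_def
    by (auto simp: coord_scale \<phi>_def divide_inverse mult.commute)
  then have w0: "c *s w \<in> box (Suc m) b (\<lambda>_. 0)" if "c \<in> int_ring v" for c
    using submod_scale[OF submod_box[OF b]] that by blast
  have "y \<in> box (Suc m) e (\<lambda>_. 0) \<longleftrightarrow> y \<in> box (Suc m) b (\<lambda>_. 0)" if ys: "y \<in> fspan (Suc m) b" for y
  proof -
    have "\<phi> (y - \<phi> y *s w) = 0" using \<phi>0 split[OF ys] IH(2) by blast
    then have "y \<in> box (Suc m) e (\<lambda>_. 0) \<longleftrightarrow> y - \<phi> y *s w \<in> box (Suc m) b (\<lambda>_. 0) \<and> \<phi> y \<in> int_ring v"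
      unfolding mem[OF ys] IH(3) box' by blast
    also have "\<dots> \<longleftrightarrow> y \<in> box (Suc m) b (\<lambda>_. 0)"
    proof
      assume "y - \<phi> y *s w \<in> box (Suc m) b (\<lambda>_. 0) \<and> \<phi> y \<in> int_ring v"
      then show "y \<in> box (Suc m) b (\<lambda>_. 0)"
        using submod_add[OF submod_box[OF b], of "y - \<phi> y *s w" _ "\<phi> y *s w"] w0 by simp
    next
      assume y0: "y \<in> box (Suc m) b (\<lambda>_. 0)"
      then have "\<phi> y \<in> int_ring v" using i0(1) by (simp add: box_def \<phi>_def)
      then show "y - \<phi> y *s w \<in> box (Suc m) b (\<lambda>_. 0) \<and> \<phi> y \<in> int_ring v"
        using submod_diff[OF submod_box[OF b] y0] w0 by blast
    qed
    finally show ?thesis .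
  qed
  then have "box (Suc m) e (\<lambda>_. 0) = box (Suc m) b (\<lambda>_. 0)" using box_fspan fs by blast
  moreover have "M = box (Suc m) e a"
  proof -
    have "y \<in> M \<longleftrightarrow> y \<in> box (Suc m) e a" if ys: "y \<in> fspan (Suc m) b" for y
    proof -
      have "y \<in> box (Suc m) e a \<longleftrightarrow> y - \<phi> y *s w \<in> box m e' a' \<and> \<phi> y \<in> val_ge v A"
        unfolding mem[OF ys] a_def by (simp add: box_def)
      also have "\<dots> \<longleftrightarrow> y - \<phi> y *s w \<in> M \<and> \<phi> y \<in> val_ge v A"
        unfolding IH(4)[symmetric] M'_def using split[OF ys] IH(2) by blast
      also have "\<dots> \<longleftrightarrow> y \<in> M"
      proof
        assume "y - \<phi> y *s w \<in> M \<and> \<phi> y \<in> val_ge v A"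
        then show "y \<in> M" using submod_add[OF M, of "y - \<phi> y *s w" "\<phi> y *s w"] AwM by simp
      next
        assume y: "y \<in> M"
        then have "\<phi> y \<in> val_ge v A" using A i0(1) by (auto simp: box_def \<phi>_def)
        then show "y - \<phi> y *s w \<in> M \<and> \<phi> y \<in> val_ge v A" using submod_diff[OF M y] AwM by blast
      qed
      finally show ?thesis ..
    qed
    then show ?thesis using box_fspan fs Suc.prems(4) by blast
  qed
  moreover have "\<forall>i j. i \<le> j \<longrightarrow> j < Suc m \<longrightarrow> a j \<le> a i"
  proof -
    have "box m e' a' \<subseteq> box m b' (\<lambda>_. A)"
      using IH(4) A box' \<phi>0 unfolding M'_def by blast
    also have "box m b' (\<lambda>_. A) = box m e' (\<lambda>_. A)"
      using arg_cong[OF IH(3), of "twist A"] unfolding twist_box[OF IH(1)] twist_box[OF b'] by simp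
    finally have "\<forall>i<m. A \<le> a' i" unfolding box_subset_iff[OF IH(1)] .
    then show ?thesis using IH(5) by (auto simp: a_def less_Suc_eq)
  qed
  ultimately show ?case using e fs by blast
qed

end

section \<open>Lattices and their volumes\<close>

locale lattice_space = valued_space scale v \<epsilon>
  for scale :: "'l::field \<Rightarrow> 'v::ab_group_add \<Rightarrow> 'v" (infixr \<open>*s\<close> 75)
    and v :: "'l \<Rightarrow> int" and \<epsilon> :: 'l +
  fixes n :: nat and b :: "nat \<Rightarrow> 'v"
  assumes frame_b: "frame n b"
begin

abbreviation V :: "'v set" where "V \<equiv> fspan n b"

abbreviation std :: "int \<Rightarrow> 'v set" where "std k \<equiv> box n b (\<lambda>_. k)"

text \<open>Boundedness on both sides is inherited by sums, intersections and duals; that it amounts to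
  being finitely generated and spanning V is shown below.\<close>

definition lat :: "'v set \<Rightarrow> bool" where
  "lat M \<longleftrightarrow> submod M \<and> (\<exists>k. std k \<subseteq> M \<and> M \<subseteq> std (- k))"

lemma lat_submod: "lat M \<Longrightarrow> submod M"
  by (simp add: lat_def)

lemma std_mono: "j \<le> k \<Longrightarrow> std k \<subseteq> std j"
  by (intro box_mono)

lemma lat_bound: assumes "lat M" shows "\<exists>k. \<forall>j\<ge>k. std j \<subseteq> M \<and> M \<subseteq> std (- j)"
proof -
  obtain k where k: "std k \<subseteq> M" "M \<subseteq> std (- k)" using assms by (auto simp: lat_def)
  have "std j \<subseteq> M \<and> M \<subseteq> std (- j)" if "k \<le> j" for j
    using k std_mono[OF that] std_mono[of "- j" "- k"] that by auto
  then show ?thesis by blast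
qed

lemma lat_subset_V: "lat M \<Longrightarrow> M \<subseteq> V"
  unfolding lat_def using box_fspan by blast

lemma latI: "submod M \<Longrightarrow> std j \<subseteq> M \<Longrightarrow> M \<subseteq> std k \<Longrightarrow> lat M"
proof -
  assume *: "submod M" "std j \<subseteq> M" "M \<subseteq> std k"
  have "std (max j (- k)) \<subseteq> std j" "std k \<subseteq> std (- max j (- k))" by (intro std_mono; linarith)+
  then show ?thesis unfolding lat_def using * by blast
qed

lemma lat_between: "submod C \<Longrightarrow> lat A \<Longrightarrow> lat B \<Longrightarrow> A \<subseteq> C \<Longrightarrow> C \<subseteq> B \<Longrightarrow> lat C"
  unfolding lat_def[of A] lat_def[of B] by (blast intro: latI)

lemma lat_Int: assumes "lat A" "lat B" shows "lat (A \<inter> B)"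
proof -
  obtain j k where *: "\<forall>i\<ge>j. std i \<subseteq> A \<and> A \<subseteq> std (- i)" "\<forall>i\<ge>k. std i \<subseteq> B \<and> B \<subseteq> std (- i)"
    using assms lat_bound by meson
  then show ?thesis
  proof -
    have "submod (A \<inter> B)" using assms by (intro submod_Int lat_submod)
    moreover have "std (max j k) \<subseteq> A \<inter> B" "A \<inter> B \<subseteq> std (- max j k)"
      using * by (simp_all add: le_infI1)
    ultimately show ?thesis by (rule latI)
  qed
qed

lemma lat_plus: assumes "lat A" "lat B" shows "lat (A + B)"
proof -
  obtain j k where *: "\<forall>i\<ge>j. std i \<subseteq> A \<and> A \<subseteq> std (- i)" "\<forall>i\<ge>k. std i \<subseteq> B \<and> B \<subseteq> std (- i)"
    using assms lat_bound by meson
  have sm: "submod A" "submod B" using assms lat_submod by auto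
  have "A \<subseteq> std (- max j k)" "B \<subseteq> std (- max j k)" using * by (auto dest!: spec[of _ "max j k"])
  then have "A + B \<subseteq> std (- max j k)" by (intro plus_subset submod_box frame_b)
  moreover have "std j \<subseteq> A + B" using * subset_plus_left[OF sm(2), of A] by blast
  ultimately show ?thesis using sm by (intro latI submod_plus)
qed

lemma lat_std: "lat (std k)"
  by (intro latI[of _ k k] submod_box frame_b order_refl)

lemma lat_twist: assumes "lat A" shows "lat (twist j A)"
proof -
  obtain k where "std k \<subseteq> A" "A \<subseteq> std (- k)" using assms by (auto simp: lat_def)
  then have "twist j (std k) \<subseteq> twist j A" "twist j A \<subseteq> twist j (std (- k))" by (simp_all add: twist_mono)
  then show ?thesis using assms unfolding twist_box[OF frame_b] by (blast intro: latI submod_twist lat_submod)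
qed

lemma in_some_std: "x \<in> V \<Longrightarrow> \<exists>k. \<forall>j\<ge>k. x \<in> std (- j)"
proof -
  assume x: "x \<in> V"
  let ?k = "\<Sum>i<n. \<bar>v (coord n b i x)\<bar>"
  have "coord n b i x \<in> val_ge v (- j)" if "i < n" "?k \<le> j" for i j
  proof -
    have "\<bar>v (coord n b i x)\<bar> \<le> ?k" using that(1) by (intro member_le_sum) auto
    then have "- j \<le> v (coord n b i x)" using that(2) by linarith
    then show ?thesis by (simp add: val_ge_def)
  qed
  then show ?thesis using x by (auto simp: box_def)
qed

lemma scaled_into_spanning:
  assumes M: "submod M" "span M = V" and x: "x \<in> V"
  shows "\<exists>k. \<forall>j\<ge>k. \<epsilon> powi j *s x \<in> M"
proof -
  let ?S = "{x. \<exists>k. \<forall>j\<ge>k. \<epsilon> powi j *s x \<in> M}"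
  have "subspace ?S"
  proof (rule subspaceI)
    show "0 \<in> ?S" using M(1) by (simp add: submod_0)
  next
    fix x y assume "x \<in> ?S" "y \<in> ?S"
    then obtain k l where "\<forall>j\<ge>k. \<epsilon> powi j *s x \<in> M" "\<forall>j\<ge>l. \<epsilon> powi j *s y \<in> M" by blast
    then have "\<forall>j\<ge>max k l. \<epsilon> powi j *s (x + y) \<in> M"
      using submod_add[OF M(1)] by (simp add: scale_right_distrib)
    then show "x + y \<in> ?S" by blast
  next
    fix c x assume "x \<in> ?S"
    then obtain k where k: "\<forall>j\<ge>k. \<epsilon> powi j *s x \<in> M" by blast
    have "\<epsilon> powi j *s c *s x \<in> M" if "j \<ge> k + \<bar>v c\<bar>" for j
    proof -
      have "(\<epsilon> powi (j - k) * c) *s \<epsilon> powi k *s x \<in> M"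
      proof (rule submod_scale[OF M(1)])
        show "\<epsilon> powi (j - k) * c \<in> int_ring v"
          unfolding val_ge_powi_mult using that by (auto simp: val_ge_def)
        show "\<epsilon> powi k *s x \<in> M" using k by simp
      qed
      moreover have "(\<epsilon> powi (j - k) * c) * \<epsilon> powi k = \<epsilon> powi j * c"
        using powi_add[of "j - k" k] by simp
      ultimately show ?thesis by simp
    qed
    then show "c *s x \<in> ?S" by blast
  qed
  moreover have "M \<subseteq> ?S"
  proof
    fix x assume "x \<in> M"
    then have "\<forall>j\<ge>0. \<epsilon> powi j *s x \<in> M" using submod_scale[OF M(1)] val_ge_powi by blast
    then show "x \<in> ?S" by blast
  qed
  ultimately have "span M \<subseteq> ?S" by (rule span_minimal[rotated])
  then show ?thesis using M(2) x by blast
qed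

lemma submod_int_span: "submod (int_span v scale m e)"
proof (rule submodI)
  show "0 \<in> int_span v scale m e" unfolding int_span_def by (intro CollectI exI[of _ "\<lambda>_. 0"]) simp
next
  fix x y assume "x \<in> int_span v scale m e" "y \<in> int_span v scale m e"
  then obtain c d where "\<forall>i<m. c i \<in> int_ring v" "\<forall>i<m. d i \<in> int_ring v"
      "x = (\<Sum>i<m. c i *s e i)" "y = (\<Sum>i<m. d i *s e i)" unfolding int_span_def by blast
  then show "x + y \<in> int_span v scale m e" unfolding int_span_def
    by (intro CollectI exI[of _ "\<lambda>i. c i + d i"]) (simp add: scale_left_distrib sum.distrib val_ge_add)
next
  fix r x assume r: "r \<in> int_ring v" and "x \<in> int_span v scale m e"
  then obtain c where "\<forall>i<m. c i \<in> int_ring v" "x = (\<Sum>i<m. c i *s e i)" unfolding int_span_def by blast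
  then show "r *s x \<in> int_span v scale m e" unfolding int_span_def
    by (intro CollectI exI[of _ "\<lambda>i. r * c i"]) (simp add: scale_sum_right val_ge_mult0[OF r])
qed

lemma lattice_in_imp_lat: assumes "lattice_in v scale V M" shows "lat M"
proof -
  obtain m e where M: "M = int_span v scale m e" and sp: "span M = V" using assms by (auto simp: lattice_in_def)
  have sm: "submod M" unfolding M by (rule submod_int_span)
  have "e i \<in> M" if "i < m" for i
  proof -
    have "(\<Sum>j<m. (if j = i then 1 else 0) *s e j) = e i"
      using that by (simp add: if_distrib[of "\<lambda>c. c *s _"] cong: if_cong)
    moreover have "(\<Sum>j<m. (if j = i then 1 else 0) *s e j) \<in> M" unfolding M int_span_def
      by (intro CollectI exI[of _ "\<lambda>j. if j = i then 1 else 0"]) simp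
    ultimately show ?thesis by simp
  qed
  then have "\<forall>i<m. \<exists>k. \<forall>j\<ge>k. e i \<in> std (- j)" using in_some_std sp span_base by blast
  then obtain k where k: "\<And>i j. i < m \<Longrightarrow> k i \<le> j \<Longrightarrow> e i \<in> std (- j)" by metis
  have "e i \<in> std (- (\<Sum>i<m. \<bar>k i\<bar>))" if "i < m" for i
  proof (rule k[OF that])
    have "\<bar>k i\<bar> \<le> (\<Sum>i<m. \<bar>k i\<bar>)" using that by (intro member_le_sum) auto
    then show "k i \<le> (\<Sum>i<m. \<bar>k i\<bar>)" by simp
  qed
  then have up: "M \<subseteq> std (- (\<Sum>i<m. \<bar>k i\<bar>))" unfolding M int_span_def
    by (auto intro!: submod_sum[OF submod_box[OF frame_b]] submod_scale[OF submod_box[OF frame_b]])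
  have "\<forall>i<n. \<exists>k. \<forall>j\<ge>k. \<epsilon> powi j *s b i \<in> M"
    by (intro allI impI scaled_into_spanning[OF sm sp] span_base) simp
  then obtain l where l: "\<And>i j. i < n \<Longrightarrow> l i \<le> j \<Longrightarrow> \<epsilon> powi j *s b i \<in> M" by metis
  let ?l = "\<Sum>i<n. \<bar>l i\<bar>"
  have lb: "\<epsilon> powi ?l *s b i \<in> M" if "i < n" for i
  proof (rule l[OF that])
    have "\<bar>l i\<bar> \<le> ?l" using that by (intro member_le_sum) auto
    then show "l i \<le> ?l" by simp
  qed
  have "std ?l \<subseteq> M"
  proof
    fix x assume x: "x \<in> std ?l"
    have "(\<epsilon> powi (- ?l) * coord n b i x) *s \<epsilon> powi ?l *s b i \<in> M" if "i < n" for i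
      using x that by (intro submod_scale[OF sm] lb) (simp_all only: val_ge_powi_mult box_def, simp)
    moreover have "(\<epsilon> powi (- ?l) * c) *s \<epsilon> powi ?l *s y = c *s y" for c y
      unfolding scale_scale mult.commute[of _ c] mult.assoc powi_minus_cancel by simp
    ultimately have "coord n b i x *s b i \<in> M" if "i < n" for i using that by (metis (no_types, lifting))
    then have "(\<Sum>i<n. coord n b i x *s b i) \<in> M" by (intro submod_sum[OF sm]) auto
    then show "x \<in> M" using coord_expand[OF frame_b box_fspan[OF x]] by simp
  qed
  then show ?thesis using sm up by (intro latI)
qed

lemma span_box: assumes e: "frame m e" shows "span (box m e a) = fspan m e"
proof (rule antisym)
  show "span (box m e a) \<subseteq> fspan m e" using box_fspan by (intro span_minimal) auto
  have "e i \<in> span (box m e a)" if "i < m" for i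
  proof -
    have "\<epsilon> powi (a i) *s e i \<in> box m e a" using powi_basis_in_box[OF e that] by blast
    then have "\<epsilon> powi (- a i) *s \<epsilon> powi (a i) *s e i \<in> span (box m e a)" by (intro span_scale span_base)
    then show ?thesis unfolding scale_cancel_powi .
  qed
  then show "fspan m e \<subseteq> span (box m e a)" by (intro span_minimal) auto
qed

definition basis :: "(nat \<Rightarrow> 'v) \<Rightarrow> bool" where
  "basis e \<longleftrightarrow> frame n e \<and> fspan n e = V"

lemma lattice_in_box: "basis e \<Longrightarrow> lattice_in v scale V (box n e a)"
  unfolding lattice_in_def basis_def using int_span_eq_box[symmetric] span_box by blast

lemma lat_box: "basis e \<Longrightarrow> lat (box n e a)"
  by (intro lattice_in_imp_lat lattice_in_box)

text \<open>An adapted basis for the standard lattice, rescaled by its exponents, is a basis of M.\<close>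

lemma lat_basis: assumes "lat M" shows "\<exists>e. basis e \<and> M = box n e (\<lambda>_. 0)"
proof -
  obtain k where "std k \<subseteq> M" "M \<subseteq> std (- k)" using assms by (auto simp: lat_def)
  from adapted_frame[OF frame_b lat_submod[OF assms] this]
  obtain e a where e: "frame n e" "fspan n e = V" "M = box n e a" by blast
  define e' where "e' = (\<lambda>i. \<epsilon> powi (a i) *s e i)"
  have sum_e: "(\<Sum>i<n. c i *s e' i) = (\<Sum>i<n. (c i * \<epsilon> powi (a i)) *s e i)" for c by (simp add: e'_def)
  have "M = int_span v scale n e'" unfolding e(3) e'_def int_span_eq_box[OF e(1)] ..
  have e'_in: "e' i \<in> fspan n e" if "i < n" for i
    unfolding e'_def using that by (intro span_scale span_base) simp
  have coord_e': "coord n e j (e' i) = (if i = j then \<epsilon> powi (a i) else 0)" if "i < n" "j < n" for i j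
    unfolding e'_def using that e(1) by (simp add: coord_scale span_base coord_basis)
  have inj: "inj_on e' {..<n}"
  proof (rule inj_onI)
    fix i j assume ij: "i \<in> {..<n}" "j \<in> {..<n}" "e' i = e' j"
    then have "\<epsilon> powi (a i) = (if j = i then \<epsilon> powi (a j) else 0)"
      using coord_e'[of i i] coord_e'[of j i] by simp
    then show "i = j" using powi_nz[of "a i"] by presburger
  qed
  have "independent (e' ` {..<n})"
  proof (rule independent_if_scalars_zero)
    fix f x assume f: "(\<Sum>x\<in>e' ` {..<n}. f x *s x) = 0" and "x \<in> e' ` {..<n}"
    then obtain j where j: "j < n" "x = e' j" by auto
    have "0 = (\<Sum>i<n. (f (e' i) * \<epsilon> powi (a i)) *s e i)" using f unfolding sum.reindex[OF inj] sum_e[symmetric] by simp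
    then have "coord n e j 0 = f (e' j) * \<epsilon> powi (a j)" using coord_lincomb[OF e(1) j(1)] by metis
    then show "f x = 0" using j by simp
  qed simp
  then have fr: "frame n e'" using inj by (simp add: frame_def)
  have "fspan n e' = V"
  proof -
    have "span (int_span v scale n e') = V"
      using span_box[OF e(1), of a] e(2,3) \<open>M = int_span v scale n e'\<close> by simp
    then show ?thesis unfolding int_span_eq_box0[OF fr] span_box[OF fr] .
  qed
  then show ?thesis using fr \<open>M = int_span v scale n e'\<close> int_span_eq_box0[OF fr] unfolding basis_def by blast
qed

lemma lattice_in_iff: "lattice_in v scale V M \<longleftrightarrow> lat M"
  using lattice_in_imp_lat lat_basis lattice_in_box by blast

lemma lat_twist_bounds: assumes "lat A" "lat B" shows "\<exists>k. twist k A \<subseteq> B \<and> B \<subseteq> twist (- k) A"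
proof -
  obtain i where i: "\<forall>l\<ge>i. std l \<subseteq> A \<and> A \<subseteq> std (- l)" using lat_bound[OF assms(1)] by blast
  obtain j where j: "\<forall>l\<ge>j. std l \<subseteq> B \<and> B \<subseteq> std (- l)" using lat_bound[OF assms(2)] by blast
  have "twist (i + j) A \<subseteq> twist (i + j) (std (- i))" using i by (intro twist_mono) blast
  also have "\<dots> = std j" by (simp add: twist_box[OF frame_b])
  also have "\<dots> \<subseteq> B" using j by blast
  finally have "twist (i + j) A \<subseteq> B" .
  moreover have "B \<subseteq> std (- j)" using j by blast
  then have "B \<subseteq> twist (- (i + j)) (std i)" by (simp add: twist_box[OF frame_b])
  then have "B \<subseteq> twist (- (i + j)) A" using i twist_mono[of "std i" A] by blast
  ultimately show ?thesis by blast
qed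

lemma ex_adapted_basis:
  assumes "lat M1" "lat M2"
  shows "\<exists>e a. basis e \<and> M1 = box n e (\<lambda>_. 0) \<and> M2 = box n e a \<and> (\<forall>i j. i \<le> j \<longrightarrow> j < n \<longrightarrow> a j \<le> a i)"
proof -
  obtain e where e: "basis e" "M1 = box n e (\<lambda>_. 0)" using lat_basis[OF assms(1)] by blast
  then have fr: "frame n e" "fspan n e = V" by (simp_all add: basis_def)
  obtain k where "twist k M1 \<subseteq> M2" "M2 \<subseteq> twist (- k) M1" using lat_twist_bounds[OF assms] by blast
  then have "box n e (\<lambda>_. k) \<subseteq> M2" "M2 \<subseteq> box n e (\<lambda>_. - k)" by (simp_all add: e(2) twist_box[OF fr(1)])
  from adapted_frame[OF fr(1) lat_submod[OF assms(2)] this] show ?thesis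
    unfolding e(2) basis_def fr(2) by metis
qed

lemma len_finite: assumes "lat A" "lat B" "A \<subseteq> B" shows "\<exists>m. len A B = enat m"
proof -
  obtain e a where ea: "basis e" "B = box n e (\<lambda>_. 0)" "A = box n e a"
    using ex_adapted_basis[OF assms(2,1)] by blast
  then have fr: "frame n e" by (simp add: basis_def)
  have "\<forall>i<n. 0 \<le> a i" using assms(3) unfolding ea(2,3) box_subset_iff[OF fr] .
  then show ?thesis unfolding ea(2,3) using box_len[OF fr, of "\<lambda>_. 0" a] by blast
qed

text \<open>The volume is the length of A relative to the standard lattice, an integer because neither need
  contain the other.\<close>

definition vol :: "'v set \<Rightarrow> int" where
  "vol A = int (the_enat (len (A \<inter> std 0) A)) - int (the_enat (len (A \<inter> std 0) (std 0)))"

theorem len_vol: assumes A: "lat A" and B: "lat B" and AB: "A \<subseteq> B"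
  shows "len A B = enat (nat (vol B - vol A))" and "vol A \<le> vol B"
proof -
  have split: "the_enat (len P R) = the_enat (len P Q) + the_enat (len Q R)" and fin: "len P R = enat (the_enat (len P R))"
    if PQR: "lat P" "lat Q" "lat R" "P \<subseteq> Q" "Q \<subseteq> R" for P Q R
  proof -
    obtain p where p: "len P Q = enat p" using len_finite[OF PQR(1,2,4)] by blast
    obtain q where q: "len Q R = enat q" using len_finite[OF PQR(2,3,5)] by blast
    note pq = p q
    then have "len P R = enat (p + q)" using PQR by (intro len_additive lat_submod)
    then show "the_enat (len P R) = the_enat (len P Q) + the_enat (len Q R)" "len P R = enat (the_enat (len P R))"
      using pq by simp_all
  qed
  note L = lat_Int[OF A lat_std[of 0]] lat_Int[OF B lat_std[of 0]] lat_std[of 0]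
  have "the_enat (len (A \<inter> std 0) B) = the_enat (len (A \<inter> std 0) A) + the_enat (len A B)"
    using AB L A B by (intro split) auto
  moreover have "the_enat (len (A \<inter> std 0) B) = the_enat (len (A \<inter> std 0) (B \<inter> std 0)) + the_enat (len (B \<inter> std 0) B)"
    using AB L A B by (intro split) auto
  moreover have "the_enat (len (A \<inter> std 0) (std 0)) =
      the_enat (len (A \<inter> std 0) (B \<inter> std 0)) + the_enat (len (B \<inter> std 0) (std 0))"
    using AB L A B by (intro split) auto
  ultimately have "vol B - vol A = int (the_enat (len A B))" unfolding vol_def by linarith
  then show "vol A \<le> vol B" "len A B = enat (nat (vol B - vol A))"
    using fin[OF A A B order_refl AB] by simp_all
qed

lemma vol_mono: "lat A \<Longrightarrow> lat B \<Longrightarrow> A \<subseteq> B \<Longrightarrow> vol A \<le> vol B"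
  by (rule len_vol(2))

lemma vol_less: assumes "lat A" "lat B" "A \<subset> B" shows "vol A < vol B"
proof -
  have "1 \<le> len A B" using assms by (intro len_pos lat_submod)
  then have "enat 1 \<le> enat (nat (vol B - vol A))"
    using len_vol(1)[OF assms(1,2)] assms(3) unfolding one_enat_def by (simp add: less_imp_le)
  then show ?thesis by simp
qed

lemma vol_eqD: "lat A \<Longrightarrow> lat B \<Longrightarrow> A \<subseteq> B \<Longrightarrow> vol B \<le> vol A \<Longrightarrow> A = B"
  using vol_less[of A B] by auto

lemma vol_plus_Int: assumes "lat A" "lat B" shows "vol (A + B) + vol (A \<inter> B) = vol A + vol B"
proof -
  have L: "lat (A + B)" "lat (A \<inter> B)" using assms by (auto intro: lat_plus lat_Int)
  have sub: "B \<subseteq> A + B" using assms by (intro subset_plus_right lat_submod)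
  have "enat (nat (vol A - vol (A \<inter> B))) = enat (nat (vol (A + B) - vol B))"
    using len_second_iso[of A B] assms L sub len_vol(1)[of "A \<inter> B" A] len_vol(1)[of B "A + B"]
    by (simp add: lat_submod)
  moreover have "vol (A \<inter> B) \<le> vol A" "vol B \<le> vol (A + B)" using assms L sub by (auto intro: vol_mono)
  ultimately show ?thesis by simp
qed

lemma vol_box: assumes e: "basis e" shows "vol (box n e a) = vol (box n e (\<lambda>_. 0)) - (\<Sum>i<n. a i)"
proof -
  have fr: "frame n e" using e by (simp add: basis_def)
  have le: "vol (box n e c) - vol (box n e a) = (\<Sum>i<n. a i) - (\<Sum>i<n. c i)" if "\<And>i. c i \<le> a i" for a c
  proof -
    have sub: "box n e a \<subseteq> box n e c" using that by (rule box_mono)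
    have "enat (\<Sum>i<n. nat (a i - c i)) = enat (nat (vol (box n e c) - vol (box n e a)))"
      using box_len[OF fr, of c a] len_vol(1)[OF lat_box[OF e] lat_box[OF e] sub] that by simp
    then have "int (\<Sum>i<n. nat (a i - c i)) = vol (box n e c) - vol (box n e a)"
      using vol_mono[OF lat_box[OF e] lat_box[OF e] sub] by simp
    moreover have "int (\<Sum>i<n. nat (a i - c i)) = (\<Sum>i<n. a i - c i)" using that by simp
    ultimately show ?thesis by (simp add: sum_subtractf)
  qed
  show ?thesis using le[of "\<lambda>i. min 0 (a i)" a] le[of "\<lambda>i. min 0 (a i)" "\<lambda>_. 0"] by simp
qed

lemma lat_len_map_anti:
  assumes h: "\<And>A. lat A \<Longrightarrow> lat (h A)" "\<And>A B. lat A \<Longrightarrow> lat B \<Longrightarrow> A \<subset> B \<Longrightarrow> h B \<subset> h A"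
    and P: "lat P" and Q: "lat Q"
  shows "len P Q \<le> len (h Q) (h P)"
proof (rule len_map_anti[where f = h])
  fix C assume "submod C" "P \<subseteq> C" "C \<subseteq> Q"
  then show "submod (h C)" by (rule lat_submod[OF h(1)[OF lat_between[OF _ P Q]]])
next
  fix C D assume *: "submod C" "submod D" "P \<subseteq> C" "C \<subset> D" "D \<subseteq> Q"
  have "lat C" using * by (intro lat_between[OF *(1) P Q]) auto
  moreover have "lat D" using * by (intro lat_between[OF *(2) P Q]) auto
  ultimately show "h D \<subset> h C" using *(4) by (rule h(2))
qed (rule refl)+

text \<open>Neither a duality nor its inverse can shorten a chain, so both preserve lengths.\<close>

lemma vol_shift_anti:
  assumes f: "\<And>A. lat A \<Longrightarrow> lat (f A)" "\<And>A B. lat A \<Longrightarrow> lat B \<Longrightarrow> A \<subset> B \<Longrightarrow> f B \<subset> f A"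
    and g: "\<And>A. lat A \<Longrightarrow> lat (g A)" "\<And>A B. lat A \<Longrightarrow> lat B \<Longrightarrow> A \<subset> B \<Longrightarrow> g B \<subset> g A"
    and gf: "\<And>A. lat A \<Longrightarrow> g (f A) = A"
    and A: "lat A" and B: "lat B"
  shows "vol (f A) + vol A = vol (f B) + vol B"
proof -
  have sub: "vol (f P) - vol (f Q) = vol Q - vol P" if "lat P" "lat Q" "P \<subseteq> Q" for P Q
  proof -
    have "f Q \<subseteq> f P" using f(2)[OF that(1,2)] that(3) by (cases "P = Q") auto
    moreover have "len P Q = len (f Q) (f P)"
    proof (rule antisym)
      show "len P Q \<le> len (f Q) (f P)" by (rule lat_len_map_anti) ((rule f; assumption) | rule that)+
      have "len (f Q) (f P) \<le> len (g (f P)) (g (f Q))"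
        by (rule lat_len_map_anti) ((rule g; assumption) | rule f(1) that)+
      then show "len (f Q) (f P) \<le> len P Q" unfolding gf[OF that(1)] gf[OF that(2)] .
    qed
    ultimately have "enat (nat (vol Q - vol P)) = enat (nat (vol (f P) - vol (f Q)))"
      using len_vol(1)[OF that] len_vol(1)[OF f(1)[OF that(2)] f(1)[OF that(1)]] by simp
    moreover have "vol P \<le> vol Q" "vol (f Q) \<le> vol (f P)"
      using vol_mono[OF that] vol_mono[OF f(1)[OF that(2)] f(1)[OF that(1)] \<open>f Q \<subseteq> f P\<close>] by auto
    ultimately show ?thesis by simp
  qed
  have "lat (A \<inter> B)" using A B by (rule lat_Int)
  then show ?thesis using sub[of "A \<inter> B" A] sub[of "A \<inter> B" B] A B by simp
qed

lemma vol_twist: assumes "lat A" shows "vol (twist j A) = vol A - int n * j"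
proof -
  obtain e where e: "basis e" "A = box n e (\<lambda>_. 0)" using lat_basis[OF assms] by blast
  then have "twist j A = box n e (\<lambda>_. j)" using twist_box[of n e j "\<lambda>_. 0"] by (simp add: basis_def)
  then show ?thesis using vol_box[OF e(1), of "\<lambda>_. j"] e(2) by simp
qed

lemma vol_adjoin_le: assumes A: "lat A" and x: "x \<in> V" "\<epsilon> *s x \<in> A"
  shows "lat (A + line x)" and "vol (A + line x) \<le> vol A + 1"
    and "x \<notin> A \<Longrightarrow> vol (A + line x) = vol A + 1"
proof -
  obtain k where k: "\<forall>j\<ge>k. x \<in> std (- j)" using in_some_std[OF x(1)] by blast
  obtain l where l: "\<forall>j\<ge>l. std j \<subseteq> A \<and> A \<subseteq> std (- j)" using lat_bound[OF A] by blast
  have "line x \<subseteq> std (- max k l)" using k by (intro line_subset submod_box frame_b) simp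
  moreover have "A \<subseteq> std (- max k l)" using l by simp
  ultimately have "A + line x \<subseteq> std (- max k l)" by (intro plus_subset[OF submod_box[OF frame_b]])
  moreover have sub: "A \<subseteq> A + line x" by (rule subset_plus_left[OF submod_line])
  moreover have "std l \<subseteq> A" using l by simp
  ultimately show L: "lat (A + line x)"
    by (intro latI[of _ l "- max k l"] submod_plus submod_line lat_submod[OF A]) blast+
  have le: "vol A \<le> vol (A + line x)" using vol_mono[OF A L sub] .
  have "enat (nat (vol (A + line x) - vol A)) \<le> enat 1"
    using len_adjoin_le[OF lat_submod[OF A] x(2)] len_vol(1)[OF A L sub] unfolding one_enat_def by simp
  then show 1: "vol (A + line x) \<le> vol A + 1" by simp
  assume "x \<notin> A"
  moreover have "x \<in> A + line x" using set_plus_intro[OF submod_0[OF lat_submod[OF A]] line_self[of x]] by simp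
  ultimately have "A \<subset> A + line x" using sub by blast
  then show "vol (A + line x) = vol A + 1" using vol_less[OF A L] 1 by simp
qed

end

section \<open>Relative positions and volumes of sums\<close>

lemma sorted_desc_eqI:
  fixes l l' :: "int list"
  assumes "sorted_wrt (\<ge>) l" "sorted_wrt (\<ge>) l'"
    and sums: "\<And>j. (\<Sum>x\<leftarrow>l. min 0 (x + j)) = (\<Sum>x\<leftarrow>l'. min 0 (x + j))"
  shows "l = l'"
proof -
  \<comment> \<open>The second difference of x \<mapsto> min 0 (x + j) is the indicator of one point.\<close>
  have count: "int (count (mset l) t) = 2 * (\<Sum>x\<leftarrow>l. min 0 (x - t)) -
      (\<Sum>x\<leftarrow>l. min 0 (x - t + 1)) - (\<Sum>x\<leftarrow>l. min 0 (x - t - 1))" for l t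
    by (induction l) (auto simp: min_def)
  have "count (mset l) t = count (mset l') t" for t
  proof -
    have "int (count (mset l) t) = int (count (mset l') t)"
      unfolding count using sums[of "- t"] sums[of "1 - t"] sums[of "- t - 1"] by (simp add: algebra_simps)
    then show ?thesis by simp
  qed
  then have "mset (rev l) = mset (rev l')" by (simp add: multiset_eq_iff)
  moreover have "sorted (rev l)" "sorted (rev l')" using assms(1,2) by (simp_all add: sorted_wrt_rev)
  ultimately have "rev l = rev l'" by (metis properties_for_sort)
  then show ?thesis by simp
qed

context lattice_space
begin

lemma span_lat: "lat M \<Longrightarrow> span M = V"
  unfolding lattice_in_iff[symmetric] lattice_in_def by (rule conjunct2)

lemma has_rel_pos_iff:
  "has_rel_pos v scale \<epsilon> n M1 M2 l \<longleftrightarrow> length l = n \<and> sorted_wrt (\<ge>) l \<and>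
     (\<exists>e. frame n e \<and> M1 = box n e (\<lambda>_. 0) \<and> M2 = box n e (\<lambda>i. l ! i))"
  unfolding has_rel_pos_def frame_def[symmetric]
  using int_span_eq_box0[of n] int_span_eq_box[of n _ "\<lambda>i. l ! i"] by (auto simp: frame_def)

lemma has_rel_pos_exists: assumes "lat M1" "lat M2" shows "\<exists>l. has_rel_pos v scale \<epsilon> n M1 M2 l"
proof -
  obtain e a where ea: "basis e" "M1 = box n e (\<lambda>_. 0)" "M2 = box n e a"
      "\<And>i j. i \<le> j \<Longrightarrow> j < n \<Longrightarrow> a j \<le> a i"
    using ex_adapted_basis[OF assms] by blast
  let ?l = "map a [0..<n]"
  have "has_rel_pos v scale \<epsilon> n M1 M2 ?l" unfolding has_rel_pos_iff
  proof (intro conjI exI[of _ e])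
    show "sorted_wrt (\<ge>) ?l" using ea(4) by (simp add: sorted_wrt_iff_nth_less)
    show "M2 = box n e (\<lambda>i. ?l ! i)" unfolding ea(3) by (simp add: box_def)
  qed (use ea(1,2) in \<open>simp_all add: basis_def\<close>)
  then show ?thesis ..
qed

lemma has_rel_pos_vol:
  assumes "lat M1" "has_rel_pos v scale \<epsilon> n M1 M2 l"
  shows "vol (M1 + twist j M2) = vol M1 - (\<Sum>x\<leftarrow>l. min 0 (x + j))"
proof -
  obtain e where e: "length l = n" "frame n e" "M1 = box n e (\<lambda>_. 0)" "M2 = box n e (\<lambda>i. l ! i)"
    using assms(2) unfolding has_rel_pos_iff by blast
  have "basis e" unfolding basis_def using e span_lat[OF assms(1)] span_box[OF e(2)] by simp
  then have "vol (M1 + twist j M2) = vol M1 - (\<Sum>i<n. min 0 (l ! i + j))"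
    unfolding e(3,4) twist_box[OF e(2)] box_plus[OF e(2)] by (rule vol_box)
  then show ?thesis by (simp add: sum_list_sum_nth e(1) atLeast0LessThan)
qed

text \<open>The exponents are recovered from the volumes of sums.\<close>

lemma rel_pos_unique:
  assumes "lat M1" "has_rel_pos v scale \<epsilon> n M1 M2 l" "has_rel_pos v scale \<epsilon> n M1 M2 l'"
  shows "l = l'"
proof (rule sorted_desc_eqI)
  fix j show "(\<Sum>x\<leftarrow>l. min 0 (x + j)) = (\<Sum>x\<leftarrow>l'. min 0 (x + j))"
    using has_rel_pos_vol[OF assms(1,2), of j] has_rel_pos_vol[OF assms(1,3), of j] by simp
qed (use assms has_rel_pos_iff in auto)

lemma has_rel_pos_rel_pos:
  assumes "lat M1" "lat M2" shows "has_rel_pos v scale \<epsilon> n M1 M2 (rel_pos v scale \<epsilon> n M1 M2)"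
proof -
  obtain l where l: "has_rel_pos v scale \<epsilon> n M1 M2 l" using has_rel_pos_exists[OF assms] by blast
  show ?thesis unfolding rel_pos_def
    by (rule theI[where P = "has_rel_pos v scale \<epsilon> n M1 M2" and a = l, OF l]) (rule rel_pos_unique[OF assms(1) _ l])
qed

text \<open>This replaces relative positions by volumes, which can be followed along chains of lattices.\<close>

theorem rel_pos_eq_iff:
  assumes M: "lat M" and M': "lat M'" and L: "lat L" and vol: "vol M = vol M'"
  shows "rel_pos v scale \<epsilon> n M L = rel_pos v scale \<epsilon> n M' L \<longleftrightarrow>
    (\<forall>j. vol (M + twist j L) = vol (M' + twist j L))"
proof
  note h = has_rel_pos_rel_pos[OF M L] and h' = has_rel_pos_rel_pos[OF M' L]
  {
    assume "rel_pos v scale \<epsilon> n M L = rel_pos v scale \<epsilon> n M' L"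
    then show "\<forall>j. vol (M + twist j L) = vol (M' + twist j L)"
      using has_rel_pos_vol[OF M h] has_rel_pos_vol[OF M' h'] vol by simp
  next
    assume eq: "\<forall>j. vol (M + twist j L) = vol (M' + twist j L)"
    show "rel_pos v scale \<epsilon> n M L = rel_pos v scale \<epsilon> n M' L"
    proof (rule sorted_desc_eqI)
      fix j show "(\<Sum>x\<leftarrow>rel_pos v scale \<epsilon> n M L. min 0 (x + j)) = (\<Sum>x\<leftarrow>rel_pos v scale \<epsilon> n M' L. min 0 (x + j))"
        using has_rel_pos_vol[OF M h, of j] has_rel_pos_vol[OF M' h', of j] vol eq by simp
    qed (use h h' has_rel_pos_iff in auto)
  }
qed

end

section \<open>The Frobenius\<close>

text \<open>The part of the structure of a unitary isocrystal that is used: a form, diagonal in a basis of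
  vectors fixed by the Frobenius, with values fixed by \<sigma> on the diagonal.\<close>

locale hermitian_isocrystal = lattice_space scale v \<epsilon> n b
  for scale :: "'l::field \<Rightarrow> 'v::ab_group_add \<Rightarrow> 'v" (infixr \<open>*s\<close> 75)
    and v :: "'l \<Rightarrow> int" and \<epsilon> :: 'l and n :: nat and b :: "nat \<Rightarrow> 'v" +
  fixes \<sigma> :: "'l \<Rightarrow> 'l" and \<tau> :: "'v \<Rightarrow> 'v" and H :: "'v \<Rightarrow> 'v \<Rightarrow> 'l" and \<eta> :: "nat \<Rightarrow> 'l"
  assumes sigma_bij: "bij \<sigma>"
    and sigma_add: "\<sigma> (x + y) = \<sigma> x + \<sigma> y"
    and sigma_mult: "\<sigma> (x * y) = \<sigma> x * \<sigma> y"
    and sigma_val: "x \<noteq> 0 \<Longrightarrow> v (\<sigma> x) = v x"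
    and sigma_eps: "\<sigma> \<epsilon> = \<epsilon>"
    and tau_bij: "bij \<tau>"
    and tau_add: "\<tau> (u + w) = \<tau> u + \<tau> w"
    and tau_scale: "\<tau> (c *s u) = \<sigma> (\<sigma> c) *s \<tau> u"
    and tau_b: "i < n \<Longrightarrow> \<tau> (b i) = b i"
    and H_add_left: "H (u + w) z = H u z + H w z"
    and H_add_right: "H z (u + w) = H z u + H z w"
    and H_scale_left: "H (c *s u) w = c * H u w"
    and H_scale_right: "H u (c *s w) = \<sigma> c * H u w"
    and H_b: "i < n \<Longrightarrow> j < n \<Longrightarrow> H (b i) (b j) = (if i = j then \<eta> i else 0)"
    and eta: "i < n \<Longrightarrow> \<eta> i \<noteq> 0" "i < n \<Longrightarrow> \<sigma> (\<eta> i) = \<eta> i"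
begin

lemma sigma_0 [simp]: "\<sigma> 0 = 0"
proof -
  have "\<sigma> 0 + 0 = \<sigma> 0 + \<sigma> 0" using sigma_add[of 0 0] by (simp only: add_0_right)
  then show ?thesis by (simp only: add_left_cancel)
qed

lemma sigma_eq_0 [simp]: "\<sigma> x = 0 \<longleftrightarrow> x = 0"
  using sigma_bij sigma_0 by (metis bij_pointE)

lemma sigma_1 [simp]: "\<sigma> 1 = 1"
  using sigma_mult[of 1 1] sigma_eq_0[of 1] by simp

lemma sigma_sum: "\<sigma> (sum f I) = (\<Sum>i\<in>I. \<sigma> (f i))"
  by (induction I rule: infinite_finite_induct) (simp_all add: sigma_add)

lemma sigma_inverse: "\<sigma> (inverse x) = inverse (\<sigma> x)"
proof (cases "x = 0")
  case False
  then have "\<sigma> x * \<sigma> (inverse x) = 1" by (simp flip: sigma_mult)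
  then show ?thesis by (simp add: inverse_unique)
qed simp

lemma sigma_pow: "\<sigma> (\<epsilon> ^ k) = \<epsilon> ^ k"
  by (induction k) (simp_all add: sigma_mult sigma_eps)

lemma sigma_powi [simp]: "\<sigma> (\<epsilon> powi j) = \<epsilon> powi j"
  by (simp add: power_int_def sigma_pow sigma_inverse power_inverse)

lemma sigma_val_ge [simp]: "\<sigma> x \<in> val_ge v a \<longleftrightarrow> x \<in> val_ge v a"
  using sigma_val[of x] by (cases "x = 0") (auto simp: val_ge_def)

lemma sigma_surj: "\<exists>y. x = \<sigma> y"
  using sigma_bij by (meson bij_pointE)

lemma tau_0 [simp]: "\<tau> 0 = 0"
  using tau_add[of 0 0] by simp

lemma tau_sum: "\<tau> (sum f I) = (\<Sum>i\<in>I. \<tau> (f i))"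
  by (induction I rule: infinite_finite_induct) (simp_all add: tau_add)

lemma tau_inj: "inj \<tau>"
  using tau_bij by (rule bij_is_inj)

lemma tau_expand: "x \<in> V \<Longrightarrow> \<tau> x = (\<Sum>i<n. \<sigma> (\<sigma> (coord n b i x)) *s b i)"
proof -
  assume "x \<in> V"
  then have "\<tau> x = \<tau> (\<Sum>i<n. coord n b i x *s b i)" using coord_expand[OF frame_b] by simp
  also have "\<dots> = (\<Sum>i<n. \<sigma> (\<sigma> (coord n b i x)) *s b i)"
    unfolding tau_sum by (intro sum.cong) (simp_all add: tau_scale tau_b)
  finally show ?thesis .
qed

lemma tau_in_V: "x \<in> V \<Longrightarrow> \<tau> x \<in> V"
  by (simp add: tau_expand sum_in_fspan)

lemma coord_tau: "x \<in> V \<Longrightarrow> i < n \<Longrightarrow> coord n b i (\<tau> x) = \<sigma> (\<sigma> (coord n b i x))"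
  by (simp add: tau_expand coord_lincomb[OF frame_b])

lemma submod_tau: assumes "submod A" shows "submod (\<tau> ` A)"
proof (rule submodI)
  show "0 \<in> \<tau> ` A" using submod_0[OF assms] tau_0 by (metis imageI)
next
  fix x y assume "x \<in> \<tau> ` A" "y \<in> \<tau> ` A"
  then obtain x' y' where *: "x' \<in> A" "y' \<in> A" "x = \<tau> x'" "y = \<tau> y'" by blast
  then have "x + y = \<tau> (x' + y')" by (simp add: tau_add)
  then show "x + y \<in> \<tau> ` A" using submod_add[OF assms] * by blast
next
  fix c x assume c: "c \<in> int_ring v" and "x \<in> \<tau> ` A"
  then obtain y where y: "y \<in> A" "x = \<tau> y" by blast
  obtain d where d: "c = \<sigma> (\<sigma> d)" using sigma_surj by metis
  then have "c *s x = \<tau> (d *s y)" using y by (simp add: tau_scale)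
  moreover have "d *s y \<in> A" using c d y submod_scale[OF assms] by simp
  ultimately show "c *s x \<in> \<tau> ` A" by blast
qed

abbreviation tau_inv :: "'v \<Rightarrow> 'v"  where "tau_inv \<equiv> inv_into UNIV \<tau>"

lemma submod_tau_inv: assumes "submod A" shows "submod (tau_inv ` A)"
proof -
  have inv: "\<tau> (tau_inv x) = x" for x using tau_bij by (simp add: bij_is_surj surj_f_inv_f)
  have mem: "x \<in> tau_inv ` A \<longleftrightarrow> \<tau> x \<in> A" for x
    using inv tau_inj by (metis imageE imageI inv_f_f)
  show ?thesis
    by (rule submodI) (simp_all add: mem tau_add tau_scale submod_0[OF assms] submod_add[OF assms] submod_scale[OF assms])
qed

lemma tau_inv_image: "\<tau> ` tau_inv ` A = A" "tau_inv ` \<tau> ` A = A"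
  by (rule image_f_inv_f[OF bij_is_surj[OF tau_bij]], rule image_inv_f_f[OF tau_inj])

text \<open>In the fixed basis the Frobenius acts on coordinates, and it preserves their valuations.\<close>

lemma tau_std: "\<tau> ` std k = std k"
proof (rule antisym)
  show "\<tau> ` std k \<subseteq> std k" by (auto simp: box_def tau_in_V coord_tau)
  show "std k \<subseteq> \<tau> ` std k"
  proof
    fix x assume x: "x \<in> std k"
    have "\<exists>d. coord n b i x = \<sigma> (\<sigma> d)" for i using sigma_surj by metis
    then obtain d where d: "\<And>i. coord n b i x = \<sigma> (\<sigma> (d i))" by metis
    let ?y = "\<Sum>i<n. d i *s b i"
    have dk: "d i \<in> val_ge v k" if "i < n" for i
    proof -
      have "coord n b i x \<in> val_ge v k" using x that by (simp add: box_def)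
      then show ?thesis unfolding d[of i] by simp
    qed
    then have "?y \<in> std k" by (intro sum_in_box frame_b)
    moreover have "\<tau> ?y = (\<Sum>i<n. coord n b i x *s b i)"
      unfolding tau_sum by (intro sum.cong) (simp_all add: tau_scale tau_b d)
    then have "\<tau> ?y = x" using coord_expand[OF frame_b box_fspan[OF x]] by simp
    ultimately show "x \<in> \<tau> ` std k" by blast
  qed
qed

lemma tau_inv_std: "tau_inv ` std k = std k"
  using arg_cong[OF tau_std, of "\<lambda>A. tau_inv ` A"] unfolding tau_inv_image ..

lemma lat_tau: assumes "lat A" shows "lat (\<tau> ` A)"
proof -
  obtain k where "std k \<subseteq> A" "A \<subseteq> std (- k)" using assms by (auto simp: lat_def)
  then have "\<tau> ` std k \<subseteq> \<tau> ` A" "\<tau> ` A \<subseteq> \<tau> ` std (- k)" by blast+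
  then show ?thesis unfolding tau_std by (rule latI[OF submod_tau[OF lat_submod[OF assms]]])
qed

lemma lat_tau_inv: assumes "lat A" shows "lat (tau_inv ` A)"
proof -
  obtain k where "std k \<subseteq> A" "A \<subseteq> std (- k)" using assms by (auto simp: lat_def)
  then have "tau_inv ` std k \<subseteq> tau_inv ` A" "tau_inv ` A \<subseteq> tau_inv ` std (- k)" by blast+
  then show ?thesis unfolding tau_inv_std by (rule latI[OF submod_tau_inv[OF lat_submod[OF assms]]])
qed

lemma tau_plus: "\<tau> ` (A + B) = \<tau> ` A + \<tau> ` B"
proof (rule Set.set_eqI)
  fix x
  have "x \<in> \<tau> ` (A + B) \<longleftrightarrow> (\<exists>a\<in>A. \<exists>b\<in>B. x = \<tau> (a + b))" by (auto simp: set_plus_def)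
  also have "\<dots> \<longleftrightarrow> x \<in> \<tau> ` A + \<tau> ` B" unfolding tau_add by (auto simp: set_plus_def)
  finally show "x \<in> \<tau> ` (A + B) \<longleftrightarrow> x \<in> \<tau> ` A + \<tau> ` B" .
qed

lemma tau_Int: "\<tau> ` (A \<inter> B) = \<tau> ` A \<inter> \<tau> ` B"
  using tau_inj by (rule image_Int)

lemma tau_twist: "\<tau> ` twist j A = twist j (\<tau> ` A)"
  unfolding scale_lattice_def image_image by (simp add: tau_scale)

section \<open>Duality\<close>

lemma H_0_left [simp]: "H 0 w = 0"
  using H_scale_left[of 0 0 w] by simp

lemma H_0_right [simp]: "H u 0 = 0"
  using H_scale_right[of u 0 0] by simp

lemma H_diff_left: "H (u - w) z = H u z - H w z"
  using H_add_left[of "u - w" w z] by simp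

lemma H_sum_left: "H (sum f I) w = (\<Sum>i\<in>I. H (f i) w)"
  by (induction I rule: infinite_finite_induct) (simp_all add: H_add_left)

lemma H_sum_right: "H u (sum f I) = (\<Sum>i\<in>I. H u (f i))"
  by (induction I rule: infinite_finite_induct) (simp_all add: H_add_right)

lemma H_lincomb: "H (\<Sum>i<n. c i *s b i) (\<Sum>i<n. d i *s b i) = (\<Sum>i<n. c i * \<eta> i * \<sigma> (d i))"
proof -
  have "H (\<Sum>i<n. c i *s b i) (\<Sum>j<n. d j *s b j) = (\<Sum>i<n. \<Sum>j<n. c i * (\<sigma> (d j) * H (b i) (b j)))"
    unfolding H_sum_left H_scale_left by (simp only: H_sum_right H_scale_right sum_distrib_left)
  also have "\<dots> = (\<Sum>i<n. \<Sum>j<n. if i = j then c i * (\<sigma> (d j) * \<eta> i) else 0)"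
    by (intro sum.cong) (simp_all add: H_b)
  also have "\<dots> = (\<Sum>i<n. c i * \<eta> i * \<sigma> (d i))"
    by (intro sum.cong) (simp_all add: mult.commute mult.left_commute)
  finally show ?thesis .
qed

lemma H_expand:
  assumes "u \<in> V" "w \<in> V"
  shows "H u w = (\<Sum>i<n. coord n b i u * \<eta> i * \<sigma> (coord n b i w))"
  using H_lincomb[of "\<lambda>i. coord n b i u" "\<lambda>i. coord n b i w"]
  unfolding coord_expand[OF frame_b assms(1)] coord_expand[OF frame_b assms(2)] .

lemma H_tau: assumes "u \<in> V" "w \<in> V" shows "H (\<tau> u) w = \<sigma> (H w u)"
  unfolding H_expand[OF tau_in_V[OF assms(1)] assms(2)] H_expand[OF assms(2,1)] sigma_sum
  by (intro sum.cong) (simp_all add: coord_tau assms eta sigma_mult mult.commute mult.left_commute)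

lemma H_tau_tau: "u \<in> V \<Longrightarrow> w \<in> V \<Longrightarrow> H (\<tau> u) (\<tau> w) = \<sigma> (\<sigma> (H u w))"
  by (simp add: H_tau tau_in_V)

lemma tau_V: "\<tau> ` V = V"
proof (rule antisym)
  show "\<tau> ` V \<subseteq> V" using tau_in_V by blast
  show "V \<subseteq> \<tau> ` V"
  proof
    fix x assume "x \<in> V"
    then obtain k where "\<forall>j\<ge>k. x \<in> std (- j)" using in_some_std by blast
    then have "x \<in> std (- k)" by blast
    then have "x \<in> \<tau> ` std (- k)" unfolding tau_std .
    then show "x \<in> \<tau> ` V" using box_fspan by blast
  qed
qed

text \<open>The first multiple of the dual lattice. It is more convenient than the dual itself, being
  contained in the lattices of interest.\<close>

definition pdual :: "'v set \<Rightarrow> 'v set" where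
  "pdual A = {x \<in> V. \<forall>y\<in>A. H x y \<in> val_ge v 1}"

lemma pdualD: "x \<in> pdual A \<Longrightarrow> y \<in> A \<Longrightarrow> H x y \<in> val_ge v 1"
  by (simp add: pdual_def)

lemma pdual_V: "pdual A \<subseteq> V"
  by (auto simp: pdual_def)

lemma twist_dual: "twist 1 (dual_lattice v V H A) = pdual A"
proof (rule Set.set_eqI)
  fix x
  have "\<epsilon> powi (- 1) *s x \<in> V \<longleftrightarrow> x \<in> V"
    using span_scale[of "\<epsilon> powi (- 1) *s x" "b ` {..<n}" "\<epsilon> powi 1"] span_scale[of x "b ` {..<n}"]
    unfolding scale_cancel_powi by blast
  then show "x \<in> twist 1 (dual_lattice v V H A) \<longleftrightarrow> x \<in> pdual A"
    unfolding twist_iff dual_lattice_def pdual_def mem_Collect_eq H_scale_left val_ge_powi_mult by simp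
qed

lemma pdual_anti: "A \<subseteq> B \<Longrightarrow> pdual B \<subseteq> pdual A"
  by (auto simp: pdual_def)

lemma submod_pdual: "submod (pdual A)"
  by (rule submodI) (auto simp: pdual_def span_zero span_add span_scale H_add_left H_scale_left
      intro: val_ge_add val_ge_mult0)

lemma lat_pdual: assumes A: "lat A" shows "lat (pdual A)"
proof -
  obtain k where k: "std k \<subseteq> A" "A \<subseteq> std (- k)" using A by (auto simp: lat_def)
  define K where "K = (\<Sum>i<n. \<bar>v (\<eta> i)\<bar>)"
  have K: "\<bar>v (\<eta> i)\<bar> \<le> K" if "i < n" for i unfolding K_def using that by (intro member_le_sum) auto
  have "std (1 + K + k) \<subseteq> pdual A"
  proof
    fix x assume x: "x \<in> std (1 + K + k)"
    have "H x y \<in> val_ge v 1" if "y \<in> A" for y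
    proof -
      have y: "y \<in> std (- k)" using that k by blast
      have "coord n b i x * \<eta> i * \<sigma> (coord n b i y) \<in> val_ge v 1" if i: "i < n" for i
      proof -
        have "\<eta> i \<in> val_ge v (- K)" using K[OF i] by (auto simp: val_ge_def)
        then have "coord n b i x * \<eta> i \<in> val_ge v ((1 + K + k) + (- K))"
          using x i by (intro val_ge_mult) (simp_all add: box_def)
        moreover have "\<sigma> (coord n b i y) \<in> val_ge v (- k)" using y i by (simp add: box_def)
        ultimately have "coord n b i x * \<eta> i * \<sigma> (coord n b i y) \<in> val_ge v ((1 + K + k) + (- K) + (- k))"
          by (rule val_ge_mult)
        then show ?thesis by simp
      qed
      then show ?thesis
        unfolding H_expand[OF box_fspan[OF x] box_fspan[OF y]] by (intro val_ge_sum) auto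
    qed
    then show "x \<in> pdual A" using box_fspan[OF x] by (simp add: pdual_def)
  qed
  moreover have "pdual A \<subseteq> std (1 - k - K)"
  proof
    fix x assume x: "x \<in> pdual A"
    then have xV: "x \<in> V" by (simp add: pdual_def)
    have "coord n b i x \<in> val_ge v (1 - k - K)" if i: "i < n" for i
    proof -
      have bi: "\<epsilon> powi k *s b i \<in> std k" using powi_basis_in_box[OF frame_b i] by blast
      then have "H x (\<epsilon> powi k *s b i) \<in> val_ge v 1" using x k by (blast intro: pdualD)
      moreover have "H x (b i) = coord n b i x * \<eta> i"
      proof -
        have biV: "b i \<in> V" using i by (intro span_base) simp
        have "H x (b i) = (\<Sum>j<n. coord n b j x * \<eta> j * \<sigma> (if j = i then 1 else 0))"
          unfolding H_expand[OF xV biV] using i by (intro sum.cong) (simp_all add: coord_basis[OF frame_b])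
        also have "\<dots> = coord n b i x * \<eta> i"
          using i by (simp add: if_distrib[of \<sigma>] if_distrib[of "\<lambda>c. _ * c"] cong: if_cong)
        finally show ?thesis .
      qed
      ultimately have "\<epsilon> powi k * (coord n b i x * \<eta> i) \<in> val_ge v 1" by (simp add: H_scale_right)
      then have "coord n b i x * \<eta> i \<in> val_ge v (1 - k)" unfolding val_ge_powi_mult .
      then show ?thesis using K[OF i] eta(1)[OF i] by (cases "coord n b i x = 0") (auto simp: val_ge_def v_mult)
    qed
    then show "x \<in> std (1 - k - K)" using xV by (simp add: box_def)
  qed
  ultimately show ?thesis by (rule latI[OF submod_pdual])
qed

text \<open>Every coordinate function is given by pairing with some vector, so a vector whose pairings with
  the dual of a lattice are integral has integral coordinates.\<close>

theorem pdual_pdual: assumes A: "lat A" shows "pdual (pdual A) = \<tau> ` A"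
proof (rule antisym)
  show "\<tau> ` A \<subseteq> pdual (pdual A)"
  proof
    fix x assume "x \<in> \<tau> ` A"
    then obtain y where y: "y \<in> A" "x = \<tau> y" by blast
    have yV: "y \<in> V" using y lat_subset_V[OF A] by blast
    have "H x z \<in> val_ge v 1" if "z \<in> pdual A" for z
      using pdualD[OF that y(1)] that pdual_V unfolding y(2) by (subst H_tau[OF yV]) auto
    then show "x \<in> pdual (pdual A)" using tau_in_V[OF yV] y(2) by (simp add: pdual_def)
  qed
  show "pdual (pdual A) \<subseteq> \<tau> ` A"
  proof
    fix x assume x: "x \<in> pdual (pdual A)"
    then have "x \<in> \<tau> ` V" unfolding tau_V using pdual_V by blast
    then obtain x' where x': "x' \<in> V" "x = \<tau> x'" by blast
    obtain e where e: "basis e" "A = box n e (\<lambda>_. 0)" using lat_basis[OF A] by blast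
    then have fr: "frame n e" "fspan n e = V" by (auto simp: basis_def)
    have "coord n e j x' \<in> int_ring v" if j: "j < n" for j
    proof -
      \<comment> \<open>The vector that represents the first multiple of the j-th coordinate function of e.\<close>
      let ?f = "\<Sum>k<n. (\<epsilon> * \<sigma> (coord n e j (b k)) / \<eta> k) *s b k"
      have fV: "?f \<in> V" by (rule sum_in_fspan)
      have Hf: "H ?f w = \<epsilon> * \<sigma> (coord n e j w)" if w: "w \<in> V" for w
      proof -
        have "coord n e j w = coord n e j (\<Sum>k<n. coord n b k w *s b k)" using coord_expand[OF frame_b w] by simp
        also have "\<dots> = (\<Sum>k<n. coord n b k w * coord n e j (b k))"
          using fr by (subst coord_sum[OF fr(1)]) (simp_all add: coord_scale span_scale span_base)
        finally have cw: "coord n e j w = (\<Sum>k<n. coord n b k w * coord n e j (b k))" .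
        have "H ?f w = (\<Sum>k<n. \<epsilon> * \<sigma> (coord n e j (b k)) / \<eta> k * \<eta> k * \<sigma> (coord n b k w))"
          using H_lincomb[of "\<lambda>k. \<epsilon> * \<sigma> (coord n e j (b k)) / \<eta> k" "\<lambda>k. coord n b k w"]
          unfolding coord_expand[OF frame_b w] .
        also have "\<dots> = (\<Sum>k<n. \<epsilon> * \<sigma> (coord n b k w * coord n e j (b k)))"
          by (intro sum.cong) (simp_all add: eta sigma_mult)
        also have "\<dots> = \<epsilon> * \<sigma> (coord n e j w)" unfolding cw sigma_sum sum_distrib_left ..
        finally show ?thesis .
      qed
      have eps: "\<epsilon> * c \<in> val_ge v 1 \<longleftrightarrow> c \<in> int_ring v" for c using val_ge_powi_mult[of 1 c 1] by simp
      have "?f \<in> pdual A"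
        unfolding pdual_def using fV Hf lat_subset_V[OF A] j e(2) eps by (auto simp: box_def)
      then have "H (\<tau> x') ?f \<in> val_ge v 1" using x x'(2) by (auto intro: pdualD)
      then have "H ?f x' \<in> val_ge v 1" unfolding H_tau[OF x'(1) fV] by simp
      then show ?thesis unfolding Hf[OF x'(1)] eps by simp
    qed
    then have "x' \<in> A" using x'(1) fr e(2) by (simp add: box_def)
    then show "x \<in> \<tau> ` A" using x'(2) by blast
  qed
qed

lemma pdual_inject: assumes "lat A" "lat B" "pdual A = pdual B" shows "A = B"
proof -
  have "\<tau> ` A = \<tau> ` B" unfolding pdual_pdual[OF assms(1), symmetric] pdual_pdual[OF assms(2), symmetric] assms(3) ..
  then show ?thesis by (simp only: inj_image_eq_iff[OF tau_inj])
qed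

lemma vol_pdual: assumes "lat A" "lat B" shows "vol (pdual A) + vol A = vol (pdual B) + vol B"
proof (rule vol_shift_anti[where g = "\<lambda>A. tau_inv ` pdual A"])
  have strict: "pdual D \<subset> pdual C" if "lat C" "lat D" "C \<subset> D" for C D
    using pdual_anti[of C D] pdual_inject[OF that(1,2)] that(3) by blast
  show "\<And>A B. lat A \<Longrightarrow> lat B \<Longrightarrow> A \<subset> B \<Longrightarrow> pdual B \<subset> pdual A" by (rule strict)
  show "tau_inv ` pdual D \<subset> tau_inv ` pdual C" if "lat C" "lat D" "C \<subset> D" for C D
  proof -
    have "tau_inv ` pdual D \<noteq> tau_inv ` pdual C"
      using strict[OF that] arg_cong[of "tau_inv ` pdual D" "tau_inv ` pdual C" "\<lambda>A. \<tau> ` A"]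
      unfolding tau_inv_image by blast
    then show ?thesis using strict[OF that] by blast
  qed
qed (simp_all add: lat_pdual lat_tau_inv pdual_pdual tau_inv_image assms)

lemma pdual_plus: assumes "submod A" "submod B" shows "pdual (A + B) = pdual A \<inter> pdual B"
proof (rule antisym)
  show "pdual (A + B) \<subseteq> pdual A \<inter> pdual B"
    using pdual_anti[OF subset_plus_left[OF assms(2)]] pdual_anti[OF subset_plus_right[OF assms(1)]] by blast
  show "pdual A \<inter> pdual B \<subseteq> pdual (A + B)"
  proof
    fix x assume x: "x \<in> pdual A \<inter> pdual B"
    have "H x y \<in> val_ge v 1" if "y \<in> A + B" for y
    proof -
      obtain a c where "y = a + c" "a \<in> A" "c \<in> B" using \<open>y \<in> A + B\<close> by (rule set_plus_elim)
      then show ?thesis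
        using pdualD[of x A a] pdualD[of x B c] x by (simp add: H_add_right val_ge_add)
    qed
    then show "x \<in> pdual (A + B)" using x by (simp add: pdual_def)
  qed
qed

lemma pdual_tau: assumes "A \<subseteq> V" shows "pdual (\<tau> ` A) = \<tau> ` pdual A"
proof (rule Set.set_eqI)
  fix x
  show "x \<in> pdual (\<tau> ` A) \<longleftrightarrow> x \<in> \<tau> ` pdual A"
  proof (cases "x \<in> V")
    case True
    then have "x \<in> \<tau> ` V" unfolding tau_V .
    then obtain y where y: "y \<in> V" "x = \<tau> y" by blast
    have "H x (\<tau> a) \<in> val_ge v 1 \<longleftrightarrow> H y a \<in> val_ge v 1" if "a \<in> A" for a
      using that assms y by (subst y(2), subst H_tau_tau) auto
    then have "x \<in> pdual (\<tau> ` A) \<longleftrightarrow> y \<in> pdual A" using True y by (simp add: pdual_def)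
    also have "\<dots> \<longleftrightarrow> x \<in> \<tau> ` pdual A" using y(2) tau_inj by (simp add: inj_image_mem_iff)
    finally show ?thesis .
  next
    case False
    then show ?thesis using pdual_V tau_in_V by blast
  qed
qed

lemma pdual_invariant: "lat A \<Longrightarrow> \<tau> ` A = A \<Longrightarrow> \<tau> ` pdual A = pdual A"
  using pdual_tau[OF lat_subset_V] by metis

text \<open>The sum of the volumes of a lattice and its dual is constant, and the bidual is the Frobenius
  image.\<close>

lemma vol_tau: "lat A \<Longrightarrow> vol (\<tau> ` A) = vol A"
  using vol_pdual[OF lat_pdual, of A A] pdual_pdual[of A] by simp

section \<open>Growing chains\<close>

lemma invariantI: assumes "lat A" "\<tau> ` A \<subseteq> A" shows "\<tau> ` A = A"
  using vol_eqD[OF lat_tau[OF assms(1)] assms] vol_tau[OF assms(1)] by simp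

definition grow :: "'v set \<Rightarrow> 'v set" where
  "grow C = C + \<tau> ` C"

abbreviation grown :: "nat \<Rightarrow> 'v set \<Rightarrow> 'v set" where
  "grown j C \<equiv> (grow ^^ j) C"

lemma lat_grow: "lat C \<Longrightarrow> lat (grow C)"
  unfolding grow_def by (intro lat_plus lat_tau)

lemma lat_grown: "lat C \<Longrightarrow> lat (grown j C)"
  by (induction j) (simp_all add: lat_grow)

lemma subset_grow: "lat C \<Longrightarrow> C \<subseteq> grow C"
  unfolding grow_def by (intro subset_plus_left submod_tau lat_submod)

lemma tau_subset_grow: "lat C \<Longrightarrow> \<tau> ` C \<subseteq> grow C"
  unfolding grow_def by (intro subset_plus_right lat_submod)

lemma grow_subset: "lat D \<Longrightarrow> C \<subseteq> D \<Longrightarrow> \<tau> ` C \<subseteq> D \<Longrightarrow> grow C \<subseteq> D"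
  unfolding grow_def by (intro plus_subset lat_submod)

lemma grow_invariant: "lat C \<Longrightarrow> \<tau> ` C = C \<Longrightarrow> grow C = C"
  unfolding grow_def by (simp add: plus_absorb lat_submod)

lemma grow_fixedD: "lat C \<Longrightarrow> grow C = C \<Longrightarrow> \<tau> ` C = C"
  using tau_subset_grow invariantI by metis

lemma grown_invariant: "lat C \<Longrightarrow> \<tau> ` C = C \<Longrightarrow> grown j C = C"
  by (induction j) (simp_all add: grow_invariant)

lemma grown_mono: assumes "lat C" "i \<le> j" shows "grown i C \<subseteq> grown j C"
  using assms(2)
proof (induction j)
  case (Suc j)
  show ?case
  proof (cases "i = Suc j")
    case False
    then have "grown i C \<subseteq> grown j C" using Suc by simp
    also have "\<dots> \<subseteq> grow (grown j C)" by (intro subset_grow lat_grown assms)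
    finally show ?thesis by simp
  qed simp
qed simp

lemma grown_subset:
  assumes "lat D" "\<tau> ` D = D" "C \<subseteq> D" shows "grown j C \<subseteq> D"
proof (induction j)
  case (Suc j)
  then have "\<tau> ` grown j C \<subseteq> D" using assms(2) by blast
  then show ?case using grow_subset[OF assms(1) Suc] by simp
qed (use assms in simp)

lemma grown_stable:
  assumes "lat C" "\<tau> ` grown i C = grown i C" "i \<le> j"
  shows "grown j C = grown i C"
proof -
  have "grown j C = grown (j - i) (grown i C)"
    using assms(3) by (simp add: funpow_add[symmetric, unfolded comp_def, THEN fun_cong] flip: comp_apply[of "grow ^^ _" "grow ^^ _"] funpow_add)
  then show ?thesis using grown_invariant[OF lat_grown[OF assms(1)] assms(2)] by simp
qed

text \<open>The intersection of C with its Frobenius image has colength at most one in C, and this persists: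
  the next intersection contains the previous Frobenius image.\<close>

lemma grow_vol_step:
  assumes "lat A" "lat C" "A \<subseteq> C" "A \<subseteq> \<tau> ` C" "vol C \<le> vol A + 1"
  shows "vol (grown (Suc j) C) \<le> vol (grown j C) + 1"
  using assms
proof (induction j arbitrary: A C)
  case 0
  have "vol A \<le> vol (C \<inter> \<tau> ` C)" using 0 by (intro vol_mono lat_Int lat_tau) auto
  then show ?case using vol_plus_Int[OF 0(2) lat_tau[OF 0(2)]] vol_tau[OF 0(2)] 0(5) by (simp add: grow_def)
next
  case (Suc j)
  have "vol A \<le> vol (C \<inter> \<tau> ` C)" using Suc.prems by (intro vol_mono lat_Int lat_tau) auto
  then have le: "vol (grow C) \<le> vol (\<tau> ` C) + 1"
    using vol_plus_Int[OF Suc.prems(2) lat_tau[OF Suc.prems(2)]] vol_tau[OF Suc.prems(2)] Suc.prems(5)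
    by (simp add: grow_def)
  have "\<tau> ` C \<subseteq> \<tau> ` grow C" using subset_grow[OF Suc.prems(2)] by (rule image_mono)
  from Suc.IH[OF lat_tau[OF Suc.prems(2)] lat_grow[OF Suc.prems(2)] tau_subset_grow[OF Suc.prems(2)] this le]
  show ?case by (simp add: funpow_swap1)
qed

text \<open>A chain that does not grow in one step consists of invariant lattices from then on. Before that
  happens, the growth is positive and at most one.\<close>

lemma grown_vol:
  assumes C: "lat C" and step: "\<And>j. vol (grown (Suc j) C) \<le> vol (grown j C) + 1"
    and W: "\<tau> ` grown N C = grown N C"
  shows "vol (grown j C) = min (vol C + int j) (vol (grown N C))"
proof (induction j)
  case 0
  have "C \<subseteq> grown N C" using grown_mono[OF C, of 0 N] by simp
  then show ?case using vol_mono[OF C lat_grown[OF C]] by simp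
next
  case (Suc j)
  note L = lat_grown[OF C]
  have le: "vol (grown (Suc j) C) \<le> vol (grown N C)"
  proof (cases "Suc j \<le> N")
    case True
    then show ?thesis by (intro vol_mono L grown_mono C)
  next
    case False
    then show ?thesis using grown_stable[OF C W, of "Suc j"] by simp
  qed
  show ?case
  proof (cases "\<tau> ` grown j C = grown j C")
    case True
    have "grown (max j N) C = grown j C" using grown_stable[OF C True, of "max j N"] by simp
    moreover have "grown (max j N) C = grown N C" using grown_stable[OF C W, of "max j N"] by simp
    ultimately have "grown N C = grown j C" by (simp only:)
    moreover have "grown (Suc j) C = grown j C" by (rule grown_stable[OF C True]) simp
    ultimately have "vol (grown (Suc j) C) = vol (grown j C)" "vol (grown N C) = vol (grown j C)" by (simp_all only:)
    then show ?thesis using Suc by linarith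
  next
    case False
    then have "grown j C \<noteq> grow (grown j C)" using grow_fixedD[OF L] by metis
    then have "grown j C \<subset> grown (Suc j) C" using subset_grow[OF L, of j] by auto
    then have "vol (grown j C) < vol (grown (Suc j) C)" by (intro vol_less L)
    then show ?thesis using step[of j] le Suc by linarith
  qed
qed

text \<open>All members of the chain lie in a common multiple of the standard lattice, which bounds their
  volumes.\<close>

lemma ex_grown_invariant: assumes C: "lat C" shows "\<exists>N. \<tau> ` grown N C = grown N C"
proof (rule ccontr)
  assume no: "\<nexists>N. \<tau> ` grown N C = grown N C"
  note L = lat_grown[OF C]
  have grow: "vol C + int j \<le> vol (grown j C)" for j
  proof (induction j)
    case (Suc j)
    have "grown j C \<noteq> grow (grown j C)" using grow_fixedD[OF L] no by metis
    then have "grown j C \<subset> grown (Suc j) C" using subset_grow[OF L, of j] by auto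
    then have "vol (grown j C) < vol (grown (Suc j) C)" by (intro vol_less L)
    then show ?case using Suc by simp
  qed simp
  obtain k where "C \<subseteq> std (- k)" using C by (auto simp: lat_def)
  then have "vol (grown j C) \<le> vol (std (- k))" for j
    by (intro vol_mono L lat_std grown_subset tau_std)
  from this[of "nat (vol (std (- k)) - vol C + 1)"] grow[of "nat (vol (std (- k)) - vol C + 1)"]
  show False by linarith
qed

lemma tau_funpow_add: "(\<tau> ^^ i) (x + y) = (\<tau> ^^ i) x + (\<tau> ^^ i) y"
  by (induction i) (simp_all add: tau_add)

lemma tau_funpow_0 [simp]: "(\<tau> ^^ i) 0 = 0"
  by (induction i) simp_all

lemma iterate_sum_grown: assumes C: "submod C" shows "iterate_sum \<tau> C j = grown j C"
proof (induction j)
  case 0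
  show ?case unfolding iterate_sum_def by auto
next
  case (Suc j)
  have "iterate_sum \<tau> C (Suc j) = iterate_sum \<tau> C j + \<tau> ` iterate_sum \<tau> C j"
  proof (rule antisym)
    show "iterate_sum \<tau> C (Suc j) \<subseteq> iterate_sum \<tau> C j + \<tau> ` iterate_sum \<tau> C j"
    proof
      fix z assume "z \<in> iterate_sum \<tau> C (Suc j)"
      then obtain x where x: "\<forall>i\<le>Suc j. x i \<in> C" "z = (\<Sum>i\<le>Suc j. (\<tau> ^^ i) (x i))"
        unfolding iterate_sum_def by blast
      have "x 0 = (\<Sum>i\<le>j. (\<tau> ^^ i) (if i = 0 then x 0 else 0))"
        by (simp add: if_distrib[of "\<tau> ^^ _"] cong: if_cong)
      also have "\<dots> \<in> iterate_sum \<tau> C j" unfolding iterate_sum_def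
        using x(1) submod_0[OF C] by (intro CollectI exI[of _ "\<lambda>i. if i = 0 then x 0 else 0"]) simp
      finally have 1: "x 0 \<in> iterate_sum \<tau> C j" .
      have "(\<Sum>i\<le>j. (\<tau> ^^ i) (x (Suc i))) \<in> iterate_sum \<tau> C j"
        unfolding iterate_sum_def using x(1) by (intro CollectI exI[of _ "\<lambda>i. x (Suc i)"]) simp
      then have 2: "\<tau> (\<Sum>i\<le>j. (\<tau> ^^ i) (x (Suc i))) \<in> \<tau> ` iterate_sum \<tau> C j" by (rule imageI)
      have "z = x 0 + \<tau> (\<Sum>i\<le>j. (\<tau> ^^ i) (x (Suc i)))"
        unfolding x(2) sum.atMost_Suc_shift tau_sum by simp
      then show "z \<in> iterate_sum \<tau> C j + \<tau> ` iterate_sum \<tau> C j" using set_plus_intro[OF 1 2] by simp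
    qed
    show "iterate_sum \<tau> C j + \<tau> ` iterate_sum \<tau> C j \<subseteq> iterate_sum \<tau> C (Suc j)"
    proof
      fix z assume "z \<in> iterate_sum \<tau> C j + \<tau> ` iterate_sum \<tau> C j"
      then obtain p q where pq: "p \<in> iterate_sum \<tau> C j" "q \<in> iterate_sum \<tau> C j" "z = p + \<tau> q"
        by (auto elim!: set_plus_elim)
      then obtain x y where xy: "\<forall>i\<le>j. x i \<in> C" "p = (\<Sum>i\<le>j. (\<tau> ^^ i) (x i))"
          "\<forall>i\<le>j. y i \<in> C" "q = (\<Sum>i\<le>j. (\<tau> ^^ i) (y i))"
        unfolding iterate_sum_def by blast
      let ?x = "\<lambda>i. if i \<le> j then x i else 0" and ?y = "\<lambda>i. if i = 0 then 0 else y (i - 1)"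
      have "p = (\<Sum>i\<le>Suc j. (\<tau> ^^ i) (?x i))" unfolding xy(2) by simp
      moreover have "\<tau> q = (\<Sum>i\<le>Suc j. (\<tau> ^^ i) (?y i))"
        unfolding xy(4) tau_sum sum.atMost_Suc_shift by simp
      ultimately have "z = (\<Sum>i\<le>Suc j. (\<tau> ^^ i) (?x i + ?y i))"
        unfolding pq(3) tau_funpow_add sum.distrib by simp
      moreover have "?x i + ?y i \<in> C" if "i \<le> Suc j" for i
        using that xy(1,3) submod_0[OF C] by (intro submod_add[OF C]) auto
      ultimately show "z \<in> iterate_sum \<tau> C (Suc j)"
        unfolding iterate_sum_def by (intro CollectI exI[of _ "\<lambda>i. ?x i + ?y i"]) blast
    qed
  qed
  then show ?case unfolding Suc by (simp only: funpow.simps comp_apply grow_def[of "grown j C"])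
qed

section \<open>The chain generated by a special lattice\<close>

text \<open>The lattices to which Vollaard and Wedhorn attach an invariant.\<close>

definition special :: "'v set \<Rightarrow> bool" where
  "special M \<longleftrightarrow> lat M \<and> pdual M \<subseteq> M \<and> vol M = vol (pdual M) + 1"

lemma special_vol: "special M \<Longrightarrow> special M' \<Longrightarrow> vol M = vol M'"
  using vol_pdual[of M M'] by (simp add: special_def)

lemma special_pdual_tau: "special M \<Longrightarrow> pdual M \<subseteq> \<tau> ` M"
  using pdual_anti[of "pdual M" M] pdual_pdual[of M] by (simp add: special_def)

lemma special_step: "special M \<Longrightarrow> vol (grown (Suc j) M) \<le> vol (grown j M) + 1"
  by (rule grow_vol_step[of "pdual M"]) (simp_all add: special_pdual_tau lat_pdual special_def)

definition shrink :: "'v set \<Rightarrow> 'v set" where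
  "shrink C = C \<inter> tau_inv ` C"

lemma lat_shrink: "lat C \<Longrightarrow> lat (shrink C)"
  unfolding shrink_def by (intro lat_Int lat_tau_inv)

lemma lat_shrunk: "lat C \<Longrightarrow> lat ((shrink ^^ j) C)"
  by (induction j) (simp_all add: lat_shrink)

lemma tau_shrink: "\<tau> ` shrink C = \<tau> ` C \<inter> C"
  unfolding shrink_def tau_Int tau_inv_image ..

lemma grow_shrink_subset: "lat C \<Longrightarrow> grow (shrink C) \<subseteq> C"
  by (rule grow_subset) (auto simp: tau_shrink, simp add: shrink_def)

lemma grow_mono: "A \<subseteq> B \<Longrightarrow> grow A \<subseteq> grow B"
  unfolding grow_def by (intro set_plus_mono2 image_mono)

lemma grown_shrunk_subset: "lat C \<Longrightarrow> grown j ((shrink ^^ j) C) \<subseteq> C"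
proof (induction j)
  case (Suc j)
  have mono: "grown j A \<subseteq> grown j B" if "A \<subseteq> B" for A B
    using that by (induction j) (simp_all add: grow_mono)
  have "grown (Suc j) ((shrink ^^ Suc j) C) = grown j (grow (shrink ((shrink ^^ j) C)))"
    by (simp add: funpow_swap1)
  also have "\<dots> \<subseteq> grown j ((shrink ^^ j) C)"
    by (intro mono grow_shrink_subset lat_shrunk Suc.prems)
  also have "\<dots> \<subseteq> C" using Suc by simp
  finally show ?case .
qed simp

lemma invariant_subset_shrunk: "\<tau> ` A = A \<Longrightarrow> A \<subseteq> C \<Longrightarrow> A \<subseteq> (shrink ^^ j) C"
proof (induction j)
  case (Suc j)
  then have "tau_inv ` A \<subseteq> tau_inv ` (shrink ^^ j) C" by (intro image_mono) simp
  moreover have "tau_inv ` A = A" using Suc.prems(1) tau_inv_image(2)[of A] by simp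
  ultimately show ?case using Suc unfolding funpow.simps comp_apply shrink_def[of "(shrink ^^ j) C"] by simp
qed simp

end

text \<open>The Vollaard-Wedhorn invariant of a special lattice M, the dual S of its lattice, and the
  intersection P of M with its images under the first d inverse powers of the Frobenius. From P
  the whole chain will be generated.\<close>

locale special_lattice = hermitian_isocrystal scale v \<epsilon> n b \<sigma> \<tau> H \<eta>
  for scale :: "'l::field \<Rightarrow> 'v::ab_group_add \<Rightarrow> 'v" (infixr \<open>*s\<close> 75)
    and v :: "'l \<Rightarrow> int" and \<epsilon> :: 'l and n :: nat and b :: "nat \<Rightarrow> 'v"
    and \<sigma> :: "'l \<Rightarrow> 'l" and \<tau> :: "'v \<Rightarrow> 'v" and H :: "'v \<Rightarrow> 'v \<Rightarrow> 'l" and \<eta> :: "nat \<Rightarrow> 'l" +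
  fixes M :: "'v set"
  assumes special: "special M"
begin

definition d :: nat where "d = (LEAST j. \<tau> ` grown j M = grown j M)"

definition \<Lambda> :: "'v set" where "\<Lambda> = grown d M"

definition S :: "'v set" where "S = pdual \<Lambda>"

definition P :: "'v set" where "P = (shrink ^^ d) M"

lemma lat_M: "lat M" and pdual_M: "pdual M \<subseteq> M" and vol_M: "vol M = vol (pdual M) + 1"
  using special by (auto simp: special_def)

lemma Lambda_invariant: "\<tau> ` \<Lambda> = \<Lambda>"
  unfolding \<Lambda>_def d_def using ex_grown_invariant[OF lat_M] by (rule LeastI_ex)

lemma lat_Lambda: "lat \<Lambda>"
  unfolding \<Lambda>_def by (intro lat_grown lat_M)

lemma M_subset_Lambda: "M \<subseteq> \<Lambda>"
  unfolding \<Lambda>_def using grown_mono[OF lat_M, of 0 d] by simp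

lemma grown_M_vol: "vol (grown j M) = min (vol M + int j) (vol \<Lambda>)"
  unfolding \<Lambda>_def by (rule grown_vol[OF lat_M special_step[OF special] Lambda_invariant[unfolded \<Lambda>_def]])

text \<open>The chain reaches its final volume at the first index at which it is invariant, not earlier.\<close>

lemma vol_Lambda: "vol \<Lambda> = vol M + int d"
proof (rule ccontr)
  assume "vol \<Lambda> \<noteq> vol M + int d"
  then have less: "vol \<Lambda> < vol M + int d" using grown_M_vol[of d] unfolding \<Lambda>_def[symmetric] by linarith
  define j where "j = nat (vol \<Lambda> - vol M)"
  have "vol M \<le> vol \<Lambda>" by (intro vol_mono lat_M lat_Lambda M_subset_Lambda)
  then have j: "vol M + int j = vol \<Lambda>" "j < d" using less by (auto simp: j_def)
  have "grown j M = \<Lambda>"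
  proof (rule vol_eqD)
    show "grown j M \<subseteq> \<Lambda>" unfolding \<Lambda>_def using j(2) by (intro grown_mono lat_M) simp
    show "vol \<Lambda> \<le> vol (grown j M)" using grown_M_vol[of j] j(1) by simp
  qed (intro lat_grown lat_M lat_Lambda)+
  then have "\<tau> ` grown j M = grown j M" using Lambda_invariant by simp
  then show False using j(2) not_less_Least unfolding d_def by blast
qed

lemma lat_S: "lat S"
  unfolding S_def by (intro lat_pdual lat_Lambda)

lemma S_invariant: "\<tau> ` S = S"
  unfolding S_def by (intro pdual_invariant lat_Lambda Lambda_invariant)

lemma S_subset_M: "S \<subseteq> M"
  unfolding S_def using pdual_anti[OF M_subset_Lambda] pdual_M by blast

lemma vol_S: "vol S = vol M - 1 - int d"
  unfolding S_def using vol_pdual[OF lat_Lambda lat_M] vol_Lambda vol_M by simp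

lemma lat_P: "lat P"
  unfolding P_def by (intro lat_shrunk lat_M)

lemma S_subset_P: "S \<subseteq> P"
  unfolding P_def by (intro invariant_subset_shrunk S_invariant S_subset_M)

text \<open>If M is not invariant, the intersection with its Frobenius image is proper and contains pdual M,
  which has colength one in M.\<close>

lemma M_Int_tau: assumes "0 < d" shows "\<tau> ` M \<inter> M = pdual M"
proof (rule sym, rule vol_eqD)
  have "\<not> \<tau> ` M = M"
  proof
    assume "\<tau> ` M = M"
    then have "d \<le> 0" unfolding d_def by (intro Least_le) simp
    then show False using assms by simp
  qed
  then have "\<not> M \<subseteq> \<tau> ` M" using vol_eqD[OF lat_M lat_tau[OF lat_M]] vol_tau[OF lat_M] by auto
  then have "\<tau> ` M \<inter> M \<subset> M" by blast
  then have "vol (\<tau> ` M \<inter> M) < vol M" by (intro vol_less lat_Int lat_tau lat_M)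
  then show "vol (\<tau> ` M \<inter> M) \<le> vol (pdual M)" using vol_M by simp
  show "pdual M \<subseteq> \<tau> ` M \<inter> M" using pdual_M special_pdual_tau[OF special] by blast
qed (intro lat_pdual lat_Int lat_tau lat_M)+

text \<open>Duality exchanges the growing and the shrinking chain.\<close>

lemma shrunk_dual:
  assumes "0 < d" shows "\<tau> ` (\<tau> ^^ j) ` (shrink ^^ Suc j) M = pdual (grown j M)"
proof (induction j)
  case 0
  show ?case using M_Int_tau[OF assms] by (simp add: tau_shrink)
next
  case (Suc j)
  let ?C = "(shrink ^^ Suc j) M"
  have com: "(\<tau> ^^ j) ` \<tau> ` A = \<tau> ` (\<tau> ^^ j) ` A" for A
    unfolding image_image by (simp add: funpow_swap1)
  have inj: "inj (\<tau> ^^ j)" using tau_inj by (rule inj_fn)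
  have "\<tau> ` (\<tau> ^^ Suc j) ` (shrink ^^ Suc (Suc j)) M = \<tau> ` (\<tau> ^^ j) ` \<tau> ` shrink ?C"
    by (simp add: image_image funpow_swap1)
  also have "\<dots> = \<tau> ` (\<tau> ` (\<tau> ^^ j) ` ?C \<inter> (\<tau> ^^ j) ` ?C)"
    unfolding tau_shrink image_Int[OF inj] com ..
  also have "\<dots> = \<tau> ` pdual (grown j M) \<inter> pdual (grown j M)"
    unfolding tau_Int using Suc by simp
  also have "\<dots> = pdual (\<tau> ` grown j M + grown j M)"
    unfolding pdual_tau[OF lat_subset_V[OF lat_grown[OF lat_M]], symmetric]
    by (intro pdual_plus[symmetric] lat_submod lat_tau lat_grown lat_M)
  also have "\<dots> = pdual (grown (Suc j) M)" by (simp add: grow_def add.commute)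
  finally show ?case .
qed

lemma vol_funpow_tau: "lat A \<Longrightarrow> lat ((\<tau> ^^ j) ` A) \<and> vol ((\<tau> ^^ j) ` A) = vol A"
proof (induction j)
  case (Suc j)
  have "(\<tau> ^^ Suc j) ` A = \<tau> ` (\<tau> ^^ j) ` A" by (simp add: image_image)
  then show ?case using Suc lat_tau vol_tau by simp
qed simp

text \<open>P is dual, up to the Frobenius, to the last member of the growing chain that differs from \<Lambda>,
  while S is dual to \<Lambda>.\<close>

lemma vol_P: "vol P = vol S + 1"
proof (cases "d = 0")
  case True
  then show ?thesis using vol_S by (simp add: P_def)
next
  case False
  then obtain j where j: "d = Suc j" by (cases d) auto
  have "vol P = vol (pdual (grown j M))"
    using shrunk_dual[of j] vol_funpow_tau[OF lat_P, of j] vol_tau[of "(\<tau> ^^ j) ` P"] j unfolding P_def by simp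
  also have "\<dots> = vol (pdual M) + vol M - vol (grown j M)"
    using vol_pdual[OF lat_grown[OF lat_M, of j] lat_M] by simp
  also have "\<dots> = vol S + 1" using grown_M_vol[of j] vol_Lambda vol_S vol_M j by simp
  finally show ?thesis .
qed

text \<open>An invariant lattice in M lies in the intersection of M with its Frobenius image, that is, in
  pdual M. By invariance it lies in all Frobenius images of pdual M, and S is the intersection of
  some of them.\<close>

lemma invariant_subset_S:
  assumes "0 < d" "lat A" "\<tau> ` A = A" "A \<subseteq> M" shows "A \<subseteq> S"
proof -
  have "A \<subseteq> pdual (grown j M)" for j
  proof (induction j)
    case 0
    have "A \<subseteq> \<tau> ` M \<inter> M" using assms(3,4) by blast
    then show ?case using M_Int_tau[OF assms(1)] by simp
  next
    case (Suc j)
    have "pdual (grown (Suc j) M) = pdual (grown j M) \<inter> \<tau> ` pdual (grown j M)"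
      unfolding pdual_tau[OF lat_subset_V[OF lat_grown[OF lat_M]], symmetric] funpow.simps comp_apply grow_def[of "grown j M"]
      by (intro pdual_plus lat_submod lat_tau lat_grown lat_M)
    then show ?case using Suc assms(3) by blast
  qed
  then show ?thesis unfolding S_def \<Lambda>_def .
qed

lemma P_step: "vol (grown (Suc j) P) \<le> vol (grown j P) + 1"
  using S_invariant S_subset_P vol_P
  by (intro grow_vol_step[of S] lat_S lat_P) auto

text \<open>The lattices generated by P stay in M. Were they stationary before reaching the volume of M, the
  result would be an invariant lattice in M, hence in S, which does not contain P.\<close>

theorem M_generated: "grown d P = M"
proof (cases "d = 0")
  case True
  then show ?thesis by (simp add: P_def)
next
  case False
  obtain N where N: "\<tau> ` grown N P = grown N P" using ex_grown_invariant[OF lat_P] by blast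
  have sub: "grown d P \<subseteq> M" unfolding P_def by (rule grown_shrunk_subset[OF lat_M])
  have vol: "vol (grown d P) = min (vol P + int d) (vol (grown N P))"
    by (rule grown_vol[OF lat_P P_step N])
  have "vol M \<le> vol (grown d P)"
  proof (rule ccontr)
    assume "\<not> vol M \<le> vol (grown d P)"
    then have eq: "vol (grown d P) = vol (grown N P)" using vol vol_P vol_S by linarith
    have "grown d P = grown N P"
    proof (cases "d \<le> N")
      case True
      show ?thesis by (rule vol_eqD) (use eq lat_P lat_grown grown_mono[OF lat_P True] in auto)
    next
      case False
      show ?thesis by (rule vol_eqD[symmetric]) (use eq lat_P lat_grown grown_mono[OF lat_P, of N d] False in auto)
    qed
    then have "grown N P \<subseteq> S" using sub N False by (intro invariant_subset_S lat_grown lat_P) auto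
    then have "P \<subseteq> S" using grown_mono[OF lat_P, of 0 N] by simp
    then show False using vol_mono[OF lat_P lat_S] vol_P by simp
  qed
  then show ?thesis by (intro vol_eqD lat_grown lat_P lat_M sub)
qed

lemma Lambda_generated: "grown (d + d) P = \<Lambda>"
  unfolding \<Lambda>_def funpow_add comp_apply M_generated ..

lemma grown_plus_invariant:
  assumes "lat C" "lat Y" "\<tau> ` Y = Y" shows "grown j (C + Y) = grown j C + Y"
proof (induction j)
  case (Suc j)
  have YY: "Y + Y = Y" using assms(2) by (intro plus_absorb lat_submod) auto
  have "grow (grown j C + Y) = grown j C + Y + (\<tau> ` grown j C + Y)" unfolding grow_def tau_plus assms(3) ..
  also have "\<dots> = grown j C + \<tau> ` grown j C + (Y + Y)" by (simp only: ac_simps)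
  also have "\<dots> = grow (grown j C) + Y" unfolding YY grow_def ..
  finally show ?case using Suc by simp
qed simp

text \<open>Modulo S the lattice generated by P is cyclic for the Frobenius. Every quotient of a cyclic
  module is cyclic, so the images of the partial sums of the chain in it keep growing by one until
  they are everything, whatever the invariant lattice Y divided out.\<close>

theorem vol_plus_invariant:
  assumes Y: "lat Y" "\<tau> ` Y = Y"
  shows "vol (M + Y) = min (vol (S + Y) + 1 + int d) (vol (\<Lambda> + Y))"
proof -
  have L: "lat (P + Y)" "lat (S + Y)" using Y lat_P lat_S by (auto intro: lat_plus)
  have SY: "S + Y \<subseteq> P + Y" using S_subset_P by (intro set_plus_mono2) auto
  have inv: "\<tau> ` (S + Y) = S + Y" unfolding tau_plus S_invariant Y(2) ..
  have MY: "grown d (P + Y) = M + Y" using grown_plus_invariant[OF lat_P Y] M_generated by simp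
  have LY: "grown (d + d) (P + Y) = \<Lambda> + Y" using grown_plus_invariant[OF lat_P Y] Lambda_generated by simp
  have LY_inv: "\<tau> ` (\<Lambda> + Y) = \<Lambda> + Y" unfolding tau_plus Lambda_invariant Y(2) ..
  have "P + (S + Y) = (P + S) + Y" by (simp only: add.assoc)
  also have "P + S = P" using S_subset_P by (intro plus_absorb2 lat_submod lat_P lat_S)
  finally have "P + (S + Y) = P + Y" .
  moreover have "vol S \<le> vol (P \<inter> (S + Y))"
    using S_subset_P subset_plus_left[OF lat_submod[OF Y(1)], of S] by (intro vol_mono lat_S lat_Int lat_P L) blast
  ultimately have le: "vol (P + Y) \<le> vol (S + Y) + 1"
    using vol_plus_Int[OF lat_P L(2)] vol_P by simp
  have "S + Y \<subseteq> \<tau> ` (P + Y)" using image_mono[OF SY, of \<tau>] unfolding inv .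
  then have step: "vol (grown (Suc j) (P + Y)) \<le> vol (grown j (P + Y)) + 1" for j
    using le SY by (intro grow_vol_step[of "S + Y"] L)
  have vol: "vol (M + Y) = min (vol (P + Y) + int d) (vol (\<Lambda> + Y))"
    using grown_vol[OF L(1) step, of "d + d" d] unfolding MY LY using LY_inv by blast
  show ?thesis
  proof (cases "vol (P + Y) \<le> vol (S + Y)")
    case True
    then have eq: "S + Y = P + Y" using SY by (intro vol_eqD L)
    then have "grown j (P + Y) = P + Y" for j using inv L by (intro grown_invariant) auto
    then have "M + Y = S + Y" "\<Lambda> + Y = S + Y" using MY LY eq by auto
    then show ?thesis by simp
  next
    case False
    then have "vol (P + Y) = vol (S + Y) + 1" using le by simp
    then show ?thesis using vol by simp
  qed
qed

text \<open>P modulo S is simple, hence killed by the uniformizer, and so is everything that it generates.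
  Explicitly, if \<epsilon> x were outside S then adjoining it to S would give P, which contains x, so that
  a unit multiple (1 - c \<epsilon>) x would lie in S.\<close>

lemma twist_Lambda_subset: "twist 1 \<Lambda> \<subseteq> S"
proof -
  have sS: "submod S" and sP: "submod P" using lat_S lat_P by (simp_all add: lat_submod)
  have eps: "\<epsilon> *s x \<in> S" if x: "x \<in> P" for x
  proof (rule ccontr)
    assume ex: "\<epsilon> *s x \<notin> S"
    let ?C = "S + line (\<epsilon> *s x)"
    have SC: "S \<subseteq> ?C" by (rule subset_plus_left[OF submod_line])
    have "\<epsilon> *s x \<in> P" using submod_scale[OF sP _ x, of \<epsilon>] by (simp add: val_ge_def v_eps)
    then have CP: "?C \<subseteq> P" using S_subset_P line_subset[OF sP] by (intro plus_subset[OF sP])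
    have lC: "lat ?C" by (rule lat_between[OF submod_plus[OF sS submod_line] lat_S lat_P SC CP])
    have "\<epsilon> *s x \<in> ?C" using set_plus_intro[OF submod_0[OF sS] line_self] by simp
    then have "S \<subset> ?C" using ex SC by blast
    then have "vol P \<le> vol ?C" using vol_less[OF lat_S lC] vol_P by simp
    then have "?C = P" by (rule vol_eqD[OF lC lat_P CP])
    then have "x \<in> ?C" using x by blast
    then obtain a c where ac: "a \<in> S" "c \<in> int_ring v" "x = a + c *s \<epsilon> *s x"
      by (blast elim: set_plus_elim lineE)
    have "c * \<epsilon> \<in> val_ge v 1" using val_ge_mult[OF ac(2), of \<epsilon> 1] by (simp add: val_ge_def v_eps)
    moreover have "1 \<notin> val_ge v 1" by (simp add: val_ge_def)
    ultimately have "1 - c * \<epsilon> \<notin> val_ge v 1" using val_ge_add[of "1 - c * \<epsilon>" 1 "c * \<epsilon>"] by auto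
    moreover have "1 - c * \<epsilon> \<in> int_ring v"
      using val_ge_mono[of 0 1] \<open>c * \<epsilon> \<in> val_ge v 1\<close> by (intro val_ge_diff) auto
    ultimately have unit: "1 - c * \<epsilon> \<noteq> 0" "v (1 - c * \<epsilon>) = 0" by (auto simp: val_ge_def)
    then have "inverse (1 - c * \<epsilon>) \<in> int_ring v" using val_ge_inverse[of "1 - c * \<epsilon>"] by simp
    moreover have "a = (1 - c * \<epsilon>) *s x" using ac(3) by (simp add: scale_left_diff_distrib algebra_simps)
    then have "x = inverse (1 - c * \<epsilon>) *s a" using unit(1) by simp
    ultimately have "x \<in> S" using submod_scale[OF sS _ ac(1)] by metis
    then show False using submod_scale[OF sS _ \<open>x \<in> S\<close>, of \<epsilon>] ex by (simp add: val_ge_def v_eps)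
  qed
  have "P \<subseteq> twist (- 1) S"
    using eps by (auto simp: twist_iff)
  then have "grown (d + d) P \<subseteq> twist (- 1) S"
    by (intro grown_subset lat_twist lat_S) (simp_all add: tau_twist S_invariant)
  then have "twist 1 \<Lambda> \<subseteq> twist 1 (twist (- 1) S)" unfolding Lambda_generated by (rule twist_mono)
  then show ?thesis by simp
qed

lemma VW_invariant_eq: "VW_invariant \<tau> M = (\<Lambda>, d)"
  unfolding VW_invariant_def Let_def invariant_under_def iterate_sum_grown[OF lat_submod[OF lat_M]]
    \<Lambda>_def d_def ..

end

section \<open>Equations over the residue field\<close>

text \<open>The residue field, with its q-th power map. This map is additive because it is the reduction of
  the additive map \<sigma>.\<close>

locale residue_isocrystal = hermitian_isocrystal scale v \<epsilon> n b \<sigma> \<tau> H \<eta>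
  for scale :: "'l::field \<Rightarrow> 'v::ab_group_add \<Rightarrow> 'v" (infixr \<open>*s\<close> 75)
    and v :: "'l \<Rightarrow> int" and \<epsilon> :: 'l and n :: nat and b :: "nat \<Rightarrow> 'v"
    and \<sigma> :: "'l \<Rightarrow> 'l" and \<tau> :: "'v \<Rightarrow> 'v" and H :: "'v \<Rightarrow> 'v \<Rightarrow> 'l" and \<eta> :: "nat \<Rightarrow> 'l" +
  fixes res :: "'l \<Rightarrow> 'r::alg_closed_field" and q :: nat
  assumes residue: "residue_map v res"
    and q_gt_1: "1 < q"
    and res_sigma: "c \<in> int_ring v \<Longrightarrow> res (\<sigma> c) = res c ^ q"
begin

lemma res_add: "c \<in> int_ring v \<Longrightarrow> d \<in> int_ring v \<Longrightarrow> res (c + d) = res c + res d"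
  and res_mult: "c \<in> int_ring v \<Longrightarrow> d \<in> int_ring v \<Longrightarrow> res (c * d) = res c * res d"
  and res_eq_0: "c \<in> int_ring v \<Longrightarrow> res c = 0 \<longleftrightarrow> c \<in> val_ge v 1"
  using residue unfolding residue_map_def by blast+

lemma res_0 [simp]: "res 0 = 0"
  using res_eq_0[of 0] by simp

lemma res_diff: "c \<in> int_ring v \<Longrightarrow> d \<in> int_ring v \<Longrightarrow> res (c - d) = res c - res d"
  using res_add[of "c - d" d] val_ge_diff[of c 0 d] by simp

lemma ex_lift: "\<exists>c\<in>int_ring v. res c = a"
  using residue unfolding residue_map_def by (metis UNIV_I imageE)

lemma frob_0 [simp]: "(0::'r) ^ q = 0"
  using q_gt_1 by simp

lemma frob_add: "(a + c) ^ q = a ^ q + (c::'r) ^ q"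
proof -
  obtain a' where a': "a' \<in> int_ring v" "res a' = a" using ex_lift by blast
  obtain c' where c': "c' \<in> int_ring v" "res c' = c" using ex_lift by blast
  have "(a + c) ^ q = res (\<sigma> (a' + c'))" using a' c' by (simp add: res_sigma res_add val_ge_add)
  also have "\<dots> = a ^ q + c ^ q" using a' c' by (simp add: sigma_add res_add res_sigma)
  finally show ?thesis .
qed

lemma frob_diff: "(a - c) ^ q = a ^ q - (c::'r) ^ q"
  using frob_add[of "a - c" c] by simp

lemma frob_uminus: "(- c) ^ q = - ((c::'r) ^ q)"
  using frob_diff[of 0 c] by simp

lemma ex_root:
  assumes "1 < m" shows "\<exists>t::'r. t ^ m + a * t = c"
proof -
  let ?p = "monom 1 m + [:- c, a:]"
  have "degree ?p = degree (monom (1::'r) m)"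
    using assms by (intro degree_add_eq_left) (auto simp: degree_monom_eq)
  then have "degree ?p > 0" using assms by (simp add: degree_monom_eq)
  then obtain t where "poly ?p t = 0" using alg_closed_imp_poly_has_root by blast
  then have "t ^ m + a * t = c" by (simp add: poly_monom algebra_simps)
  then show ?thesis by blast
qed

lemma ex_artin_schreier: "\<exists>t::'r. (t ^ q) ^ q - t = c"
proof -
  have "1 < q * q" by (rule less_1_mult[OF q_gt_1 q_gt_1])
  then obtain t :: 'r where "t ^ (q * q) + (- 1) * t = c" using ex_root by blast
  then show ?thesis by (auto simp: power_mult)
qed

lemma ex_trace_one: "\<exists>t::'r. t ^ q + t = 1 \<and> (t ^ q) ^ q = t"
proof -
  obtain t :: 'r where t: "t ^ q + 1 * t = 1" using ex_root[OF q_gt_1] by blast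
  then have "t ^ q = 1 - t" by (simp add: algebra_simps)
  then have "(t ^ q) ^ q = t" by (simp add: frob_diff)
  then show ?thesis using t by auto
qed

text \<open>The norm of z is z ^ (q + 1). If c is fixed by the square of the q-th power map, the ratio of c ^ q
  and c has norm 1. For c ^ q - c = w with nonzero w, the ratio is not 1, and c is fixed by the
  square as soon as w ^ q = - w.\<close>

lemma ex_norm_one: "\<exists>z::'r. z \<noteq> 1 \<and> z ^ (q + 1) = 1"
proof -
  have "0 < q - 1" using q_gt_1 by simp
  then obtain w :: 'r where w: "w ^ (q - 1) = - 1" using nth_root_exists by blast
  have "w \<noteq> 0" using w q_gt_1 by (auto simp: power_0_left split: if_splits)
  have wq: "w ^ q = - w" using w q_gt_1 power_Suc[of w "q - 1"] by simp
  obtain c :: 'r where c: "c ^ q + (- 1) * c = w" using ex_root[OF q_gt_1] by blast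
  then have cq: "c ^ q = c + w" by (simp add: algebra_simps)
  then have "c \<noteq> 0" using \<open>w \<noteq> 0\<close> by auto
  have cqq: "(c ^ q) ^ q = c" unfolding cq frob_add wq cq by simp
  let ?z = "c ^ q / c"
  have "?z \<noteq> 1" using cq \<open>w \<noteq> 0\<close> \<open>c \<noteq> 0\<close> by simp
  moreover have "?z ^ (q + 1) = 1"
    using \<open>c \<noteq> 0\<close> by (simp add: power_divide cqq)
  ultimately show ?thesis by blast
qed

text \<open>Solutions of norm c are themselves fixed by the square of the q-th power map, because c is fixed
  by the q-th power map.\<close>

lemma ex_two_norms:
  assumes "c \<noteq> (0::'r)" "c ^ q = c"
  shows "\<exists>l m. l \<noteq> m \<and> l ^ q * l = c \<and> m ^ q * m = c \<and> (l ^ q) ^ q = l \<and> (m ^ q) ^ q = m"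
proof -
  obtain l :: 'r where l: "l ^ (q + 1) = c" using nth_root_exists[of "q + 1"] by auto
  obtain z :: 'r where z: "z \<noteq> 1" "z ^ (q + 1) = 1" using ex_norm_one by blast
  have twice: "(k ^ q) ^ q = k" if "k ^ q * k = c" for k
  proof -
    have "k ^ q \<noteq> 0" using that assms(1) by auto
    have "(k ^ q) ^ q * k ^ q = (k ^ q * k) ^ q" by (simp add: power_mult_distrib)
    also have "\<dots> = k * k ^ q" using that assms(2) by (simp add: mult.commute)
    finally show ?thesis using mult_right_cancel[OF \<open>k ^ q \<noteq> 0\<close>] by blast
  qed
  have l': "l ^ q * l = c" using l by (simp add: mult.commute)
  moreover have m': "(z * l) ^ q * (z * l) = c"
  proof -
    have "(z * l) ^ q * (z * l) = (z * l) ^ (q + 1)" by (simp add: mult.commute)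
    also have "\<dots> = z ^ (q + 1) * l ^ (q + 1)" by (rule power_mult_distrib)
    also have "\<dots> = c" unfolding z(2) l by simp
    finally show ?thesis .
  qed
  moreover have "l \<noteq> z * l" using l' assms(1) z(1) by auto
  ultimately show ?thesis using twice by blast
qed

section \<open>Generators fixed by the Frobenius modulo the uniformizer\<close>

text \<open>The span of the first m basis vectors, in terms of coordinates of the whole space.\<close>

definition flag :: "nat \<Rightarrow> 'v set" where
  "flag m = {x \<in> V. \<forall>i<n. m \<le> i \<longrightarrow> coord n b i x = 0}"

lemma flag_tau: "x \<in> flag m \<Longrightarrow> \<tau> x \<in> flag m"
  by (simp add: flag_def tau_in_V coord_tau)

lemma flag_add: "x \<in> flag m \<Longrightarrow> y \<in> flag m \<Longrightarrow> x + y \<in> flag m"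
  and flag_diff: "x \<in> flag m \<Longrightarrow> y \<in> flag m \<Longrightarrow> x - y \<in> flag m"
  and flag_scale: "x \<in> flag m \<Longrightarrow> c *s x \<in> flag m"
  by (auto simp: flag_def coord_add[OF frame_b] coord_diff[OF frame_b] coord_scale[OF frame_b]
      span_add span_diff span_scale)

lemma flag_Suc: "x \<in> flag (Suc m) \<Longrightarrow> m < n \<Longrightarrow> coord n b m x = 0 \<Longrightarrow> x \<in> flag m"
  by (auto simp: flag_def Suc_le_eq le_less)

lemma submod_flag: "submod A \<Longrightarrow> submod (A \<inter> flag m)"
proof -
  have "submod (flag m)"
  proof (rule submodI)
    show "0 \<in> flag m" by (simp add: flag_def span_zero)
  qed (rule flag_add flag_scale; assumption)+
  then show "submod A \<Longrightarrow> submod (A \<inter> flag m)" by (intro submod_Int)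
qed

definition nearly_fixed :: "'v set \<Rightarrow> 'v \<Rightarrow> bool" where
  "nearly_fixed A x \<longleftrightarrow> x \<in> A \<and> \<tau> x - x \<in> twist 1 A"

lemma twist_1_scale: "submod A \<Longrightarrow> c \<in> val_ge v 1 \<Longrightarrow> x \<in> A \<Longrightarrow> c *s x \<in> twist 1 A"
proof -
  assume "submod A" "c \<in> val_ge v 1" "x \<in> A"
  then have "(\<epsilon> powi (- 1) * c) *s x \<in> A" by (intro submod_scale) (simp_all only: val_ge_powi_mult, simp_all)
  then show ?thesis unfolding twist_iff scale_scale .
qed

lemma twist_submod_scale: "submod A \<Longrightarrow> c \<in> int_ring v \<Longrightarrow> x \<in> twist j A \<Longrightarrow> c *s x \<in> twist j A"
  by (rule submod_scale[OF submod_twist])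

text \<open>Modulo the uniformizer this is an equation of Artin-Schreier type.\<close>

lemma ex_correction:
  assumes "c \<in> int_ring v" shows "\<exists>t\<in>int_ring v. c + \<sigma> (\<sigma> t) - t \<in> val_ge v 1"
proof -
  obtain a where a: "(a ^ q) ^ q - a = - res c" using ex_artin_schreier by blast
  obtain t where t: "t \<in> int_ring v" "res t = a" using ex_lift by blast
  have "res (c + \<sigma> (\<sigma> t) - t) = res c + (a ^ q) ^ q - a"
    using assms t by (simp add: res_diff res_add res_sigma val_ge_add)
  also have "\<dots> = 0" using a by (simp add: algebra_simps)
  finally have "c + \<sigma> (\<sigma> t) - t \<in> val_ge v 1"
    using assms t by (subst res_eq_0[symmetric]) (simp_all add: val_ge_add val_ge_diff)
  then show ?thesis using t(1) by blast
qed

text \<open>In the quotients of the filtration of A by the spans of the first m vectors of the fixed basis a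
  generator is fixed, and lifts of it can be corrected by elements of the previous step.\<close>

lemma nearly_fixed_generators_flag:
  assumes A: "lat A" "\<tau> ` A = A" and "m \<le> n"
  shows "\<exists>z. (\<forall>i<m. nearly_fixed (A \<inter> flag m) (z i)) \<and>
    (\<forall>x\<in>A \<inter> flag m. \<exists>c. (\<forall>i<m. c i \<in> int_ring v) \<and> x = (\<Sum>i<m. c i *s z i))"
  using assms(3)
proof (induction m)
  case 0
  have "x = 0" if "x \<in> flag 0" for x
    using that coord_expand[OF frame_b, of x] by (simp add: flag_def)
  then show ?case by auto
next
  case (Suc m)
  then have m: "m < n" by simp
  obtain z where z: "\<And>i. i < m \<Longrightarrow> nearly_fixed (A \<inter> flag m) (z i)"
      "\<And>x. x \<in> A \<inter> flag m \<Longrightarrow> \<exists>c. (\<forall>i<m. c i \<in> int_ring v) \<and> x = (\<Sum>i<m. c i *s z i)"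
    using Suc by (metis Suc_leD)
  let ?A = "A \<inter> flag m" and ?B = "A \<inter> flag (Suc m)" and ?f = "coord n b m"
  have smA: "submod A" using A(1) by (rule lat_submod)
  have sm: "submod ?A" "submod ?B" using submod_flag[OF smA] by auto
  have AB: "?A \<subseteq> ?B" by (auto simp: flag_def)
  have fV: "x \<in> V" if "x \<in> flag j" for x j using that by (simp add: flag_def)
  obtain k where k: "std k \<subseteq> A" "A \<subseteq> std (- k)" using A(1) by (auto simp: lat_def)
  \<comment> \<open>x0 is a vector whose coordinate at m has the least possible valuation.\<close>
  let ?Q = "\<lambda>j. \<exists>x\<in>?B. ?f x \<noteq> 0 \<and> v (?f x) = - k + int j"
  have "\<exists>x\<in>?B. ?f x \<noteq> 0"
  proof
    let ?x = "\<epsilon> powi k *s b m"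
    have "?x \<in> std k" using powi_basis_in_box[OF frame_b m] by blast
    moreover have "b m \<in> V" using m by (intro span_base) simp
    then have "?x \<in> flag (Suc m)" and "?f ?x \<noteq> 0"
      using m by (auto simp: flag_def span_scale coord_scale[OF frame_b] coord_basis[OF frame_b])
    ultimately show "?x \<in> ?B" "?f ?x \<noteq> 0" using k by auto
  qed
  then obtain x where x: "x \<in> ?B" "?f x \<noteq> 0" by blast
  have low: "- k \<le> v (?f y)" if "y \<in> ?B" "?f y \<noteq> 0" for y
  proof -
    have "y \<in> std (- k)" using that k by blast
    then show ?thesis using that m by (auto simp: box_def val_ge_def)
  qed
  have "?Q (nat (v (?f x) + k))" using x low[OF x] by auto
  then obtain j where j: "?Q j" and min: "\<And>i. i < j \<Longrightarrow> \<not> ?Q i" using exists_least_iff[of ?Q] by blast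
  then obtain x0 where x0: "x0 \<in> ?B" "?f x0 \<noteq> 0" "v (?f x0) = - k + int j" by blast
  define a where "a = - k + int j"
  have val: "?f y \<in> val_ge v a" if y: "y \<in> ?B" for y
  proof (cases "?f y = 0")
    case False
    have "\<not> nat (v (?f y) + k) < j"
    proof
      assume "nat (v (?f y) + k) < j"
      then have "\<not> ?Q (nat (v (?f y) + k))" by (rule min)
      then show False using y False low[OF y False] by auto
    qed
    then have "a \<le> v (?f y)" using low[OF y False] unfolding a_def by linarith
    then show ?thesis by (simp add: val_ge_def)
  qed simp
  define x1 where "x1 = (\<epsilon> powi a / ?f x0) *s x0"
  have "\<epsilon> powi a / ?f x0 \<in> int_ring v" using x0 by (intro val_ge_divide) (simp_all add: val_ge_powi a_def)
  then have x1: "x1 \<in> ?B" unfolding x1_def using x0 by (intro submod_scale[OF sm(2)])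
  have fx1: "?f x1 = \<epsilon> powi a"
  proof -
    have "x0 \<in> V" using x0(1) fV by blast
    then show ?thesis unfolding x1_def using x0(2) by (simp add: coord_scale[OF frame_b])
  qed
  have tB: "\<tau> y \<in> ?B" if "y \<in> ?B" for y using that A(2) flag_tau by blast
  have x1V: "x1 \<in> V" using x1 fV by blast
  have "\<tau> x1 - x1 \<in> flag m"
  proof (rule flag_Suc[OF _ m])
    show "\<tau> x1 - x1 \<in> flag (Suc m)" using x1 tB[OF x1] by (intro flag_diff) auto
    show "?f (\<tau> x1 - x1) = 0"
      using x1V m fx1 by (simp add: coord_diff[OF frame_b] coord_tau tau_in_V)
  qed
  moreover have "\<tau> x1 - x1 \<in> A" using x1 tB[OF x1] submod_diff[OF smA] by blast
  ultimately obtain c where c: "\<forall>i<m. c i \<in> int_ring v" "\<tau> x1 - x1 = (\<Sum>i<m. c i *s z i)"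
    using z(2)[of "\<tau> x1 - x1"] by blast
  have "\<forall>i<m. \<exists>t\<in>int_ring v. c i + \<sigma> (\<sigma> t) - t \<in> val_ge v 1" using c(1) ex_correction by blast
  then obtain t where t: "\<And>i. i < m \<Longrightarrow> t i \<in> int_ring v"
      "\<And>i. i < m \<Longrightarrow> c i + \<sigma> (\<sigma> (t i)) - t i \<in> val_ge v 1" by metis
  have zA: "z i \<in> ?A" "\<tau> (z i) - z i \<in> twist 1 ?A" if "i < m" for i
    using z(1)[OF that] by (auto simp: nearly_fixed_def)
  define y where "y = (\<Sum>i<m. t i *s z i)"
  define x2 where "x2 = x1 + y"
  have yA: "y \<in> ?A" unfolding y_def using t(1) zA(1) by (intro submod_sum[OF sm(1)] submod_scale[OF sm(1)]) auto
  have x2: "x2 \<in> ?B" unfolding x2_def using x1 yA AB submod_add[OF sm(2)] by blast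
  have "\<tau> x2 - x2 = (\<tau> x1 - x1) + (\<tau> y - y)" by (simp add: x2_def tau_add algebra_simps)
  also have "\<dots> = (\<Sum>i<m. c i *s z i + (\<sigma> (\<sigma> (t i)) *s \<tau> (z i) - t i *s z i))"
    unfolding c(2) y_def tau_sum tau_scale by (simp only: sum.distrib sum_subtractf)
  also have "\<dots> = (\<Sum>i<m. (c i + \<sigma> (\<sigma> (t i)) - t i) *s z i + \<sigma> (\<sigma> (t i)) *s (\<tau> (z i) - z i))"
    by (intro sum.cong) (simp_all add: scale_left_distrib scale_left_diff_distrib scale_right_diff_distrib)
  also have "\<dots> \<in> twist 1 ?A"
    using t zA by (intro submod_sum submod_add submod_twist sm twist_1_scale twist_submod_scale) auto
  finally have fix2: "\<tau> x2 - x2 \<in> twist 1 ?A" .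
  have tAB: "twist 1 ?A \<subseteq> twist 1 ?B" by (rule twist_mono[OF AB])
  have fx2: "?f x2 = \<epsilon> powi a"
  proof -
    have "?f y = 0" using yA m by (simp add: flag_def)
    moreover have "y \<in> V" using yA fV by blast
    ultimately show ?thesis unfolding x2_def using fx1 x1V by (simp add: coord_add[OF frame_b])
  qed
  have x2V: "x2 \<in> V" using x2 fV by blast
  let ?z = "z(m := x2)"
  have "nearly_fixed ?B (?z i)" if "i < Suc m" for i
    using that zA AB tAB x2 fix2 by (auto simp: nearly_fixed_def less_Suc_eq)
  moreover have "\<exists>c. (\<forall>i<Suc m. c i \<in> int_ring v) \<and> x = (\<Sum>i<Suc m. c i *s ?z i)" if x: "x \<in> ?B" for x
  proof -
    let ?e = "\<epsilon> powi (- a) * ?f x"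
    have e: "?e \<in> int_ring v" unfolding val_ge_powi_mult using val[OF x] by simp
    have ex2: "?e *s x2 \<in> ?B" using e x2 by (rule submod_scale[OF sm(2)])
    have "?e * \<epsilon> powi a = (\<epsilon> powi (- a) * \<epsilon> powi a) * ?f x" by (simp only: ac_simps)
    then have ea: "?e * \<epsilon> powi a = ?f x" unfolding powi_minus_cancel by simp
    have "x \<in> V" using x fV by blast
    then have "?f (x - ?e *s x2) = ?f x - ?e * ?f x2"
      using x2V by (simp add: coord_diff[OF frame_b] coord_scale[OF frame_b] span_scale del: power_int_minus)
    also have "\<dots> = 0" unfolding fx2 ea by simp
    finally have "?f (x - ?e *s x2) = 0" .
    moreover have "x - ?e *s x2 \<in> flag (Suc m)" using x ex2 by (intro flag_diff) blast+
    ultimately have "x - ?e *s x2 \<in> flag m" using flag_Suc m by blast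
    moreover have "x - ?e *s x2 \<in> A" using x ex2 submod_diff[OF smA] by blast
    ultimately obtain c where c: "\<forall>i<m. c i \<in> int_ring v" "x - ?e *s x2 = (\<Sum>i<m. c i *s z i)"
      using z(2)[of "x - ?e *s x2"] by blast
    have "(\<Sum>i<Suc m. (c(m := ?e)) i *s ?z i) = (\<Sum>i<m. c i *s z i) + ?e *s x2" by simp
    also have "\<dots> = x" unfolding c(2)[symmetric] by simp
    finally show ?thesis using c(1) e by (intro exI[of _ "c(m := ?e)"]) (simp add: less_Suc_eq del: power_int_minus)
  qed
  ultimately show ?case by blast
qed

theorem nearly_fixed_generators:
  assumes A: "lat A" "\<tau> ` A = A"
  shows "\<exists>z. (\<forall>i<n. nearly_fixed A (z i)) \<and>
    (\<forall>x\<in>A. \<exists>c. (\<forall>i<n. c i \<in> int_ring v) \<and> x = (\<Sum>i<n. c i *s z i))"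
proof -
  have "A \<inter> flag n = A" using lat_subset_V[OF A(1)] by (auto simp: flag_def)
  then show ?thesis using nearly_fixed_generators_flag[OF A order_refl] by simp
qed

end

section \<open>Opposite isotropic lattices\<close>

text \<open>The conditions make the quotient of L by pdual L a vector space over the residue field, on which
  the form induces a nondegenerate hermitian form.\<close>

locale vertex_lattice = residue_isocrystal scale v \<epsilon> n b \<sigma> \<tau> H \<eta> res q
  for scale :: "'l::field \<Rightarrow> 'v::ab_group_add \<Rightarrow> 'v" (infixr \<open>*s\<close> 75)
    and v :: "'l \<Rightarrow> int" and \<epsilon> :: 'l and n :: nat and b :: "nat \<Rightarrow> 'v"
    and \<sigma> :: "'l \<Rightarrow> 'l" and \<tau> :: "'v \<Rightarrow> 'v" and H :: "'v \<Rightarrow> 'v \<Rightarrow> 'l" and \<eta> :: "nat \<Rightarrow> 'l"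
    and res :: "'l \<Rightarrow> 'r::alg_closed_field" and q :: nat +
  fixes L :: "'v set"
  assumes lat_L: "lat L" and L_invariant: "\<tau> ` L = L"
    and pdual_L: "pdual L \<subseteq> L" and twist_L: "twist 1 L \<subseteq> pdual L"
begin

abbreviation R :: "'v set" where "R \<equiv> pdual L"

lemma lat_R: "lat R"
  by (rule lat_pdual[OF lat_L])

lemma R_invariant: "\<tau> ` R = R"
  by (rule pdual_invariant[OF lat_L L_invariant])

lemma L_V: "x \<in> L \<Longrightarrow> x \<in> V"
  using lat_subset_V[OF lat_L] by blast

lemma tau_L: "x \<in> L \<Longrightarrow> \<tau> x \<in> L"
  using L_invariant by blast

lemma H_integral: assumes "x \<in> L" "y \<in> L" shows "H x y \<in> int_ring v"
proof -
  have "\<epsilon> powi 1 *s x \<in> R" using assms(1) twist_L unfolding scale_lattice_def by blast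
  then have "H (\<epsilon> powi 1 *s x) y \<in> val_ge v 1" using assms(2) by (rule pdualD)
  then show ?thesis unfolding H_scale_left val_ge_powi_mult by simp
qed

definition red_form :: "'v \<Rightarrow> 'v \<Rightarrow> 'r" where "red_form x y = res (H x y)"

lemma red_form_add_left: "x \<in> L \<Longrightarrow> y \<in> L \<Longrightarrow> z \<in> L \<Longrightarrow> red_form (x + y) z = red_form x z + red_form y z"
  and red_form_add_right: "x \<in> L \<Longrightarrow> y \<in> L \<Longrightarrow> z \<in> L \<Longrightarrow> red_form z (x + y) = red_form z x + red_form z y"
  and red_form_diff_left: "x \<in> L \<Longrightarrow> y \<in> L \<Longrightarrow> z \<in> L \<Longrightarrow> red_form (x - y) z = red_form x z - red_form y z"
  by (simp_all add: red_form_def H_add_left H_add_right H_diff_left res_add res_diff H_integral)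

lemma red_form_scale_left: "c \<in> int_ring v \<Longrightarrow> x \<in> L \<Longrightarrow> y \<in> L \<Longrightarrow> red_form (c *s x) y = res c * red_form x y"
  and red_form_scale_right: "c \<in> int_ring v \<Longrightarrow> x \<in> L \<Longrightarrow> y \<in> L \<Longrightarrow> red_form x (c *s y) = res c ^ q * red_form x y"
  by (simp_all add: red_form_def H_scale_left H_scale_right res_mult H_integral res_sigma)

lemma red_form_0_iff: "x \<in> L \<Longrightarrow> y \<in> L \<Longrightarrow> red_form x y = 0 \<longleftrightarrow> H x y \<in> val_ge v 1"
  by (simp add: red_form_def res_eq_0 H_integral)

lemma red_form_tau: "x \<in> L \<Longrightarrow> y \<in> L \<Longrightarrow> red_form (\<tau> x) y = red_form y x ^ q"
  by (simp add: red_form_def H_tau L_V res_sigma H_integral)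

lemma in_R_iff: "x \<in> L \<Longrightarrow> x \<in> R \<longleftrightarrow> (\<forall>y\<in>L. red_form x y = 0)"
  by (auto simp: red_form_0_iff pdual_def L_V)

lemma red_form_R_left: "x \<in> R \<Longrightarrow> y \<in> L \<Longrightarrow> red_form x y = 0"
  using in_R_iff pdual_L by blast

lemma red_form_sum_left: "finite I \<Longrightarrow> (\<And>i. i \<in> I \<Longrightarrow> f i \<in> L) \<Longrightarrow> y \<in> L \<Longrightarrow> red_form (sum f I) y = (\<Sum>i\<in>I. red_form (f i) y)"
proof (induction I rule: finite_induct)
  case empty
  then show ?case by (simp add: red_form_def)
next
  case (insert i I)
  then have "f i \<in> L" "sum f I \<in> L" by (auto intro!: submod_sum[OF lat_submod[OF lat_L]])
  then show ?case using insert by (simp add: red_form_add_left)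
qed

lemma red_form_sum_right: "finite I \<Longrightarrow> (\<And>i. i \<in> I \<Longrightarrow> f i \<in> L) \<Longrightarrow> y \<in> L \<Longrightarrow> red_form y (sum f I) = (\<Sum>i\<in>I. red_form y (f i))"
proof (induction I rule: finite_induct)
  case empty
  then show ?case by (simp add: red_form_def)
next
  case (insert i I)
  then have "f i \<in> L" "sum f I \<in> L" by (auto intro!: submod_sum[OF lat_submod[OF lat_L]])
  then show ?case using insert by (simp add: red_form_add_right)
qed

definition fixed_mod :: "'v \<Rightarrow> bool" where
  "fixed_mod x \<longleftrightarrow> x \<in> L \<and> \<tau> x - x \<in> R"

lemma fixed_mod_hb: assumes "fixed_mod x" "y \<in> L" shows "red_form x y = red_form y x ^ q"
proof -
  have x: "x \<in> L" "\<tau> x \<in> L" "\<tau> x - x \<in> R" using assms tau_L by (auto simp: fixed_mod_def)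
  have "red_form (\<tau> x) y - red_form x y = red_form (\<tau> x - x) y" using red_form_diff_left[OF x(2,1) assms(2)] ..
  also have "\<dots> = 0" by (rule red_form_R_left[OF x(3) assms(2)])
  finally show ?thesis using red_form_tau[OF x(1) assms(2)] by simp
qed

lemma fixed_mod_scale:
  assumes x: "fixed_mod x" and c: "c \<in> int_ring v" "(res c ^ q) ^ q = res c" shows "fixed_mod (c *s x)"
proof -
  have xL: "x \<in> L" "\<tau> x - x \<in> R" using x by (auto simp: fixed_mod_def)
  have "res (\<sigma> (\<sigma> c) - c) = 0" using c by (simp add: res_diff res_sigma)
  then have "\<sigma> (\<sigma> c) - c \<in> val_ge v 1" using c(1) by (subst (asm) res_eq_0) (simp_all add: val_ge_diff)
  then have "(\<sigma> (\<sigma> c) - c) *s x \<in> R" using twist_1_scale[OF lat_submod[OF lat_L]] xL(1) twist_L by blast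
  moreover have "\<sigma> (\<sigma> c) *s (\<tau> x - x) \<in> R"
    using c(1) xL(2) by (intro submod_scale[OF lat_submod[OF lat_R]]) simp_all
  ultimately have "\<sigma> (\<sigma> c) *s (\<tau> x - x) + (\<sigma> (\<sigma> c) - c) *s x \<in> R" by (intro submod_add[OF lat_submod[OF lat_R]])
  moreover have "\<tau> (c *s x) - c *s x = \<sigma> (\<sigma> c) *s (\<tau> x - x) + (\<sigma> (\<sigma> c) - c) *s x"
    by (simp add: tau_scale scale_right_diff_distrib scale_left_diff_distrib)
  ultimately show ?thesis using submod_scale[OF lat_submod[OF lat_L] c(1) xL(1)] by (simp add: fixed_mod_def)
qed

lemma fixed_mod_add: assumes "fixed_mod x" "fixed_mod y" shows "fixed_mod (x + y)"
proof -
  have eq: "\<tau> (x + y) - (x + y) = (\<tau> x - x) + (\<tau> y - y)" by (simp add: tau_add algebra_simps)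
  show ?thesis
    unfolding fixed_mod_def eq using assms submod_add[OF lat_submod[OF lat_R]] submod_add[OF lat_submod[OF lat_L]]
    by (simp add: fixed_mod_def)
qed

definition nondeg :: "'v set \<Rightarrow> bool" where
  "nondeg D \<longleftrightarrow> lat D \<and> \<tau> ` D = D \<and> R \<subseteq> D \<and> D \<subseteq> L \<and> (\<forall>z\<in>D. (\<forall>y\<in>D. red_form z y = 0) \<longrightarrow> z \<in> R)"

lemma nondeg_L: "nondeg L"
  unfolding nondeg_def using lat_L L_invariant pdual_L in_R_iff by blast

text \<open>If all fixed vectors were isotropic, then, as elements of trace one exist, they would also be
  orthogonal to each other. As they generate D, the form on D would vanish.\<close>

lemma ex_anisotropic:
  assumes D: "nondeg D" "D \<noteq> R"
  shows "\<exists>x\<in>D. fixed_mod x \<and> red_form x x \<noteq> 0"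
proof (rule ccontr)
  assume no: "\<not> (\<exists>x\<in>D. fixed_mod x \<and> red_form x x \<noteq> 0)"
  have lD: "lat D" "\<tau> ` D = D" "R \<subseteq> D" and DL: "\<And>x. x \<in> D \<Longrightarrow> x \<in> L"
    and rad: "\<And>z. z \<in> D \<Longrightarrow> \<forall>y\<in>D. red_form z y = 0 \<Longrightarrow> z \<in> R"
    using D(1) unfolding nondeg_def by blast+
  have sD: "submod D" using lD(1) by (rule lat_submod)
  have orth: "red_form x y = 0" if x: "fixed_mod x" "x \<in> D" and y: "fixed_mod y" "y \<in> D" for x y
  proof (rule ccontr)
    assume "red_form x y \<noteq> 0"
    have xL: "x \<in> L" "y \<in> L" using x y DL by auto
    define t where "t = red_form y x"
    have tq: "red_form x y = t ^ q" "(t ^ q) ^ q = t"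
      using fixed_mod_hb[OF x(1) xL(2)] fixed_mod_hb[OF y(1) xL(1)] by (simp_all add: t_def)
    have t: "t \<noteq> 0" using \<open>red_form x y \<noteq> 0\<close> tq by auto
    obtain s :: 'r where s: "s ^ q + s = 1" "(s ^ q) ^ q = s" using ex_trace_one by blast
    \<comment> \<open>This coefficient makes the mixed terms in the norm of x + c y add up to the trace of s.\<close>
    obtain c where c: "c \<in> int_ring v" "res c = s / t" using ex_lift by blast
    have "(res c ^ q) ^ q = res c" unfolding c(2) using s(2) tq(2) by (simp add: power_divide)
    then have cy: "fixed_mod (c *s y)" using y(1) c(1) by (intro fixed_mod_scale)
    have cyD: "c *s y \<in> D" using c(1) y(2) by (rule submod_scale[OF sD])
    have cyL: "c *s y \<in> L" using cyD by (rule DL)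
    have "red_form (x + c *s y) (x + c *s y) = red_form x x + red_form x (c *s y) + (red_form (c *s y) x + red_form (c *s y) (c *s y))"
      using xL cyL submod_add[OF lat_submod[OF lat_L]] by (simp add: red_form_add_left red_form_add_right)
    also have "\<dots> = red_form x (c *s y) + red_form (c *s y) x"
      using no x y cyD cy by auto
    also have "\<dots> = (s / t) ^ q * t ^ q + (s / t) * t"
      using xL c by (simp add: red_form_scale_left red_form_scale_right tq(1) t_def[symmetric])
    also have "\<dots> = 1" using t s(1) by (simp add: power_divide)
    finally have "red_form (x + c *s y) (x + c *s y) = 1" .
    moreover have "x + c *s y \<in> D" "fixed_mod (x + c *s y)" using x cy cyD submod_add[OF sD] fixed_mod_add by auto
    ultimately show False using no by auto
  qed
  obtain z where z: "\<And>i. i < n \<Longrightarrow> nearly_fixed D (z i)"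
      "\<And>x. x \<in> D \<Longrightarrow> \<exists>c. (\<forall>i<n. c i \<in> int_ring v) \<and> x = (\<Sum>i<n. c i *s z i)"
    using nearly_fixed_generators[OF lD(1,2)] by metis
  have "twist 1 D \<subseteq> R" using twist_mono[of D L 1] twist_L DL by blast
  then have zf: "fixed_mod (z i)" "z i \<in> D" "z i \<in> L" if "i < n" for i
    using z(1)[OF that] DL by (auto simp: nearly_fixed_def fixed_mod_def)
  have "red_form x y = 0" if xy: "x \<in> D" "y \<in> D" for x y
  proof -
    obtain c where c: "\<forall>i<n. c i \<in> int_ring v" "x = (\<Sum>i<n. c i *s z i)" using z(2)[OF xy(1)] by blast
    obtain e where e: "\<forall>i<n. e i \<in> int_ring v" "y = (\<Sum>i<n. e i *s z i)" using z(2)[OF xy(2)] by blast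
    have czL: "c i *s z i \<in> L" "e i *s z i \<in> L" if "i < n" for i
      using c(1) e(1) zf(3)[OF that] that submod_scale[OF lat_submod[OF lat_L]] by auto
    have "red_form (z i) y = 0" if "i < n" for i
    proof -
      have "red_form (z i) y = (\<Sum>j<n. red_form (z i) (e j *s z j))"
        unfolding e(2) using czL zf(3)[OF that] by (intro red_form_sum_right) auto
      also have "\<dots> = 0" using e(1) zf orth that by (intro sum.neutral) (auto simp: red_form_scale_right)
      finally show ?thesis .
    qed
    moreover have "red_form x y = (\<Sum>i<n. red_form (c i *s z i) y)"
      unfolding c(2) using czL DL[OF xy(2)] by (intro red_form_sum_left) auto
    ultimately show ?thesis using c(1) zf(3) DL[OF xy(2)] by (simp add: red_form_scale_left)
  qed
  then have "D \<subseteq> R" using rad by blast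
  then show False using D(2) lD(3) by blast
qed

text \<open>As the norm of x is a unit, every vector of D becomes orthogonal to x after subtracting an
  integral multiple of x.\<close>

lemma orthogonal_complement:
  assumes D: "nondeg D" and x: "x \<in> D" "fixed_mod x" "red_form x x \<noteq> 0"
  defines "D' \<equiv> {z \<in> D. red_form z x = 0}"
  shows "nondeg D'" and "vol D = vol D' + 1"
proof -
  have lD: "lat D" "\<tau> ` D = D" "R \<subseteq> D" "D \<subseteq> L" and DL: "\<And>x. x \<in> D \<Longrightarrow> x \<in> L"
    and rad: "\<And>z. z \<in> D \<Longrightarrow> \<forall>y\<in>D. red_form z y = 0 \<Longrightarrow> z \<in> R"
    using D(1) unfolding nondeg_def by blast+
  have sD: "submod D" using lD(1) by (rule lat_submod)
  have xL: "x \<in> L" using x DL by blast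
  have sD': "submod D'"
  proof (rule submodI)
    show "0 \<in> D'" using submod_0[OF sD] by (simp add: D'_def red_form_def)
  qed (use sD DL xL in \<open>auto simp: D'_def red_form_add_left red_form_scale_left intro: submod_add submod_scale\<close>)
  have RD: "R \<subseteq> D'" using lD(3) red_form_R_left[OF _ xL] by (auto simp: D'_def)
  have sub: "D' \<subseteq> D" by (auto simp: D'_def)
  have lD': "lat D'" using sD' lat_R lD(1) RD sub by (rule lat_between)
  have "\<tau> ` D' \<subseteq> D'"
  proof
    fix w assume "w \<in> \<tau> ` D'"
    then obtain z where z: "z \<in> D" "red_form z x = 0" "w = \<tau> z" by (auto simp: D'_def)
    have "red_form (\<tau> z) x = red_form x z ^ q" using z DL xL by (intro red_form_tau) auto
    also have "red_form x z = red_form z x ^ q" using z DL x(2) by (intro fixed_mod_hb) auto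
    finally have "red_form w x = 0" using z by simp
    moreover have "w \<in> D" using z lD(2) by blast
    ultimately show "w \<in> D'" by (simp add: D'_def)
  qed
  then have inv: "\<tau> ` D' = D'" by (rule invariantI[OF lD'])
  have proj: "\<exists>c\<in>int_ring v. y - c *s x \<in> D'" if y: "y \<in> D" for y
  proof -
    obtain c where c: "c \<in> int_ring v" "res c = red_form y x / red_form x x" using ex_lift by blast
    have cx: "c *s x \<in> D" using c(1) x(1) by (rule submod_scale[OF sD])
    then have "red_form (y - c *s x) x = red_form y x - res c * red_form x x"
      using y DL xL c(1) by (simp add: red_form_diff_left red_form_scale_left)
    also have "\<dots> = 0" using x(3) c(2) by simp
    finally have "y - c *s x \<in> D'" using submod_diff[OF sD y cx] by (simp add: D'_def)
    then show ?thesis using c(1) by blast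
  qed
  have "z \<in> R" if z: "z \<in> D'" "\<forall>y\<in>D'. red_form z y = 0" for z
  proof (rule rad)
    show "z \<in> D" using z sub by blast
    show "\<forall>y\<in>D. red_form z y = 0"
    proof
      fix y assume y: "y \<in> D"
      obtain c where c: "c \<in> int_ring v" "y - c *s x \<in> D'" using proj[OF y] by blast
      have zL: "z \<in> L" "y - c *s x \<in> L" "c *s x \<in> L"
        using z c sub DL submod_scale[OF lat_submod[OF lat_L] c(1) xL] by auto
      have "red_form z y = red_form z ((y - c *s x) + c *s x)" by simp
      also have "\<dots> = red_form z (y - c *s x) + red_form z (c *s x)" by (rule red_form_add_right[OF zL(2,3,1)])
      also have "\<dots> = res c ^ q * red_form z x" using z(2) c zL xL by (simp add: red_form_scale_right)
      also have "\<dots> = 0" using z(1) by (simp add: D'_def)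
      finally show "red_form z y = 0" .
    qed
  qed
  then show "nondeg D'" unfolding nondeg_def using lD' inv RD sub lD(4) by blast
  have "x \<notin> D'" using x(3) by (simp add: D'_def)
  moreover have "\<epsilon> *s x \<in> D'"
  proof -
    have "\<epsilon> powi 1 *s x \<in> twist 1 L" using xL unfolding scale_lattice_def by blast
    then show ?thesis using twist_L RD by auto
  qed
  moreover have "D' + line x = D"
  proof (rule antisym)
    show "D' + line x \<subseteq> D" using sub line_subset[OF sD x(1)] by (intro plus_subset[OF sD])
    show "D \<subseteq> D' + line x"
    proof
      fix y assume "y \<in> D"
      then obtain c where "c \<in> int_ring v" "y - c *s x \<in> D'" using proj by blast
      then have "(y - c *s x) + c *s x \<in> D' + line x" by (intro set_plus_intro lineI)
      then show "y \<in> D' + line x" by simp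
    qed
  qed
  ultimately show "vol D = vol D' + 1" using vol_adjoin_le(3)[OF lD' L_V[OF xL]] by simp
qed

definition isotropic :: "'v set \<Rightarrow> bool" where
  "isotropic I \<longleftrightarrow> lat I \<and> \<tau> ` I = I \<and> R \<subseteq> I \<and> I \<subseteq> L \<and> (\<forall>x\<in>I. \<forall>y\<in>I. red_form x y = 0)"

lemma isotropic_adjoin:
  assumes J: "isotropic J" and u: "fixed_mod u" "red_form u u = 0" and orth: "\<And>x. x \<in> J \<Longrightarrow> red_form x u = 0"
    and uJ: "u \<notin> J"
  shows "isotropic (J + line u)" and "vol (J + line u) = vol J + 1"
proof -
  have lJ: "lat J" "\<tau> ` J = J" "R \<subseteq> J" "J \<subseteq> L" and iso: "\<And>x y. x \<in> J \<Longrightarrow> y \<in> J \<Longrightarrow> red_form x y = 0"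
    using J unfolding isotropic_def by blast+
  have sJ: "submod J" using lJ(1) by (rule lat_submod)
  have uL: "u \<in> L" "\<tau> u - u \<in> R" using u(1) by (auto simp: fixed_mod_def)
  have "\<epsilon> powi 1 *s u \<in> twist 1 L" using uL(1) unfolding scale_lattice_def by blast
  then have eu: "\<epsilon> *s u \<in> J" using twist_L lJ(3) by auto
  note adj = vol_adjoin_le[OF lJ(1) L_V[OF uL(1)] eu]
  show "vol (J + line u) = vol J + 1" by (rule adj(3)[OF uJ])
  have JJ: "J \<subseteq> J + line u" and uu: "line u \<subseteq> J + line u"
    by (rule subset_plus_left[OF submod_line], rule subset_plus_right[OF sJ])
  have "\<tau> ` (J + line u) \<subseteq> J + line u"
  proof
    fix w assume "w \<in> \<tau> ` (J + line u)"
    then obtain x y where xy: "x \<in> J" "y \<in> line u" "w = \<tau> (x + y)" by (auto elim!: set_plus_elim)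
    then obtain c where c: "c \<in> int_ring v" "y = c *s u" by (blast elim: lineE)
    let ?c = "\<sigma> (\<sigma> c)"
    have "w = (\<tau> x + ?c *s (\<tau> u - u)) + ?c *s u"
      unfolding xy(3) c(2) tau_add tau_scale by (simp add: scale_right_diff_distrib)
    moreover have "\<tau> x \<in> J" using xy(1) lJ(2) by blast
    moreover have "?c *s (\<tau> u - u) \<in> J" using c(1) uL(2) lJ(3) by (intro submod_scale[OF sJ]) auto
    moreover have "?c *s u \<in> line u" using c(1) by (intro lineI) simp
    ultimately show "w \<in> J + line u" using submod_add[OF sJ] by (simp add: set_plus_intro)
  qed
  then have inv: "\<tau> ` (J + line u) = J + line u" by (rule invariantI[OF adj(1)])
  have sub: "J + line u \<subseteq> L"
    using lJ(4) line_subset[OF lat_submod[OF lat_L] uL(1)] by (intro plus_subset[OF lat_submod[OF lat_L]])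
  have "red_form w w' = 0" if w: "w \<in> J + line u" "w' \<in> J + line u" for w w'
  proof -
    obtain x c where x: "x \<in> J" "c \<in> int_ring v" "w = x + c *s u"
      using w(1) by (blast elim: set_plus_elim lineE)
    obtain x' c' where x': "x' \<in> J" "c' \<in> int_ring v" "w' = x' + c' *s u"
      using w(2) by (blast elim: set_plus_elim lineE)
    have L: "x \<in> L" "x' \<in> L" "c *s u \<in> L" "c' *s u \<in> L" "x' + c' *s u \<in> L"
      using x x' lJ(4) uL(1) submod_scale[OF lat_submod[OF lat_L]] submod_add[OF lat_submod[OF lat_L]] by auto
    have "red_form u x' = 0" using fixed_mod_hb[OF u(1) L(2)] orth[OF x'(1)] by simp
    then show ?thesis unfolding x(3) x'(3)
      using L x x' uL(1) iso[OF x(1) x'(1)] orth[OF x(1)] u(2)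
      by (simp add: red_form_add_left red_form_add_right red_form_scale_left red_form_scale_right)
  qed
  then show "isotropic (J + line u)"
    unfolding isotropic_def using adj(1) inv JJ lJ(3) sub by blast
qed

text \<open>Split off two orthogonal anisotropic fixed vectors. On their span the form has two isotropic
  fixed lines, which are distributed to the two lattices.\<close>

theorem ex_opposite_isotropic:
  assumes "nondeg D" "vol D = vol R + 2 * int m + 1"
  shows "\<exists>I J. isotropic I \<and> isotropic J \<and> I \<subseteq> D \<and> J \<subseteq> D \<and> vol I = vol R + int m \<and>
    vol J = vol R + int m \<and> I \<inter> J = R"
  using assms
proof (induction m arbitrary: D)
  case 0
  have "isotropic R"
    unfolding isotropic_def using lat_R R_invariant pdual_L red_form_R_left by blast
  moreover have "R \<subseteq> D" using 0 by (simp add: nondeg_def)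
  ultimately show ?case by auto
next
  case (Suc m)
  have "D \<noteq> R" using Suc.prems(2) by auto
  then obtain x where x: "x \<in> D" "fixed_mod x" "red_form x x \<noteq> 0" using ex_anisotropic Suc.prems(1) by blast
  define D1 where "D1 = {z \<in> D. red_form z x = 0}"
  have D1: "nondeg D1" "vol D = vol D1 + 1"
    unfolding D1_def using orthogonal_complement[OF Suc.prems(1) x] by auto
  have "D1 \<noteq> R" using D1(2) Suc.prems(2) by auto
  then obtain y where y: "y \<in> D1" "fixed_mod y" "red_form y y \<noteq> 0" using ex_anisotropic D1(1) by blast
  define D2 where "D2 = {z \<in> D1. red_form z y = 0}"
  have D2: "nondeg D2" "vol D1 = vol D2 + 1"
    unfolding D2_def using orthogonal_complement[OF D1(1) y] by auto
  have "vol D2 = vol R + 2 * int m + 1" using D1(2) D2(2) Suc.prems(2) by simp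
  then obtain I J where IJ: "isotropic I" "isotropic J" "I \<subseteq> D2" "J \<subseteq> D2" "vol I = vol R + int m"
      "vol J = vol R + int m" "I \<inter> J = R" using Suc.IH[OF D2(1)] by blast
  have xL: "x \<in> L" "y \<in> L" using x(2) y(2) by (auto simp: fixed_mod_def)
  have DL: "D \<subseteq> L" using Suc.prems(1) by (simp add: nondeg_def)
  have sD: "submod D" using Suc.prems(1) by (simp add: nondeg_def lat_submod)
  have yD: "y \<in> D" using y(1) by (simp add: D1_def)
  have yx: "red_form y x = 0" using y(1) by (simp add: D1_def)
  have xy: "red_form x y = 0" using fixed_mod_hb[OF x(2) xL(2)] yx by simp
  have a: "red_form x x ^ q = red_form x x" "red_form y y ^ q = red_form y y"
    using fixed_mod_hb[OF x(2) xL(1)] fixed_mod_hb[OF y(2) xL(2)] by simp_all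
  \<comment> \<open>A vector x + c y is isotropic exactly if the norm of the residue of c is this value.\<close>
  let ?c = "- red_form x x / red_form y y"
  have "?c \<noteq> 0" "?c ^ q = ?c" using x(3) y(3) a by (simp_all add: power_divide frob_uminus)
  then obtain l k :: 'r where lk: "l \<noteq> k" "l ^ q * l = ?c" "k ^ q * k = ?c" "(l ^ q) ^ q = l" "(k ^ q) ^ q = k"
    using ex_two_norms by blast
  obtain l' where l': "l' \<in> int_ring v" "res l' = l" using ex_lift by blast
  obtain k' where k': "k' \<in> int_ring v" "res k' = k" using ex_lift by blast
  have u: "fixed_mod (x + c *s y)" "red_form (x + c *s y) (x + c *s y) = 0" "red_form (x + c *s y) x = red_form x x"
      "red_form (x + c *s y) y = res c * red_form y y" "\<And>z. z \<in> D2 \<Longrightarrow> red_form z (x + c *s y) = 0" "x + c *s y \<in> D"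
      "x + c *s y \<notin> D2"
    if c: "c \<in> int_ring v" "res c ^ q * res c = ?c" "(res c ^ q) ^ q = res c" for c
  proof -
    have cy: "c *s y \<in> L" "fixed_mod (c *s y)" using fixed_mod_scale[OF y(2) c(1,3)] by (auto simp: fixed_mod_def)
    show "fixed_mod (x + c *s y)" using x(2) cy(2) by (rule fixed_mod_add)
    show 1: "red_form (x + c *s y) x = red_form x x"
      using xL cy c(1) yx by (simp add: red_form_add_left red_form_scale_left)
    show 2: "red_form (x + c *s y) y = res c * red_form y y"
      using xL cy c(1) xy by (simp add: red_form_add_left red_form_scale_left)
    have "x + c *s y \<in> L" using xL cy by (intro submod_add[OF lat_submod[OF lat_L]])
    then have "red_form (x + c *s y) (x + c *s y) = red_form x x + (res c ^ q * res c) * red_form y y"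
      using xL cy c(1) 1 2 by (simp add: red_form_add_right red_form_scale_right mult.assoc)
    then show "red_form (x + c *s y) (x + c *s y) = 0" unfolding c(2) using y(3) by simp
    show "red_form z (x + c *s y) = 0" if "z \<in> D2" for z
      using that DL xL cy c(1) by (auto simp: D2_def D1_def red_form_add_right red_form_scale_right)
    show "x + c *s y \<in> D" using x(1) yD c(1) by (intro submod_add[OF sD] submod_scale[OF sD])
    show "x + c *s y \<notin> D2" using 1 x(3) by (simp add: D2_def D1_def)
  qed
  note ul = u[OF l'(1), unfolded l'(2), OF lk(2,4)] and uk = u[OF k'(1), unfolded k'(2), OF lk(3,5)]
  define I' where "I' = I + line (x + l' *s y)"
  define J' where "J' = J + line (x + k' *s y)"
  have I': "isotropic I'" "vol I' = vol I + 1"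
    unfolding I'_def using isotropic_adjoin[OF IJ(1) ul(1,2)] ul(5,7) IJ(3) by blast+
  have J': "isotropic J'" "vol J' = vol J + 1"
    unfolding J'_def using isotropic_adjoin[OF IJ(2) uk(1,2)] uk(5,7) IJ(4) by blast+
  have D2D: "D2 \<subseteq> D" by (auto simp: D2_def D1_def)
  have "I' \<subseteq> D" unfolding I'_def using IJ(3) D2D line_subset[OF sD ul(6)] by (intro plus_subset[OF sD]) auto
  moreover have "J' \<subseteq> D" unfolding J'_def using IJ(4) D2D line_subset[OF sD uk(6)] by (intro plus_subset[OF sD]) auto
  moreover have "I' \<inter> J' = R"
  proof (rule antisym)
    show "R \<subseteq> I' \<inter> J'" using I'(1) J'(1) by (simp add: isotropic_def)
    show "I' \<inter> J' \<subseteq> R"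
    proof
      fix w assume w: "w \<in> I' \<inter> J'"
      obtain i c where i: "i \<in> I" "c \<in> int_ring v" "w = i + c *s (x + l' *s y)"
        using w unfolding I'_def by (blast elim: set_plus_elim lineE)
      obtain j e where j: "j \<in> J" "e \<in> int_ring v" "w = j + e *s (x + k' *s y)"
        using w unfolding J'_def by (blast elim: set_plus_elim lineE)
      have ij: "i \<in> L" "j \<in> L" "red_form i x = 0" "red_form i y = 0" "red_form j x = 0" "red_form j y = 0"
        using i(1) j(1) IJ(3,4) DL by (auto simp: D2_def D1_def)
      have uL: "x + l' *s y \<in> L" "x + k' *s y \<in> L" using ul(6) uk(6) DL by auto
      note cu = submod_scale[OF lat_submod[OF lat_L] i(2) uL(1)] submod_scale[OF lat_submod[OF lat_L] j(2) uL(2)]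
      have "red_form w x = res c * red_form x x" unfolding i(3) using ij cu uL xL i(2) ul(3) by (simp add: red_form_add_left red_form_scale_left)
      moreover have "red_form w x = res e * red_form x x" unfolding j(3) using ij cu uL xL j(2) uk(3) by (simp add: red_form_add_left red_form_scale_left)
      ultimately have ce: "res c = res e" using x(3) by simp
      have "red_form w y = res c * (l * red_form y y)" unfolding i(3) using ij cu uL xL i(2) ul(4) by (simp add: red_form_add_left red_form_scale_left)
      moreover have "red_form w y = res e * (k * red_form y y)" unfolding j(3) using ij cu uL xL j(2) uk(4) by (simp add: red_form_add_left red_form_scale_left)
      ultimately have "res c = 0" using ce lk(1) y(3) by simp
      then have c0: "c \<in> val_ge v 1" "e \<in> val_ge v 1"
        using ce res_eq_0[OF i(2)] res_eq_0[OF j(2)] by simp_all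
      have "c *s (x + l' *s y) \<in> R" "e *s (x + k' *s y) \<in> R"
        using twist_1_scale[OF lat_submod[OF lat_L] c0(1) uL(1)] twist_1_scale[OF lat_submod[OF lat_L] c0(2) uL(2)] twist_L by blast+
      moreover have "R \<subseteq> I" "R \<subseteq> J" and sm: "submod I" "submod J"
        using IJ(1,2) by (simp_all add: isotropic_def lat_submod)
      ultimately have "c *s (x + l' *s y) \<in> I" "e *s (x + k' *s y) \<in> J" by blast+
      then have "i + c *s (x + l' *s y) \<in> I" "j + e *s (x + k' *s y) \<in> J"
        using submod_add[OF sm(1) i(1)] submod_add[OF sm(2) j(1)] by blast+
      then have "w \<in> I" "w \<in> J" by (simp_all only: i(3)[symmetric] j(3)[symmetric])
      then show "w \<in> R" using IJ(7) by blast
    qed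
  qed
  ultimately show ?case using I' J' IJ(5,6) by (intro exI[of _ I'] exI[of _ J']) simp
qed

end

section \<open>Vollaard-Wedhorn invariants and special invariant lattices\<close>

context residue_isocrystal
begin

text \<open>Duality takes two opposite isotropic lattices with intersection S to lattices with sum \<Lambda>. By
  isotropy they contain their own duals, and by maximality with colength one.\<close>

theorem Lambda_sum_of_special:
  assumes "special M"
  defines "\<Lambda> \<equiv> fst (VW_invariant \<tau> M)"
  shows "\<exists>I J. special I \<and> special J \<and> \<tau> ` I = I \<and> \<tau> ` J = J \<and> twist 1 I \<subseteq> pdual I \<and>
    twist 1 J \<subseteq> pdual J \<and> I + J = \<Lambda>"
proof -
  interpret M: special_lattice scale v \<epsilon> n b \<sigma> \<tau> H \<eta> M by unfold_locales (rule assms(1))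
  have Lam: "\<Lambda> = M.\<Lambda>" unfolding \<Lambda>_def M.VW_invariant_eq by simp
  have lL: "lat \<Lambda>" "\<tau> ` \<Lambda> = \<Lambda>" unfolding Lam using M.lat_Lambda M.Lambda_invariant by auto
  interpret L: vertex_lattice scale v \<epsilon> n b \<sigma> \<tau> H \<eta> res q \<Lambda>
    using M.lat_Lambda M.Lambda_invariant M.S_subset_M M.M_subset_Lambda M.twist_Lambda_subset
    unfolding Lam M.S_def by unfold_locales auto
  have vols: "vol (pdual \<Lambda>) = vol M - 1 - int M.d" "vol \<Lambda> = vol M + int M.d"
    unfolding Lam using M.vol_S M.vol_Lambda unfolding M.S_def by auto
  have "vol \<Lambda> = vol (pdual \<Lambda>) + 2 * int M.d + 1" using vols by simp
  then obtain I J where IJ: "L.isotropic I" "L.isotropic J" "vol I = vol (pdual \<Lambda>) + int M.d"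
      "vol J = vol (pdual \<Lambda>) + int M.d" "I \<inter> J = pdual \<Lambda>"
    using L.ex_opposite_isotropic[OF L.nondeg_L] by blast
  have iso: "special (pdual K) \<and> \<tau> ` pdual K = pdual K \<and> pdual K \<subseteq> \<Lambda> \<and> twist 1 (pdual K) \<subseteq> pdual (pdual K)"
    if K: "L.isotropic K" "vol K = vol (pdual \<Lambda>) + int M.d" for K
  proof -
    have lK: "lat K" "\<tau> ` K = K" "pdual \<Lambda> \<subseteq> K" "K \<subseteq> \<Lambda>" using K(1) by (auto simp: L.isotropic_def)
    have ppK: "pdual (pdual K) = K" using pdual_pdual[OF lK(1)] lK(2) by simp
    have KK: "K \<subseteq> pdual K"
    proof
      fix x assume x: "x \<in> K"
      have "H x y \<in> val_ge v 1" if "y \<in> K" for y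
      proof -
        have "L.red_form x y = 0" using K(1) x that unfolding L.isotropic_def by blast
        then show ?thesis using L.red_form_0_iff[of x y] x that lK(4) by blast
      qed
      then show "x \<in> pdual K" using x lat_subset_V[OF lK(1)] unfolding pdual_def by blast
    qed
    have "vol (pdual K) = vol (pdual \<Lambda>) + vol \<Lambda> - vol K" using vol_pdual[OF lK(1) lL(1)] by simp
    then have "special (pdual K)" unfolding special_def ppK using KK lat_pdual[OF lK(1)] K(2) vols by simp
    moreover have sub: "pdual K \<subseteq> \<Lambda>" using pdual_anti[OF lK(3)] pdual_pdual[OF lL(1)] lL(2) by simp
    moreover have "twist 1 (pdual K) \<subseteq> pdual (pdual K)"
      using twist_mono[OF sub, of 1] L.twist_L lK(3) unfolding ppK by blast
    ultimately show ?thesis using pdual_invariant[OF lK(1,2)] by blast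
  qed
  have lIJ: "lat I" "lat J" "\<tau> ` I = I" "\<tau> ` J = J" using IJ(1,2) by (auto simp: L.isotropic_def)
  have "pdual (pdual I + pdual J) = pdual (pdual I) \<inter> pdual (pdual J)"
    by (intro pdual_plus lat_submod lat_pdual lIJ)
  also have "\<dots> = pdual \<Lambda>" unfolding pdual_pdual[OF lIJ(1)] pdual_pdual[OF lIJ(2)] lIJ(3,4) IJ(5) ..
  finally have eq: "pdual (pdual I + pdual J) = pdual \<Lambda>" .
  have "lat (pdual I + pdual J)" by (intro lat_plus lat_pdual lIJ)
  then have "pdual I + pdual J = \<Lambda>" using lL(1) eq by (rule pdual_inject)
  then show ?thesis using iso[OF IJ(1,3)] iso[OF IJ(2,4)] by blast
qed

text \<open>The minimum in the formula for the volume of M + I is vol M + d, because I lies between S and \<Lambda>.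
  In the formula for M' the first term is at least vol I + 1 + d', which is larger, so that the
  volume of \<Lambda>' + I has to be vol M + d. It is also at least the volume vol M + d' of \<Lambda>'.\<close>

lemma special_distance:
  assumes M: "special M" and M': "special M'"
    and I: "special I" "\<tau> ` I = I" "I \<subseteq> fst (VW_invariant \<tau> M)"
    and dist: "vol (M + I) = vol (M' + I)" and le: "snd (VW_invariant \<tau> M) \<le> snd (VW_invariant \<tau> M')"
  shows "I \<subseteq> fst (VW_invariant \<tau> M') \<and> snd (VW_invariant \<tau> M') = snd (VW_invariant \<tau> M)"
proof -
  interpret M: special_lattice scale v \<epsilon> n b \<sigma> \<tau> H \<eta> M by unfold_locales (rule M)
  interpret M': special_lattice scale v \<epsilon> n b \<sigma> \<tau> H \<eta> M' by unfold_locales (rule M')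
  have lI: "lat I" "pdual I \<subseteq> I" using I(1) by (auto simp: special_def)
  have IL: "I \<subseteq> M.\<Lambda>" using I(3) M.VW_invariant_eq by simp
  have le: "M.d \<le> M'.d" using le M.VW_invariant_eq M'.VW_invariant_eq by simp
  have v: "vol I = vol M" "vol M' = vol M" using special_vol[OF I(1) M] special_vol[OF M' M] by auto
  have "M.S + I = I" using pdual_anti[OF IL] lI unfolding M.S_def
    by (intro plus_absorb submod_pdual lat_submod) auto
  moreover have "M.\<Lambda> + I = M.\<Lambda>" using IL lI(1) M.lat_Lambda by (intro plus_absorb2 lat_submod)
  ultimately have "vol (M + I) = vol M + int M.d"
    using M.vol_plus_invariant[OF lI(1) I(2)] M.vol_Lambda v by simp
  moreover have "vol I \<le> vol (M'.S + I)"
    by (intro vol_mono lat_plus M'.lat_S lI subset_plus_right lat_submod)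
  ultimately have dd: "vol (M'.\<Lambda> + I) = vol M + int M.d"
    using M'.vol_plus_invariant[OF lI(1) I(2)] dist v le by linarith
  have L: "lat (M'.\<Lambda> + I)" "M'.\<Lambda> \<subseteq> M'.\<Lambda> + I" "I \<subseteq> M'.\<Lambda> + I"
    using M'.lat_Lambda lI(1) by (auto intro: lat_plus subset_plus_left[THEN subsetD] subset_plus_right[THEN subsetD] lat_submod)
  have "vol M'.\<Lambda> \<le> vol (M'.\<Lambda> + I)" by (intro vol_mono M'.lat_Lambda L)
  then have "M'.d = M.d" using dd M'.vol_Lambda v le by simp
  moreover from this have "M'.\<Lambda> = M'.\<Lambda> + I" using dd M'.vol_Lambda v by (intro vol_eqD M'.lat_Lambda L) simp
  then have "I \<subseteq> M'.\<Lambda>" using L(3) by simp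
  ultimately show ?thesis using M.VW_invariant_eq M'.VW_invariant_eq by simp
qed

lemma VW_invariant_eqI:
  assumes M: "special M" and M': "special M'"
    and dist: "\<And>I. special I \<Longrightarrow> \<tau> ` I = I \<Longrightarrow> twist 1 I \<subseteq> pdual I \<Longrightarrow> vol (M + I) = vol (M' + I)"
    and le: "snd (VW_invariant \<tau> M) \<le> snd (VW_invariant \<tau> M')"
  shows "VW_invariant \<tau> M = VW_invariant \<tau> M'"
proof -
  interpret M: special_lattice scale v \<epsilon> n b \<sigma> \<tau> H \<eta> M by unfold_locales (rule M)
  interpret M': special_lattice scale v \<epsilon> n b \<sigma> \<tau> H \<eta> M' by unfold_locales (rule M')
  obtain I J where IJ: "special I" "special J" "\<tau> ` I = I" "\<tau> ` J = J" "twist 1 I \<subseteq> pdual I"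
      "twist 1 J \<subseteq> pdual J" "I + J = M.\<Lambda>"
    using Lambda_sum_of_special[OF M] unfolding M.VW_invariant_eq by auto
  have sm: "submod I" "submod J" using IJ(1,2) by (simp_all add: special_def lat_submod)
  have sub: "I \<subseteq> M.\<Lambda>" "J \<subseteq> M.\<Lambda>"
    unfolding IJ(7)[symmetric] by (rule subset_plus_left[OF sm(2)], rule subset_plus_right[OF sm(1)])
  have K: "K \<subseteq> M'.\<Lambda> \<and> M'.d = M.d" if "special K" "\<tau> ` K = K" "twist 1 K \<subseteq> pdual K" "K \<subseteq> M.\<Lambda>" for K
    using special_distance[OF M M' that(1,2) _ dist[OF that(1-3)] le] that(4)
    unfolding M.VW_invariant_eq M'.VW_invariant_eq by simp
  have "M.\<Lambda> \<subseteq> M'.\<Lambda>" unfolding IJ(7)[symmetric]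
    using K[OF IJ(1,3,5) sub(1)] K[OF IJ(2,4,6) sub(2)] by (intro plus_subset lat_submod M'.lat_Lambda) auto
  moreover have dd: "M'.d = M.d" using K[OF IJ(1,3,5) sub(1)] by blast
  ultimately have "M.\<Lambda> = M'.\<Lambda>"
    using M.vol_Lambda M'.vol_Lambda special_vol[OF M M'] by (intro vol_eqD M.lat_Lambda M'.lat_Lambda) auto
  then show ?thesis unfolding M.VW_invariant_eq M'.VW_invariant_eq using dd by simp
qed

lemma vol_plus_determined:
  assumes M: "special M" and M': "special M'" and eq: "VW_invariant \<tau> M = VW_invariant \<tau> M'"
    and Y: "lat Y" "\<tau> ` Y = Y"
  shows "vol (M + Y) = vol (M' + Y)"
proof -
  interpret M: special_lattice scale v \<epsilon> n b \<sigma> \<tau> H \<eta> M by unfold_locales (rule M)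
  interpret M': special_lattice scale v \<epsilon> n b \<sigma> \<tau> H \<eta> M' by unfold_locales (rule M')
  have "M.\<Lambda> = M'.\<Lambda>" "M.d = M'.d" using eq unfolding M.VW_invariant_eq M'.VW_invariant_eq by auto
  then show ?thesis
    unfolding M.vol_plus_invariant[OF Y] M'.vol_plus_invariant[OF Y] M.S_def M'.S_def by simp
qed

lemma dual_condition_imp_special:
  assumes "lat M" "dual_condition v scale \<epsilon> n V H 1 M" shows "special M"
proof -
  have sub: "pdual M \<subseteq> M" and "len (pdual M) M = enat 1"
    using assms(2) unfolding dual_condition_def sub_of_length_def twist_dual by simp_all
  then have "vol M - vol (pdual M) = 1"
    using len_vol[OF lat_pdual[OF assms(1)] assms(1) sub] by auto
  then show ?thesis using assms(1) sub by (simp add: special_def)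
qed

lemma special_imp_dual_condition:
  assumes M: "special M" and tw: "twist 1 M \<subseteq> pdual M" and n: "1 \<le> n"
  shows "dual_condition v scale \<epsilon> n V H 1 M"
proof -
  have lM: "lat M" "pdual M \<subseteq> M" "vol M = vol (pdual M) + 1" using M by (auto simp: special_def)
  have dual: "dual_lattice v V H M = twist (- 1) (pdual M)" unfolding twist_dual[symmetric] by simp
  have lD: "lat (twist (- 1) (pdual M))" by (intro lat_twist lat_pdual lM)
  have "twist (- 1) (twist 1 M) \<subseteq> twist (- 1) (pdual M)" using tw by (rule twist_mono)
  then have sub: "M \<subseteq> twist (- 1) (pdual M)" by simp
  have "vol (twist (- 1) (pdual M)) - vol M = int n - 1"
    using vol_twist[OF lat_pdual[OF lM(1)], of "- 1"] lM(3) by simp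
  then have "len M (twist (- 1) (pdual M)) = enat (n - 1)"
    unfolding len_vol(1)[OF lM(1) lD sub] using n by simp
  moreover have "len (pdual M) M = enat 1"
    unfolding len_vol(1)[OF lat_pdual[OF lM(1)] lM(1,2)] using lM(3) by simp
  ultimately show ?thesis
    unfolding dual_condition_def sub_of_length_def twist_dual using lM(2) sub by (simp add: dual)
qed

theorem VW_invariant_eq_iff:
  assumes n: "1 \<le> n"
    and M: "lattice_in v scale V M" "dual_condition v scale \<epsilon> n V H 1 M"
    and M': "lattice_in v scale V M'" "dual_condition v scale \<epsilon> n V H 1 M'"
  shows "VW_invariant \<tau> M = VW_invariant \<tau> M' \<longleftrightarrow>
    (\<forall>\<Lambda>'. lattice_in v scale V \<Lambda>' \<longrightarrow> invariant_under \<tau> \<Lambda>' \<longrightarrow>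
       (\<exists>i. dual_condition v scale \<epsilon> n V H i \<Lambda>') \<longrightarrow>
       rel_pos v scale \<epsilon> n M \<Lambda>' = rel_pos v scale \<epsilon> n M' \<Lambda>')"
proof -
  have lM: "lat M" "lat M'" using M(1) M'(1) unfolding lattice_in_iff .
  have sM: "special M" "special M'" using dual_condition_imp_special lM M(2) M'(2) by auto
  note pos = rel_pos_eq_iff[OF lM _ special_vol[OF sM]]
  show ?thesis
  proof
    assume eq: "VW_invariant \<tau> M = VW_invariant \<tau> M'"
    show "\<forall>\<Lambda>'. lattice_in v scale V \<Lambda>' \<longrightarrow> invariant_under \<tau> \<Lambda>' \<longrightarrow>
       (\<exists>i. dual_condition v scale \<epsilon> n V H i \<Lambda>') \<longrightarrow>
       rel_pos v scale \<epsilon> n M \<Lambda>' = rel_pos v scale \<epsilon> n M' \<Lambda>'"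
    proof (intro allI impI)
      fix N assume N: "lattice_in v scale V N" "invariant_under \<tau> N"
      have lN: "lat N" "\<tau> ` N = N" using N unfolding lattice_in_iff invariant_under_def by auto
      have "\<tau> ` twist j N = twist j N" for j unfolding tau_twist lN(2) ..
      then show "rel_pos v scale \<epsilon> n M N = rel_pos v scale \<epsilon> n M' N"
        unfolding pos[OF lN(1)] using vol_plus_determined[OF sM eq] lat_twist[OF lN(1)] by blast
    qed
  next
    assume *: "\<forall>\<Lambda>'. lattice_in v scale V \<Lambda>' \<longrightarrow> invariant_under \<tau> \<Lambda>' \<longrightarrow>
       (\<exists>i. dual_condition v scale \<epsilon> n V H i \<Lambda>') \<longrightarrow>
       rel_pos v scale \<epsilon> n M \<Lambda>' = rel_pos v scale \<epsilon> n M' \<Lambda>'"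
    have dist: "vol (M + I) = vol (M' + I)" if I: "special I" "\<tau> ` I = I" "twist 1 I \<subseteq> pdual I" for I
    proof -
      have lI: "lat I" using I(1) by (simp add: special_def)
      have "rel_pos v scale \<epsilon> n M I = rel_pos v scale \<epsilon> n M' I"
        using * lI I(2) special_imp_dual_condition[OF I(1,3) n] unfolding lattice_in_iff invariant_under_def by blast
      then have "vol (M + twist 0 I) = vol (M' + twist 0 I)" unfolding pos[OF lI] by blast
      then show ?thesis by simp
    qed
    show "VW_invariant \<tau> M = VW_invariant \<tau> M'"
    proof (cases "snd (VW_invariant \<tau> M) \<le> snd (VW_invariant \<tau> M')")
      case True
      then show ?thesis using VW_invariant_eqI[OF sM] dist by blast
    next
      case False
      then have "VW_invariant \<tau> M' = VW_invariant \<tau> M"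
        using VW_invariant_eqI[OF sM(2,1)] dist by (metis nat_le_linear)
      then show ?thesis ..
    qed
  qed
qed

end

section \<open>The unitary isocrystal\<close>

lemma (in unramified_completion) uniformizer: "\<epsilon> \<noteq> 0 \<and> v \<epsilon> = 1 \<and> \<epsilon> \<in> F"
  using F_cases
proof
  assume w: "witt_fraction_field p v res F \<epsilon>"
  have "of_nat k \<in> F" for k
    using subfield_F by (induction k) (auto simp: is_subfield_def)
  moreover have "of_nat p \<noteq> (0::'l)"
    using w prime_p by (auto simp: witt_fraction_field_def of_nat_eq_0_iff_char_dvd prime_gt_0_nat)
  ultimately show ?thesis using w by (simp add: witt_fraction_field_def)
next
  assume "laurent_series_field v res F \<epsilon>"
  then obtain \<iota> :: "'k fls \<Rightarrow> 'l" where \<iota>: "\<iota> 1 = 1" "\<And>a b. \<iota> (a * b) = \<iota> a * \<iota> b" "range \<iota> = F"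
      "\<iota> fls_X = \<epsilon>" "\<And>a. a \<noteq> 0 \<Longrightarrow> v (\<iota> a) = fls_subdegree a"
    unfolding laurent_series_field_def by blast
  have "\<epsilon> * \<iota> (inverse fls_X) = 1" unfolding \<iota>(4)[symmetric] \<iota>(2)[symmetric] using \<iota>(1) by simp
  then have "\<epsilon> \<noteq> 0" by auto
  moreover have "v \<epsilon> = 1" using \<iota>(5)[of fls_X] \<iota>(4) by simp
  moreover have "\<epsilon> \<in> F" using \<iota>(3,4) by blast
  ultimately show ?thesis by blast
qed

lemma (in unramified_completion) residue_cardinality: "1 < p ^ r"
proof -
  have "card {0, 1 :: 'k} \<le> card (UNIV :: 'k set)" by (intro card_mono) auto
  then show ?thesis using card_k by simp
qed

text \<open>The basis vector with index n has norm \<delta>^2 and the others \<epsilon> \<delta>^2, because the last pair of basis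
  vectors is treated differently by \<Phi>; \<delta>^2 is fixed by \<sigma>.\<close>

lemma unitary_isocrystal_hermitian:
  fixes v :: "'l::field \<Rightarrow> int" and res :: "'l \<Rightarrow> 'k::{finite,field} alg_closure"
    and scale :: "'l \<Rightarrow> 'v::ab_group_add \<Rightarrow> 'v"
  assumes "unramified_completion p r v res F \<epsilon> \<sigma>"
    and \<delta>: "\<delta> \<noteq> 0" "\<sigma> \<delta> = - \<delta>"
    and "unitary_isocrystal scale \<sigma> \<epsilon> \<delta> n g h \<Phi> B"
  shows "residue_isocrystal scale v \<epsilon> n (\<lambda>i. g (Suc i)) \<sigma> (tau scale \<epsilon> \<Phi>) (herm \<delta> \<Phi> B)
    (\<lambda>i. if Suc i = n then \<delta> * \<delta> else \<epsilon> * (\<delta> * \<delta>)) res (p ^ r)"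
proof -
  interpret L: unramified_completion p r v res F \<epsilon> \<sigma> by fact
  interpret N: unitary_isocrystal scale \<sigma> \<epsilon> \<delta> n g h \<Phi> B by fact
  have eps: "\<epsilon> \<noteq> 0" "v \<epsilon> = 1" "\<sigma> \<epsilon> = \<epsilon>" using L.uniformizer L.frob_fixes_F by auto
  have tau: "tau scale \<epsilon> \<Phi> x = scale (inverse \<epsilon>) (\<Phi> (\<Phi> x))" for x by (simp add: tau_def)
  have herm: "herm \<delta> \<Phi> B x y = \<delta> * B x (\<Phi> y)" for x y by (simp add: herm_def)
  have Phi_g: "\<Phi> (g j) = (if j = n then h n else scale \<epsilon> (h j))" if "j \<in> {1..n}" for j
    using N.Phi_gn N.Phi_g[of j] that by auto
  interpret S: valued_space scale v \<epsilon>
    by unfold_locales (use L.valuation eps in auto)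
  have im: "(\<lambda>i. g (Suc i)) ` {..<n} = g ` {1..n}"
    unfolding image_image[of g Suc, symmetric] image_Suc_lessThan ..
  have "S.frame n (\<lambda>i. g (Suc i))"
    unfolding S.frame_def im
  proof
    show "inj_on (\<lambda>i. g (Suc i)) {..<n}"
    proof (rule inj_onI)
      fix i j assume "i \<in> {..<n}" "j \<in> {..<n}" "g (Suc i) = g (Suc j)"
      then have "Suc i = Suc j" by (intro inj_onD[OF N.basis_inj(1)]) auto
      then show "i = j" by simp
    qed
    show "N.independent (g ` {1..n})"
      using N.basis_indep by (rule N.independent_mono) simp
  qed
  moreover have "bij (tau scale \<epsilon> \<Phi>)"
  proof (rule bijI)
    have "inj \<Phi>" using N.Phi_bij by (rule bij_is_inj)
    then show "inj (tau scale \<epsilon> \<Phi>)"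
      using eps(1) by (intro injI) (simp add: tau inj_eq)
    have "y = tau scale \<epsilon> \<Phi> (inv_into UNIV \<Phi> (inv_into UNIV \<Phi> (scale \<epsilon> y)))" for y
      using N.Phi_bij eps(1) by (simp add: tau bij_is_surj surj_f_inv_f)
    then show "surj (tau scale \<epsilon> \<Phi>)" by (rule surjI[OF sym])
  qed
  moreover have "tau scale \<epsilon> \<Phi> (g (Suc i)) = g (Suc i)" if "i < n" for i
  proof (cases "Suc i = n")
    case True
    then show ?thesis using eps(1) by (simp add: tau N.Phi_gn N.Phi_hn)
  next
    case False
    then have "Suc i \<in> {1..<n}" using that by auto
    then show ?thesis using eps(1,3) by (simp add: tau N.Phi_g N.Phi_h N.Phi_scale)
  qed
  moreover have "herm \<delta> \<Phi> B (g (Suc i)) (g (Suc j)) =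
      (if i = j then (if Suc i = n then \<delta> * \<delta> else \<epsilon> * (\<delta> * \<delta>)) else 0)" if "i < n" "j < n" for i j
  proof -
    have "Suc i \<in> {1..n}" "Suc j \<in> {1..n}" "n \<in> {1..n}" using that by auto
    then show ?thesis
      by (simp add: herm Phi_g N.B_scale_right N.B_gh)
  qed
  moreover have "tau scale \<epsilon> \<Phi> (scale c x) = scale (\<sigma> (\<sigma> c)) (tau scale \<epsilon> \<Phi> x)" for c x
    by (simp add: tau N.Phi_scale mult.commute)
  ultimately show ?thesis
    using L.frob_bij L.frob_add L.frob_mult L.frob_val eps \<delta> L.residue L.residue_cardinality L.frob_res
    by unfold_locales
      (simp_all add: tau herm N.Phi_add N.scale_right_distrib N.B_add_left N.B_add_right distrib_left
        N.B_scale_left N.B_scale_right N.Phi_scale)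
qed

theorem theorem4p6:
  fixes p r n :: nat
    and v :: "'l::field \<Rightarrow> int"
    and res :: "'l \<Rightarrow> 'k::{finite,field} alg_closure"
    and F E :: "'l set"
    and \<epsilon> \<delta> :: 'l
    and \<sigma> :: "'l \<Rightarrow> 'l"
    and scale :: "'l \<Rightarrow> 'v::ab_group_add \<Rightarrow> 'v"
    and g h :: "nat \<Rightarrow> 'v"
    and \<Phi> :: "'v \<Rightarrow> 'v"
    and B :: "'v \<Rightarrow> 'v \<Rightarrow> 'l"
    and M0 M0' :: "'v set"
    and V :: "'v set" and H :: "'v \<Rightarrow> 'v \<Rightarrow> 'l" and \<tau> :: "'v \<Rightarrow> 'v"
  assumes "unramified_completion p r v res F \<epsilon> \<sigma>"
    and "unramified_quadratic_ext v F E"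
    and "\<delta> \<in> E" "\<delta> \<noteq> 0" "v \<delta> = 0" "\<sigma> \<delta> = - \<delta>"
    and "unitary_isocrystal scale \<sigma> \<epsilon> \<delta> n g h \<Phi> B"
    and "V = N0 scale n g" "H = herm \<delta> \<Phi> B" "\<tau> = tau scale \<epsilon> \<Phi>"
    and "lattice_in v scale V M0" "dual_condition v scale \<epsilon> n V H 1 M0"
    and "lattice_in v scale V M0'" "dual_condition v scale \<epsilon> n V H 1 M0'"
  shows "VW_invariant \<tau> M0 = VW_invariant \<tau> M0' \<longleftrightarrow>
    (\<forall>\<Lambda>'. lattice_in v scale V \<Lambda>' \<longrightarrow> invariant_under \<tau> \<Lambda>' \<longrightarrow>
       (\<exists>i. dual_condition v scale \<epsilon> n V H i \<Lambda>') \<longrightarrow>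
       rel_pos v scale \<epsilon> n M0 \<Lambda>' = rel_pos v scale \<epsilon> n M0' \<Lambda>')"
proof -
  interpret I: residue_isocrystal scale v \<epsilon> n "\<lambda>i. g (Suc i)" \<sigma> \<tau> H
    "\<lambda>i. if Suc i = n then \<delta> * \<delta> else \<epsilon> * (\<delta> * \<delta>)" res "p ^ r"
    unfolding assms(9,10) using assms(1,4,6,7) by (rule unitary_isocrystal_hermitian)
  have V: "V = module.span scale ((\<lambda>i. g (Suc i)) ` {..<n})"
    unfolding assms(8) N0_def image_image[of g Suc, symmetric] image_Suc_lessThan ..
  have "1 \<le> n" using assms(7) by (rule unitary_isocrystal.n_pos)
  from I.VW_invariant_eq_iff[OF this assms(11-14)[unfolded V]] show ?thesis unfolding V .
qed

end
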